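(* Let $\{x^k\}_{k\ge0}$ be the random sequence generated by the RBPDN method (described in the context) from $x^0\in\mathrm{dom}(F)$. Suppose $F(x^0)\le F^*+\omega(c_1/p_{\min})$. Then $$\mathbf{E}[F(x^k)-F^*]\le\left[\frac{6c_2+p_{\min}^2(1-\theta)}{6c_2+p_{\min}^2}\right]^k(F(x^0)-F^* ),\qquad\forall k\ge0,$$ where $$c_2:=\left|\theta\left[\left(\frac{L_f}{\sigma_f}\right)^{3/2}\frac{2(1-\eta^2)}{c_1\sqrt n}-1\right]+\left(\frac12+\eta\right)p_{\max}\right|,$$ $$p_{\max}:=\max_{1\le i\le n}p_i,\qquad \theta:=\min_{1\le i\le n}\inf_{x\in\mathcal{S}(x^0)}\frac{p_i}{1+\lambda_i(x)}\in(0,1),$$ and $p_{\min}$, $c_1$, $\sigma_f$, $L_f$, $\omega$ are as defined in the context.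
   Context: Problem and standing assumptions. Consider $F^*=\min_{x\in\mathbb{R}^N}\{F(x):=f(x)+g(x)\}$, where $f,g:\mathbb{R}^N\to\mathbb{R}\cup\{\infty\}$. The components of $x\in\mathbb{R}^N$ are partitioned into subvectors $x_1,\dots,x_n$ with $x_i\in\mathbb{R}^{N_i}$, and $g(x)=\sum_{i=1}^n g_i(x_i)$ with each $g_i:\mathbb{R}^{N_i}\to\mathbb{R}\cup\{\infty\}$ proper closed convex. The function $f$ is standard self-concordant: it is a closed convex function with open domain $\mathrm{dom}(f)$, three times continuously differentiable on $\mathrm{dom}(f)$, and $|\psi'''(0)|\le 2(\psi''(0))^{3/2}$ for all $x\in\mathrm{dom}(f)$, $u\in\mathbb{R}^N$, where $\psi(t)=f(x+tu)$. Also $\nabla^2 f$ is continuous and positive definite on $\mathrm{dom}(F)$, and the problem has a unique optimal solution $x^*$ (so $F^*=F(x^* )$). Notation. $\|\cdot\|$ is the Euclidean norm of a vector or spectral norm of a matrix. $\nabla_i f(x)$ is the subvector of $\nabla f(x)$, and $\nabla^2_{ii}f(x)$ the submatrix of $\nabla^2 f(x)$, corresponding to $x_i$. For $y,z\in\mathbb{R}^{N_i}$, $\|y\|_{x_i}:=\sqrt{\langle y,\nabla^2_{ii}f(x)y\rangle}$ and $\|z\|^*_{x_i}:=\sqrt{\langle z,(\nabla^2_{ii}f(x))^{-1}z\rangle}$. RBPDN method. Fix $x^0\in\mathrm{dom}(F)$, $\eta\in[0,1/4]$ and $p_1,\dots,p_n>0$ with $\sum_i p_i=1$. For each $x\in\mathrm{dom}(F)$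 and each $i$, $d_i(x)\in\mathbb{R}^{N_i}$ denotes an approximate solution of $\min_{d_i}\{f(x)+\langle\nabla_i f(x),d_i\rangle+\frac12\langle d_i,\nabla^2_{ii}f(x)d_i\rangle+g_i(x_i+d_i)\}$ in the sense that, for some $v_i$, $-v_i\in\nabla_i f(x)+\nabla^2_{ii}f(x)d_i(x)+\partial g_i(x_i+d_i(x))$ and $\|v_i\|^*_{x_i}\le\eta\|d_i(x)\|_{x_i}$. Put $\lambda_i(x):=\|d_i(x)\|_{x_i}$. At iteration $k\ge0$, pick $\iota\in\{1,\dots,n\}$ at random (independently of the past) with probability $p_\iota$, and set $x^{k+1}_j=x^k_j$ for $j\ne\iota$ and $x^{k+1}_\iota=x^k_\iota+d_\iota(x^k)/(1+\lambda_\iota(x^k))$. $\mathbf{E}$ is expectation over all random block choices. Constants. $\mathcal{S}(x^0):=\{x:F(x)\le F(x^0)\}$ (a compact set), $\sigma_f:=\min_{x\in\mathcal{S}(x^0)}\lambda_{\min}(\nabla^2 f(x))$ with $\lambda_{\min}$ the minimal eigenvalue, $L_f:=\max_{x\in\mathcal{S}(x^0)}\|\nabla^2 f(x)\|$, $H(x):=\mathrm{Diag}(\nabla^2_{11}f(x),\dots,\nabla^2_{nn}f(x))$ (block diagonal), $p_{\min}:=\min_i p_i$, $\omega(t):=t-\ln(1+t)$, and $$c_1:=\frac{1-\eta}{\sqrt n\,\max_{x\in\mathcal{S}(x^0)}\left\{(1+\eta)\|H(x)^{1/2}(\nabla^2 f(x))^{-1/2}\|+\|H(x)^{-1/2}(\nabla^2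 f(x))^{1/2}\|\right\}}.$$
   Formalization: The claim θ<1 is stated only when n>1 or F(x^0)≠F^*, since for n=1 and x^0=x^* one has S(x^0)={x^*}, λ_1=0, p_1=1 and θ=1; θ>0 and the rate bound are stated in all cases. *)

theory Defs
  imports "HOL-Probability.Probability"
begin

section \<open>Extended-valued convex functions\<close>

definition edom :: "('a \<Rightarrow> ereal) \<Rightarrow> 'a set" where
  "edom h = {x. h x < \<infinity>}"

definition proper_on :: "'a set \<Rightarrow> ('a \<Rightarrow> ereal) \<Rightarrow> bool" where
  "proper_on A h \<longleftrightarrow> (\<forall>x\<in>A. h x \<noteq> -\<infinity>) \<and> (\<exists>x\<in>A. h x < \<infinity>)"

text \<open>The library constant \<open>epigraph\<close> only covers real-valued functions.\<close>

definition epi_on :: "'a set \<Rightarrow> ('a \<Rightarrow> ereal) \<Rightarrow> ('a \<times> real) set" where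
  "epi_on A h = {(x, t). x \<in> A \<and> h x \<le> ereal t}"

definition closed_convex_on :: "'a::real_normed_vector set \<Rightarrow> ('a \<Rightarrow> ereal) \<Rightarrow> bool" where
  "closed_convex_on A h \<longleftrightarrow> closed (epi_on A h) \<and> convex (epi_on A h)"

text \<open>Subdifferential of a function on the subspace \<open>V\<close>. For proper \<open>h\<close> it is empty at
  points where \<open>h\<close> is infinite.\<close>

definition subdiff_on :: "'a::real_inner set \<Rightarrow> ('a \<Rightarrow> ereal) \<Rightarrow> 'a \<Rightarrow> 'a set" where
  "subdiff_on V h y = {s \<in> V. \<forall>z\<in>V. h y + ereal (s \<bullet> (z - y)) \<le> h z}"

section \<open>Derivatives and self-concordance\<close>

text \<open>An extended-valued function is differentiated through its real part, which is only done at
  points of its open domain, where it is finite.\<close>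

abbreviation re :: "('a \<Rightarrow> ereal) \<Rightarrow> 'a \<Rightarrow> real" where
  "re h \<equiv> \<lambda>x. real_of_ereal (h x)"

text \<open>\<open>k\<close> times continuously differentiable on the open set \<open>S\<close>.\<close>

fun Ck_on :: "nat \<Rightarrow> 'a::euclidean_space set \<Rightarrow> ('a \<Rightarrow> real) \<Rightarrow> bool" where
  "Ck_on 0 S h \<longleftrightarrow> continuous_on S h"
| "Ck_on (Suc k) S h \<longleftrightarrow>
     (\<forall>x\<in>S. h differentiable (at x)) \<and>
     (\<forall>b\<in>Basis. Ck_on k S (\<lambda>x. frechet_derivative h (at x) b))"

definition grad :: "(real^'n \<Rightarrow> ereal) \<Rightarrow> real^'n \<Rightarrow> real^'n" where
  "grad f x = (\<chi> j. frechet_derivative (re f) (at x) (axis j 1))"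

definition hessian :: "(real^'n \<Rightarrow> ereal) \<Rightarrow> real^'n \<Rightarrow> real^'n^'n" where
  "hessian f x = jacobian (grad f) (at x)"

definition self_concordant :: "(real^'n \<Rightarrow> ereal) \<Rightarrow> bool" where
  "self_concordant f \<longleftrightarrow>
     (\<forall>x. f x \<noteq> -\<infinity>) \<and> closed_convex_on UNIV f \<and> open (edom f) \<and> Ck_on 3 (edom f) (re f) \<and>
     (\<forall>x\<in>edom f. \<forall>u. let \<psi> = (\<lambda>t::real. re f (x + t *\<^sub>R u)) in
        \<bar>(deriv ^^ 3) \<psi> 0\<bar> \<le> 2 * ((deriv ^^ 2) \<psi> 0) powr (3/2))"

section \<open>Matrices\<close>

definition pos_def :: "real^'n^'n \<Rightarrow> bool" where
  "pos_def A \<longleftrightarrow> transpose A = A \<and> (\<forall>v. v \<noteq> 0 \<longrightarrow> 0 < v \<bullet> (A *v v))"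

definition pos_semidef :: "real^'n^'n \<Rightarrow> bool" where
  "pos_semidef A \<longleftrightarrow> transpose A = A \<and> (\<forall>v. 0 \<le> v \<bullet> (A *v v))"

text \<open>The square root of a symmetric positive semidefinite matrix.\<close>

definition matrix_sqrt :: "real^'n^'n \<Rightarrow> real^'n^'n" where
  "matrix_sqrt A = (THE B. pos_semidef B \<and> B ** B = A)"

definition eigenvalues :: "real^'n^'n \<Rightarrow> real set" where
  "eigenvalues A = {\<mu>. \<exists>v. v \<noteq> 0 \<and> A *v v = \<mu> *\<^sub>R v}"

definition lambda_min :: "real^'n^'n \<Rightarrow> real" where
  "lambda_min A = Min (eigenvalues A)"

definition spectral_norm :: "real^'n^'n \<Rightarrow> real" where
  "spectral_norm A = onorm ((*v) A)"

section \<open>Block structure\<close>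

text \<open>The blocks are indexed by a finite type \<open>'b\<close>, so that \<open>n = CARD('b)\<close> and \<open>N = CARD('n)\<close>,
  and \<open>blk j\<close> is the block to which coordinate \<open>j\<close> belongs. As the dimensions \<open>N\<^sub>i\<close> vary with \<open>i\<close>,
  the space of the \<open>i\<close>-th subvectors is represented by the coordinate subspace of the vectors
  vanishing outside block \<open>i\<close>, and a matrix of size \<open>N\<^sub>i \<times> N\<^sub>i\<close> by its zero-padding to size
  \<open>N \<times> N\<close>.\<close>

definition block_space :: "('n \<Rightarrow> 'b) \<Rightarrow> 'b \<Rightarrow> (real^'n) set" where
  "block_space blk i = {y. \<forall>j. blk j \<noteq> i \<longrightarrow> y $ j = 0}"

definition subvec :: "('n \<Rightarrow> 'b) \<Rightarrow> 'b \<Rightarrow> real^'n \<Rightarrow> real^'n" where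
  "subvec blk i x = (\<chi> j. if blk j = i then x $ j else 0)"

definition submat :: "('n \<Rightarrow> 'b) \<Rightarrow> 'b \<Rightarrow> real^'n^'n \<Rightarrow> real^'n^'n" where
  "submat blk i A = (\<chi> j k. if blk j = i \<and> blk k = i then A $ j $ k else 0)"

text \<open>Inverse of the diagonal block \<open>A\<^sub>i\<^sub>i\<close>; \<open>submat blk i (mat 1)\<close> is the (padded) identity matrix of
  size \<open>N\<^sub>i\<close>, and \<open>submat blk i B = B\<close> says that \<open>B\<close> is a (padded) matrix of size \<open>N\<^sub>i \<times> N\<^sub>i\<close>.\<close>

definition submat_inv :: "('n \<Rightarrow> 'b) \<Rightarrow> 'b \<Rightarrow> real^'n^'n \<Rightarrow> real^'n^'n" where
  "submat_inv blk i A = (SOME B. submat blk i B = B \<and>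
     submat blk i A ** B = submat blk i (mat 1) \<and> B ** submat blk i A = submat blk i (mat 1))"

definition block_diag :: "('n \<Rightarrow> 'b::finite) \<Rightarrow> real^'n^'n \<Rightarrow> real^'n^'n" where
  "block_diag blk A = (\<Sum>i\<in>UNIV. submat blk i A)"

section \<open>The method\<close>

definition objective ::
  "('n \<Rightarrow> 'b::finite) \<Rightarrow> (real^'n \<Rightarrow> ereal) \<Rightarrow> ('b \<Rightarrow> real^'n \<Rightarrow> ereal) \<Rightarrow> real^'n \<Rightarrow> ereal" where
  "objective blk f g x = f x + (\<Sum>i\<in>UNIV. g i (subvec blk i x))"

definition local_norm ::
  "('n \<Rightarrow> 'b) \<Rightarrow> (real^'n \<Rightarrow> ereal) \<Rightarrow> 'b \<Rightarrow> real^'n \<Rightarrow> real^'n \<Rightarrow> real" where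
  "local_norm blk f i x y = sqrt (y \<bullet> (submat blk i (hessian f x) *v y))"

definition local_dual_norm ::
  "('n \<Rightarrow> 'b) \<Rightarrow> (real^'n \<Rightarrow> ereal) \<Rightarrow> 'b \<Rightarrow> real^'n \<Rightarrow> real^'n \<Rightarrow> real" where
  "local_dual_norm blk f i x z = sqrt (z \<bullet> (submat_inv blk i (hessian f x) *v z))"

definition approx_direction ::
  "('n \<Rightarrow> 'b) \<Rightarrow> (real^'n \<Rightarrow> ereal) \<Rightarrow> ('b \<Rightarrow> real^'n \<Rightarrow> ereal) \<Rightarrow> real \<Rightarrow> 'b \<Rightarrow> real^'n \<Rightarrow> real^'n \<Rightarrow> bool"
  where
  "approx_direction blk f g \<eta> i x e \<longleftrightarrow>
     e \<in> block_space blk i \<and>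
     (\<exists>v\<in>block_space blk i.
        (\<exists>s\<in>subdiff_on (block_space blk i) (g i) (subvec blk i x + e).
           - v = subvec blk i (grad f x) + submat blk i (hessian f x) *v e + s) \<and>
        local_dual_norm blk f i x v \<le> \<eta> * local_norm blk f i x e)"

definition decrement ::
  "('n \<Rightarrow> 'b) \<Rightarrow> (real^'n \<Rightarrow> ereal) \<Rightarrow> ('b \<Rightarrow> real^'n \<Rightarrow> real^'n) \<Rightarrow> 'b \<Rightarrow> real^'n \<Rightarrow> real" where
  "decrement blk f d i x = local_norm blk f i x (d i x)"

text \<open>The \<open>k\<close>-th iterate along the sequence \<open>c\<close> of chosen blocks. As \<open>d i x\<close> lies in
  \<open>block_space blk i\<close>, a step leaves the coordinates outside the chosen block unchanged.\<close>

primrec rbpdn ::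
  "('n \<Rightarrow> 'b) \<Rightarrow> (real^'n \<Rightarrow> ereal) \<Rightarrow> ('b \<Rightarrow> real^'n \<Rightarrow> real^'n) \<Rightarrow> real^'n \<Rightarrow> (nat \<Rightarrow> 'b) \<Rightarrow> nat \<Rightarrow> real^'n"
  where
  "rbpdn blk f d x0 c 0 = x0"
| "rbpdn blk f d x0 c (Suc k) =
     (let x = rbpdn blk f d x0 c k
      in x + (1 / (1 + decrement blk f d (c k) x)) *\<^sub>R d (c k) x)"

section \<open>Constants\<close>

definition sublevel :: "('a \<Rightarrow> ereal) \<Rightarrow> 'a \<Rightarrow> 'a set" where
  "sublevel F x0 = {x. F x \<le> F x0}"

definition omega :: "real \<Rightarrow> real" where
  "omega t = t - ln (1 + t)"

text \<open>The minima and maxima over the compact set \<open>S\<close> are written as infima and suprema.\<close>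

definition sigma_f :: "(real^'n \<Rightarrow> ereal) \<Rightarrow> (real^'n) set \<Rightarrow> real" where
  "sigma_f f S = (INF x\<in>S. lambda_min (hessian f x))"

definition L_f :: "(real^'n \<Rightarrow> ereal) \<Rightarrow> (real^'n) set \<Rightarrow> real" where
  "L_f f S = (SUP x\<in>S. spectral_norm (hessian f x))"

definition c1_const ::
  "('n \<Rightarrow> 'b::finite) \<Rightarrow> (real^'n \<Rightarrow> ereal) \<Rightarrow> real \<Rightarrow> (real^'n) set \<Rightarrow> real" where
  "c1_const blk f \<eta> S =
     (1 - \<eta>) / (sqrt (real CARD('b)) *
       (SUP x\<in>S. let R = matrix_sqrt (hessian f x); Q = matrix_sqrt (block_diag blk (hessian f x))
          in (1 + \<eta>) * spectral_norm (Q ** matrix_inv R) + spectral_norm (matrix_inv Q ** R)))"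

definition p_min :: "('b::finite \<Rightarrow> real) \<Rightarrow> real" where
  "p_min p = Min (range p)"

definition p_max :: "('b::finite \<Rightarrow> real) \<Rightarrow> real" where
  "p_max p = Max (range p)"

definition theta_const ::
  "('n \<Rightarrow> 'b::finite) \<Rightarrow> (real^'n \<Rightarrow> ereal) \<Rightarrow> ('b \<Rightarrow> real^'n \<Rightarrow> real^'n) \<Rightarrow> ('b \<Rightarrow> real) \<Rightarrow>
   (real^'n) set \<Rightarrow> real" where
  "theta_const blk f d p S = (MIN i\<in>UNIV. INF x\<in>S. p i / (1 + decrement blk f d i x))"

definition c2_const ::
  "('n \<Rightarrow> 'b::finite) \<Rightarrow> (real^'n \<Rightarrow> ereal) \<Rightarrow> ('b \<Rightarrow> real^'n \<Rightarrow> real^'n) \<Rightarrow> ('b \<Rightarrow> real) \<Rightarrow>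
   real \<Rightarrow> (real^'n) set \<Rightarrow> real" where
  "c2_const blk f d p \<eta> S =
     \<bar>theta_const blk f d p S *
        ((L_f f S / sigma_f f S) powr (3/2) *
           (2 * (1 - \<eta>\<^sup>2) / (c1_const blk f \<eta> S * sqrt (real CARD('b)))) - 1)
      + (1/2 + \<eta>) * p_max p\<bar>"

end

theory Submission
  imports Defs
begin

text \<open>
Write \<open>\<lambda>\<^sub>i\<close> for the local length of the inexact Newton direction \<open>d\<^sub>i(x)\<close> of block \<open>i\<close>, \<open>\<Lambda>\<^sup>2\<close> for the sum
of the \<open>\<lambda>\<^sub>i\<^sup>2\<close>, and \<open>E\<close> for the mean of the objective over the random choice of the block to be updated
at \<open>x\<close>. The rate comes from two upper bounds on \<open>E - Fstar\<close> that trade \<open>\<Lambda>\<^sup>2\<close> against each other: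

  \<^item> \<open>E - Fstar \<le> (F(x) - Fstar) - pmin\<^sup>2/6 * \<Lambda>\<^sup>2\<close> (lemma \<open>expected_value_decrease\<close>),
  \<^item> \<open>E - Fstar \<le> (1 - \<theta>) * (F(x) - Fstar) + c2 * \<Lambda>\<^sup>2\<close> (lemma \<open>expected_value_le_model\<close>).

Adding \<open>6 c2\<close> times the first to \<open>pmin\<^sup>2\<close> times the second cancels \<open>\<Lambda>\<^sup>2\<close> and leaves a contraction
with the factor of the theorem (\<open>expected_gap_contraction\<close>). Every step stays in the sublevel set
\<open>S\<close>, so the contraction can be iterated along the independent choices (\<open>expected_contraction\<close>).

Both bounds start from the self-concordant upper bound along \<open>d\<^sub>i\<close> (\<open>self_concordant_step\<close>): the
damped step of local length \<open>\<lambda>\<^sub>i/(1 + \<lambda>\<^sub>i) < 1\<close> remains in the domain, and \<open>f\<close> exceeds its linearisation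
there by at most \<open>ln (1 + \<lambda>\<^sub>i) - \<lambda>\<^sub>i/(1 + \<lambda>\<^sub>i)\<close>. Together with the subgradient inequality for \<open>g\<^sub>i\<close> this
gives a decrease of \<open>\<omega>(\<lambda>\<^sub>i) - \<eta> \<lambda>\<^sub>i\<^sup>2/(1 + \<lambda>\<^sub>i)\<close> for block \<open>i\<close>, which is of order \<open>\<lambda>\<^sub>i\<^sup>2/(1 + \<lambda>\<^sub>i)\<close>. For the
first bound \<open>\<lambda>\<^sub>i\<close> has to be at most \<open>1/(2 pmin)\<close>. This is what the hypothesis on \<open>F(x0)\<close> provides: no
step can decrease \<open>F\<close> by more than \<open>F(x0) - Fstar \<le> \<omega>(c1/pmin)\<close>, and \<open>c1 \<le> (1 - \<eta>)/(2 + \<eta>)\<close> because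
both spectral norms in the definition of \<open>c1\<close> are at least 1 (\<open>c1_const_bounds\<close>, \<open>lam_le\<close>).

For the second bound, the sum over the blocks of the changes of the linearised model is compared with
the change towards the minimiser \<open>xs\<close>. By convexity it is at most \<open>Fstar - F(x) - \<Lambda>\<^sup>2\<close> plus a cross term
between the directions and \<open>xs - x\<close>. The Hessian lies between \<open>\<sigma>\<close> and \<open>L\<close> on the compact convex set
\<open>S\<close>; hence the gradient of \<open>f\<close> is strongly monotone and Lipschitz there, and monotonicity of the
subdifferential of \<open>g\<close> bounds the distance from \<open>x\<close> to \<open>xs\<close> by a multiple of \<open>\<Lambda>\<close> (\<open>error_bound\<close>). So
the cross term is at most a constant times \<open>\<Lambda>\<^sup>2\<close>, and the inequality for \<open>c1\<close> shows that this
constant is at most the one in \<open>c2\<close> (\<open>cross_term_le_decrement\<close>).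
\<close>

section \<open>The functions omega and its conjugate\<close>

lemma omega_deriv: "0 \<le> t \<Longrightarrow> (omega has_real_derivative t / (1 + t)) (at t)"
  unfolding omega_def by (auto intro!: derivative_eq_intros simp: field_simps)

lemma omega_lower:
  assumes "0 \<le> t"
  shows "t\<^sup>2 / (2 * (1 + t)) \<le> omega t"
proof -
  define h where "h \<equiv> \<lambda>t. omega t - t\<^sup>2 / (2 * (1 + t))"
  have "h 0 \<le> h t"
  proof (rule DERIV_nonneg_imp_nondecreasing[OF assms])
    fix s :: real assume s: "0 \<le> s" "s \<le> t"
    have "(h has_real_derivative s / (1 + s) - ((2 * s) * (2 * (1 + s)) - s\<^sup>2 * 2) / (2 * (1 + s))\<^sup>2) (at s)"
      unfolding h_def using s
      by (auto intro!: derivative_eq_intros omega_deriv simp: power2_eq_square)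
    moreover have "s / (1 + s) - ((2 * s) * (2 * (1 + s)) - s\<^sup>2 * 2) / (2 * (1 + s))\<^sup>2
        = s\<^sup>2 / (2 * (1 + s)\<^sup>2)"
      using s by (simp add: divide_simps power2_eq_square) (simp add: algebra_simps)
    ultimately show "\<exists>y. (h has_real_derivative y) (at s) \<and> 0 \<le> y"
      by (intro exI[of _ "s\<^sup>2 / (2 * (1 + s)\<^sup>2)"]) auto
  qed
  thus ?thesis by (simp add: h_def omega_def)
qed

lemma omega_mono:
  assumes "0 \<le> s" "s \<le> t"
  shows "omega s \<le> omega t"
  by (rule DERIV_nonneg_imp_nondecreasing[OF assms(2)])
    (use assms in \<open>auto intro!: exI[of _ "_ / (1 + _)"] omega_deriv divide_nonneg_nonneg\<close>)

lemma omega_above_tangent: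
  assumes "0 \<le> u" "u \<le> t"
  shows "omega u + u / (1 + u) * (t - u) \<le> omega t"
proof -
  define h where "h \<equiv> \<lambda>s. omega s - u / (1 + u) * s"
  have "h u \<le> h t"
  proof (rule DERIV_nonneg_imp_nondecreasing[OF assms(2)])
    fix s :: real assume s: "u \<le> s" "s \<le> t"
    have "(h has_real_derivative s / (1 + s) - u / (1 + u)) (at s)"
      unfolding h_def using s assms
      by (auto intro!: derivative_eq_intros omega_deriv simp: power2_eq_square)
    moreover have "0 \<le> s / (1 + s) - u / (1 + u)"
      using s assms by (simp add: field_simps)
    ultimately show "\<exists>y. (h has_real_derivative y) (at s) \<and> 0 \<le> y" by blast
  qed
  moreover have "u / (1 + u) * (t - u) = u / (1 + u) * t - u / (1 + u) * u"
    by (simp only: right_diff_distrib)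
  ultimately show ?thesis by (simp add: h_def)
qed

text \<open>The decrease of the objective guaranteed by a damped step along a direction of local length \<open>t\<close>:
  an exact direction gives \<open>omega t\<close>, and the relative residual \<open>\<eta>\<close> costs the second term.\<close>

definition decrease :: "real \<Rightarrow> real \<Rightarrow> real" where
  "decrease \<eta> t = omega t - \<eta> * t\<^sup>2 / (1 + t)"

lemma decrease_lower:
  assumes "0 \<le> t"
  shows "(1/2 - \<eta>) * t\<^sup>2 / (1 + t) \<le> decrease \<eta> t"
proof -
  have "(1/2 - \<eta>) * t\<^sup>2 / (1 + t) = t\<^sup>2 / (2 * (1 + t)) - \<eta> * t\<^sup>2 / (1 + t)"
    using assms by (simp add: divide_simps) (simp add: algebra_simps)
  with omega_lower[OF assms] show ?thesis by (simp add: decrease_def)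
qed

lemma decrease_strict_mono:
  assumes "0 \<le> \<eta>" "\<eta> \<le> 1/4" "0 \<le> s" "s < t"
  shows "decrease \<eta> s < decrease \<eta> t"
proof (rule DERIV_pos_imp_increasing_open[OF assms(4)])
  fix r assume r: "s < r" "r < t"
  have "(decrease \<eta> has_real_derivative
      r / (1 + r) - ((\<eta> * (2 * r)) * (1 + r) - \<eta> * r\<^sup>2) / (1 + r)\<^sup>2) (at r)"
    unfolding decrease_def[abs_def] using r assms
    by (auto intro!: derivative_eq_intros omega_deriv simp: power2_eq_square)
  moreover have "r / (1 + r) - ((\<eta> * (2 * r)) * (1 + r) - \<eta> * r\<^sup>2) / (1 + r)\<^sup>2
      = r * ((1 + r) - \<eta> * (2 + r)) / (1 + r)\<^sup>2"
    using r assms by (simp add: divide_simps power2_eq_square) (simp add: algebra_simps)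
  moreover have "\<eta> * (2 + r) < 1 + r"
  proof -
    have "\<eta> * (2 + r) \<le> 1/4 * (2 + r)"
      using r assms by (intro mult_right_mono) auto
    also have "\<dots> < 1 + r" using r assms by simp
    finally show ?thesis .
  qed
  hence "0 < r * ((1 + r) - \<eta> * (2 + r)) / (1 + r)\<^sup>2"
    using r assms by (intro divide_pos_pos mult_pos_pos) auto
  ultimately show "\<exists>y. (decrease \<eta> has_real_derivative y) (at r) \<and> 0 < y" by metis
next
  show "continuous_on {s..t} (decrease \<eta>)"
    unfolding decrease_def[abs_def] omega_def using assms
    by (intro continuous_intros) auto
qed

text \<open>This converts a gap of at most \<open>\<omega>(c1/pmin)\<close> into the bound \<open>1/(2 pmin)\<close> on the decrement, with
  \<open>t = 1/(2 pmin)\<close>. Convexity of \<open>\<omega>\<close> is used through its tangent at \<open>u = \<kappa> t\<close>; the remaining polynomial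
  inequality is an equality at \<open>\<eta> = 1/4\<close>, \<open>t = 1/2\<close>.\<close>

lemma omega_le_decrease:
  assumes \<eta>: "0 \<le> \<eta>" "\<eta> \<le> 1/4" and t: "1/2 \<le> t"
  shows "omega (2 * ((1 - \<eta>) / (2 + \<eta>)) * t) \<le> decrease \<eta> t"
proof -
  define \<kappa> where "\<kappa> = 2 * ((1 - \<eta>) / (2 + \<eta>))"
  define u where "u = \<kappa> * t"
  have \<kappa>: "0 < \<kappa>" "\<kappa> \<le> 1" "1 - \<kappa> = 3 * \<eta> / (2 + \<eta>)"
    using \<eta> by (auto simp: \<kappa>_def field_simps)
  have u: "0 \<le> u" "u \<le> t"
    using \<kappa> t by (auto simp: u_def mult_left_le_one_le)
  have *: "(2 + \<eta>) * (1 + u) \<le> 3 * \<kappa> * (1 + t)"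
  proof -
    have k2: "(2 + \<eta>) * \<kappa> = 2 * (1 - \<eta>)" using \<eta> by (simp add: \<kappa>_def)
    have q: "0 \<le> 2 * (1 - \<eta>) * (1 - \<eta>) * (t - 1/2) + 3 * (1 - 4 * \<eta>)"
      using \<eta> t by (intro add_nonneg_nonneg mult_nonneg_nonneg) auto
    have "(2 + \<eta>) * ((2 + \<eta>) * (1 + u)) = (2 + \<eta>) * (2 + \<eta>) + (2 + \<eta>) * ((2 + \<eta>) * \<kappa>) * t"
      by (simp add: u_def algebra_simps)
    also have "\<dots> = (2 + \<eta>) * (2 + \<eta>) + (2 + \<eta>) * (2 * (1 - \<eta>)) * t" by (simp only: k2)
    also have "\<dots> \<le> 3 * (2 * (1 - \<eta>)) * (1 + t)"
      using q by (simp add: algebra_simps)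
    also have "\<dots> = (2 + \<eta>) * (3 * \<kappa> * (1 + t))" by (subst k2[symmetric]) (simp add: algebra_simps)
    finally show ?thesis using \<eta> by simp
  qed
  have "\<eta> * t\<^sup>2 / (1 + t) \<le> u / (1 + u) * (t - u)"
  proof -
    have P: "0 < (2 + \<eta>) * (1 + u)" using u \<eta> by simp
    have "1 \<le> (3 * \<kappa> * (1 + t)) / ((2 + \<eta>) * (1 + u))"
      using * P by (simp only: le_divide_eq_1_pos)
    hence le: "1 / (1 + t) \<le> 3 * \<kappa> / ((2 + \<eta>) * (1 + u))"
      using t by (simp add: pos_divide_le_eq)
    have "u / (1 + u) * (t - u) = \<kappa> * t\<^sup>2 * (1 - \<kappa>) / (1 + u)"
      by (simp add: u_def power2_eq_square algebra_simps)
    also have "\<dots> = \<eta> * t\<^sup>2 * (3 * \<kappa> / ((2 + \<eta>) * (1 + u)))"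
      unfolding \<kappa>(3) by simp
    also have "\<dots> \<ge> \<eta> * t\<^sup>2 * (1 / (1 + t))"
      using le \<eta> by (intro mult_left_mono) auto
    finally show ?thesis by simp
  qed
  with omega_above_tangent[OF u] show ?thesis
    by (simp add: decrease_def u_def \<kappa>_def)
qed

text \<open>The left-hand side is the conjugate function \<open>-s - ln (1 - s)\<close> at \<open>s = t/(1 + t)\<close>, the excess of \<open>f\<close> over
  its linearisation after a damped step.\<close>

lemma omega_conj_le:
  fixes t :: real
  assumes "0 \<le> t"
  shows "ln (1 + t) - t / (1 + t) \<le> t\<^sup>2 / 2"
proof -
  define h where "h \<equiv> \<lambda>t::real. t\<^sup>2 / 2 - ln (1 + t) + t / (1 + t)"
  have "h 0 \<le> h t"
  proof (rule DERIV_nonneg_imp_nondecreasing[OF assms])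
    fix s :: real assume s: "0 \<le> s" "s \<le> t"
    have "(h has_real_derivative s - 1 / (1 + s) + ((1 + s) - s) / (1 + s)\<^sup>2) (at s)"
      unfolding h_def using s
      by (auto intro!: derivative_eq_intros simp: power2_eq_square)
    moreover have "s - 1 / (1 + s) + ((1 + s) - s) / (1 + s)\<^sup>2 = s * (1 - 1 / (1 + s)\<^sup>2)"
      using s by (simp add: divide_simps power2_eq_square) (simp add: algebra_simps)
    moreover have "0 \<le> s * (1 - 1 / (1 + s)\<^sup>2)" using s by (auto intro!: mult_nonneg_nonneg)
    ultimately show "\<exists>y. (h has_real_derivative y) (at s) \<and> 0 \<le> y" by metis
  qed
  thus ?thesis by (simp add: h_def)
qed

section \<open>Symmetric matrices\<close>

lemma inner_matrix_transpose: "x \<bullet> (A *v y) = (transpose A *v x) \<bullet> y" for A :: "real^'n^'m"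
  by (metis dot_lmul_matrix vector_transpose_matrix transpose_transpose)

lemma inner_symmetric_matrix:
  fixes A :: "real^'n^'n"
  assumes "transpose A = A"
  shows "x \<bullet> (A *v y) = (A *v x) \<bullet> y"
  using inner_matrix_transpose[of x A y] assms by simp

text \<open>First variation: otherwise moving \<open>e\<close> slightly along \<open>w\<close> would make the quadratic form
  \<open>v \<bullet> A v - m (v \<bullet> v)\<close>, which is nonnegative on \<open>V\<close> and vanishes at \<open>e\<close>, negative.\<close>

lemma quadratic_minimizer_orthogonal:
  fixes A :: "real^'n^'n"
  assumes sym: "transpose A = A" and V: "subspace V" "e \<in> V" "w \<in> V"
    and ge: "\<And>v. v \<in> V \<Longrightarrow> m * (v \<bullet> v) \<le> v \<bullet> (A *v v)"
    and eq: "e \<bullet> (A *v e) = m * (e \<bullet> e)"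
  shows "w \<bullet> (A *v e - m *\<^sub>R e) = 0"
proof (rule ccontr)
  define b where "b = w \<bullet> (A *v e - m *\<^sub>R e)"
  define q where "q = w \<bullet> (A *v w) - m * (w \<bullet> w)"
  assume "w \<bullet> (A *v e - m *\<^sub>R e) \<noteq> 0"
  hence b: "b \<noteq> 0" by (simp add: b_def)
  have pos: "0 \<le> 2 * t * b + t\<^sup>2 * q" for t
  proof -
    have "e + t *\<^sub>R w \<in> V" using V by (intro subspace_add subspace_scale)
    from ge[OF this] have "m * ((e + t *\<^sub>R w) \<bullet> (e + t *\<^sub>R w))
        \<le> (e + t *\<^sub>R w) \<bullet> (A *v (e + t *\<^sub>R w))" .
    moreover have "e \<bullet> (A *v w) = w \<bullet> (A *v e)"
      using inner_symmetric_matrix[OF sym, of e w] by (simp add: inner_commute)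
    ultimately show ?thesis using eq
      by (simp add: b_def q_def matrix_vector_right_distrib matrix_vector_mult_scaleR
          inner_add_left inner_add_right inner_diff_right power2_eq_square inner_commute[of w e]
          algebra_simps)
  qed
  \<comment> \<open>near the minimiser of the quadratic in \<open>t\<close>, with a denominator that is positive for every \<open>q\<close>\<close>
  define s where "s = - b / (\<bar>q\<bar> + 1)"
  have "0 \<le> 2 * s * b + s\<^sup>2 * q" by (rule pos)
  also have "\<dots> \<le> 2 * s * b + s\<^sup>2 * (\<bar>q\<bar> + 1)" by (intro add_left_mono mult_left_mono) auto
  also have "\<dots> = - (b\<^sup>2 / (\<bar>q\<bar> + 1))"
    by (simp add: s_def divide_simps power2_eq_square)
  also have "\<dots> < 0" using b by (simp add: add_nonneg_pos)
  finally show False by simp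
qed

text \<open>The Rayleigh quotient on an invariant subspace attains its minimum, and a minimiser is an
  eigenvector because the first variation vanishes.\<close>

lemma rayleigh_minimizer_eigenvector:
  fixes A :: "real^'n^'n"
  assumes sym: "transpose A = A" and V: "subspace V" "V \<noteq> {0}"
    and inv: "\<And>v. v \<in> V \<Longrightarrow> A *v v \<in> V"
  obtains e m where "e \<in> V" "norm e = 1" "A *v e = m *\<^sub>R e"
    "\<And>v. v \<in> V \<Longrightarrow> m * (v \<bullet> v) \<le> v \<bullet> (A *v v)"
proof -
  let ?K = "V \<inter> sphere 0 1"
  from V obtain z where z: "z \<in> V" "z \<noteq> 0" using subspace_0 by blast
  have "compact ?K" using closed_subspace[OF V(1)] by (simp add: closed_Int_compact)
  moreover have "?K \<noteq> {}"
  proof -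
    have "z /\<^sub>R norm z \<in> ?K" using z V by (simp add: subspace_scale)
    thus ?thesis by blast
  qed
  moreover have "continuous_on ?K (\<lambda>v. v \<bullet> (A *v v))"
    by (intro continuous_intros linear_continuous_on) simp
  ultimately obtain e where e: "e \<in> ?K" and le: "\<And>v. v \<in> ?K \<Longrightarrow> e \<bullet> (A *v e) \<le> v \<bullet> (A *v v)"
    using continuous_attains_inf[of ?K "\<lambda>v. v \<bullet> (A *v v)"] by blast
  define m where "m = e \<bullet> (A *v e)"
  have ge: "m * (v \<bullet> v) \<le> v \<bullet> (A *v v)" if "v \<in> V" for v
  proof (cases "v = 0")
    case False
    have "v /\<^sub>R norm v \<in> ?K" using that V False by (simp add: subspace_scale)
    from le[OF this] have "m \<le> (v \<bullet> (A *v v)) / (norm v)\<^sup>2"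
      by (simp add: m_def matrix_vector_mult_scaleR power2_eq_square divide_simps)
    thus ?thesis using False by (simp add: field_simps power2_norm_eq_inner)
  qed simp
  have e1: "e \<in> V" "norm e = 1" using e by auto
  hence ee: "e \<bullet> e = 1" by (simp add: norm_eq_1)
  have "A *v e - m *\<^sub>R e \<in> V" using e1 V inv by (intro subspace_diff subspace_scale) auto
  with quadratic_minimizer_orthogonal[OF sym V(1) e1(1) this ge] ee
  have "A *v e - m *\<^sub>R e = 0" by (simp add: m_def)
  with e1 ge that show ?thesis by (metis eq_iff_diff_eq_0)
qed

text \<open>Eigenvectors to different eigenvalues are orthogonal, and orthogonal families of nonzero vectors
  are independent.\<close>

lemma finite_eigenvalues:
  fixes A :: "real^'n^'n"
  assumes sym: "transpose A = A"
  shows "finite (eigenvalues A)"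
proof -
  define ev where "ev \<mu> = (SOME v. v \<noteq> 0 \<and> A *v v = \<mu> *\<^sub>R v)" for \<mu>
  have ev: "ev \<mu> \<noteq> 0" "A *v ev \<mu> = \<mu> *\<^sub>R ev \<mu>" if "\<mu> \<in> eigenvalues A" for \<mu>
    using someI_ex[of "\<lambda>v. v \<noteq> 0 \<and> A *v v = \<mu> *\<^sub>R v"] that
    by (auto simp: eigenvalues_def ev_def)
  have orth: "ev \<mu> \<bullet> ev \<nu> = 0" if "\<mu> \<in> eigenvalues A" "\<nu> \<in> eigenvalues A" "\<mu> \<noteq> \<nu>" for \<mu> \<nu>
    using inner_symmetric_matrix[OF sym, of "ev \<mu>" "ev \<nu>"] ev that by simp
  have "inj_on ev (eigenvalues A)"
  proof (rule inj_onI, rule ccontr)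
    fix \<mu> \<nu> assume *: "\<mu> \<in> eigenvalues A" "\<nu> \<in> eigenvalues A" "ev \<mu> = ev \<nu>" "\<mu> \<noteq> \<nu>"
    with orth[of \<mu> \<nu>] ev(1)[of \<mu>] show False by simp
  qed
  moreover have "pairwise orthogonal (ev ` eigenvalues A)"
    using orth by (auto simp: pairwise_def orthogonal_def)
  hence "finite (ev ` eigenvalues A)"
    by (rule independent_imp_finite[OF pairwise_orthogonal_independent]) (use ev(1) in auto)
  ultimately show ?thesis using finite_imageD by blast
qed

lemma lambda_min_bounds:
  fixes A :: "real^'n^'n"
  assumes sym: "transpose A = A"
  shows "lambda_min A * (v \<bullet> v) \<le> v \<bullet> (A *v v)"
    and "\<exists>e. norm e = 1 \<and> e \<bullet> (A *v e) = lambda_min A"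
proof -
  have "axis undefined 1 \<noteq> (0 :: real^'n)" by simp
  hence "(UNIV :: (real^'n) set) \<noteq> {0}" by blast
  from rayleigh_minimizer_eigenvector[OF sym subspace_UNIV this]
  obtain e :: "real^'n" and m where e: "norm e = 1" "A *v e = m *\<^sub>R e"
    and ge: "\<And>v. m * (v \<bullet> v) \<le> v \<bullet> (A *v v)" by auto
  have "m \<in> eigenvalues A" using e unfolding eigenvalues_def
    by (intro CollectI exI[of _ e]) auto
  moreover have "m \<le> \<mu>" if \<mu>: "\<mu> \<in> eigenvalues A" for \<mu>
  proof -
    from \<mu> obtain w where w: "w \<noteq> 0" "A *v w = \<mu> *\<^sub>R w" by (auto simp: eigenvalues_def)
    with ge[of w] show ?thesis by simp
  qed
  ultimately have m: "lambda_min A = m"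
    unfolding lambda_min_def using finite_eigenvalues[OF sym] by (intro Min_eqI) auto
  show "lambda_min A * (v \<bullet> v) \<le> v \<bullet> (A *v v)" using ge m by simp
  show "\<exists>e. norm e = 1 \<and> e \<bullet> (A *v e) = lambda_min A"
    using e m by (intro exI[of _ e]) (simp add: norm_eq_1)
qed

text \<open>The spectral theorem, by splitting off the eigenvector that minimises the Rayleigh quotient on \<open>V\<close>
  and continuing in its orthogonal complement, which is again invariant.\<close>

lemma symmetric_eigenbasis:
  fixes A :: "real^'n^'n"
  assumes sym: "transpose A = A" and V: "subspace V" and inv: "\<And>v. v \<in> V \<Longrightarrow> A *v v \<in> V"
  shows "\<exists>B m. finite B \<and> (\<forall>e\<in>B. e \<in> V \<and> norm e = 1 \<and> A *v e = m e *\<^sub>R e) \<and>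
    (\<forall>v\<in>V. v = (\<Sum>e\<in>B. (e \<bullet> v) *\<^sub>R e))"
  using V inv
proof (induction "dim V" arbitrary: V rule: less_induct)
  case less
  show ?case
  proof (cases "V = {0}")
    case True
    thus ?thesis by (intro exI[of _ "{}"]) auto
  next
    case False
    from rayleigh_minimizer_eigenvector[OF sym less.prems(1) False less.prems(2)]
    obtain e \<mu> where e: "e \<in> V" "norm e = 1" "A *v e = \<mu> *\<^sub>R e" by metis
    have ee: "e \<bullet> e = 1" using e by (simp add: norm_eq_1)
    define W where "W = V \<inter> {v. e \<bullet> v = 0}"
    have W: "subspace W" unfolding W_def
      using less.prems(1) subspace_hyperplane by (rule subspace_inter)
    have "e \<notin> W" using ee by (simp add: W_def)
    moreover have "W \<subseteq> V" by (auto simp: W_def)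
    ultimately have "W \<subset> V" using e by blast
    moreover have "span W = W" "span V = V"
      using W less.prems(1) by (auto intro!: span_subspace)
    ultimately have "span W \<subset> span V" by metis
    hence dim: "dim W < dim V" by (rule dim_psubset)
    have invW: "A *v v \<in> W" if "v \<in> W" for v
      using that less.prems(2) inner_symmetric_matrix[OF sym, of e v] e by (auto simp: W_def)
    from less.hyps[OF dim W invW] obtain B m where B: "finite B"
      "\<And>b. b \<in> B \<Longrightarrow> b \<in> W \<and> norm b = 1 \<and> A *v b = m b *\<^sub>R b"
      "\<And>v. v \<in> W \<Longrightarrow> v = (\<Sum>b\<in>B. (b \<bullet> v) *\<^sub>R b)"
      by blast
    have eB: "e \<notin> B" using B(2) \<open>e \<notin> W\<close> by blast
    have "v = (\<Sum>b\<in>insert e B. (b \<bullet> v) *\<^sub>R b)" if v: "v \<in> V" for v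
    proof -
      have "v - (e \<bullet> v) *\<^sub>R e \<in> W"
        using v e less.prems(1) ee by (auto simp: W_def subspace_diff subspace_scale inner_diff_right)
      from B(3)[OF this] have "v - (e \<bullet> v) *\<^sub>R e = (\<Sum>b\<in>B. (b \<bullet> (v - (e \<bullet> v) *\<^sub>R e)) *\<^sub>R b)" .
      also have "\<dots> = (\<Sum>b\<in>B. (b \<bullet> v) *\<^sub>R b)"
        using B(2) by (intro sum.cong refl) (auto simp: W_def inner_diff_right inner_commute[of _ e])
      finally show ?thesis using B(1) eB by (simp add: algebra_simps)
    qed
    moreover have "b \<in> V \<and> norm b = 1 \<and> A *v b = (m(e := \<mu>)) b *\<^sub>R b" if "b \<in> insert e B" for b
      using that e B(2) eB by (auto simp: W_def)
    ultimately show ?thesis using B(1) by (intro exI[of _ "insert e B"] exI[of _ "m(e := \<mu>)"]) auto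
  qed
qed

lemma symmetric_psd_kernel:
  fixes A :: "real^'n^'n"
  assumes "pos_semidef A" "v \<bullet> (A *v v) = 0"
  shows "A *v v = 0"
proof -
  have "(A *v v) \<bullet> (A *v v - 0 *\<^sub>R v) = 0"
    by (rule quadratic_minimizer_orthogonal[of A UNIV]) (use assms in \<open>auto simp: pos_semidef_def\<close>)
  thus ?thesis by simp
qed

lemma pos_def_imp_semidef: "pos_def A \<Longrightarrow> pos_semidef A"
  unfolding pos_def_def pos_semidef_def by (metis inner_zero_left less_eq_real_def)

lemma pos_def_invertible:
  fixes A :: "real^'n^'n"
  assumes "pos_def A"
  shows "invertible A"
proof -
  have "x = 0" if "A *v x = 0" for x
    using assms that unfolding pos_def_def by (metis inner_zero_right less_irrefl)
  thus ?thesis using matrix_left_invertible_ker invertible_left_inverse by blast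
qed

text \<open>Two positive semidefinite square roots \<open>B\<close> and \<open>C\<close> agree: at an eigenvector \<open>v\<close> of \<open>B - C\<close>
  for a nonzero eigenvalue, \<open>v \<bullet> (B\<^sup>2 - C\<^sup>2) v = 0\<close> would force \<open>B v = C v = 0\<close>.\<close>

lemma psd_square_root_unique:
  fixes B C :: "real^'n^'n"
  assumes B: "pos_semidef B" and C: "pos_semidef C" and eq: "B ** B = C ** C"
  shows "B = C"
proof -
  define D where "D = B - C"
  have symB: "transpose B = B" and symC: "transpose C = C" using B C by (auto simp: pos_semidef_def)
  have symD: "transpose D = D" using symB symC by (simp add: D_def transpose_def vec_eq_iff)
  have D: "D *v v = B *v v - C *v v" for v by (simp add: D_def matrix_vector_mult_diff_rdistrib)
  have zero: "m = 0" if e: "norm e = 1" "D *v e = m *\<^sub>R e" for e m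
  proof (rule ccontr)
    assume m: "m \<noteq> 0"
    have "(B *v e) \<bullet> (B *v e) = (C *v e) \<bullet> (C *v e)"
    proof -
      have "(B *v e) \<bullet> (B *v e) = e \<bullet> ((B ** B) *v e)"
        using inner_symmetric_matrix[OF symB, of e "B *v e"] by (simp add: matrix_vector_mul_assoc)
      moreover have "(C *v e) \<bullet> (C *v e) = e \<bullet> ((C ** C) *v e)"
        using inner_symmetric_matrix[OF symC, of e "C *v e"] by (simp add: matrix_vector_mul_assoc)
      ultimately show ?thesis by (simp add: eq)
    qed
    hence "(B *v e + C *v e) \<bullet> (B *v e - C *v e) = 0"
      unfolding inner_add_left inner_diff_right
      by (simp add: inner_commute[of "C *v e" "B *v e"])
    hence "m * ((B *v e) \<bullet> e + (C *v e) \<bullet> e) = 0"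
      using e D by (simp add: inner_add_left distrib_left del: mult_eq_0_iff)
    hence "e \<bullet> (B *v e) + e \<bullet> (C *v e) = 0" using m by (simp add: inner_commute)
    moreover have "0 \<le> e \<bullet> (B *v e)" "0 \<le> e \<bullet> (C *v e)" using B C by (auto simp: pos_semidef_def)
    ultimately have "B *v e = 0" "C *v e = 0"
      using symmetric_psd_kernel[OF B, of e] symmetric_psd_kernel[OF C, of e] by auto
    with D[of e] e m show False by auto
  qed
  obtain E m where E: "finite E" "\<forall>e\<in>E. e \<in> UNIV \<and> norm e = 1 \<and> D *v e = m e *\<^sub>R e"
    "\<forall>v\<in>UNIV. v = (\<Sum>e\<in>E. (e \<bullet> v) *\<^sub>R e)"
    using symmetric_eigenbasis[OF symD subspace_UNIV] by auto
  have "D *v v = 0" for v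
  proof -
    have "D *v v = D *v (\<Sum>e\<in>E. (e \<bullet> v) *\<^sub>R e)" using E(3) by simp
    also have "\<dots> = (\<Sum>e\<in>E. (e \<bullet> v) *\<^sub>R (D *v e))"
      by (simp add: linear_sum[OF matrix_vector_mul_linear] matrix_vector_mult_scaleR)
    also have "\<dots> = 0" using E(2) zero by (intro sum.neutral) auto
    finally show ?thesis .
  qed
  thus ?thesis using D by (simp add: matrix_eq)
qed

text \<open>Take the square roots of the eigenvalues in an orthonormal eigenbasis.\<close>

lemma psd_square_root_exists:
  fixes A :: "real^'n^'n"
  assumes A: "pos_semidef A"
  shows "\<exists>B. pos_semidef B \<and> B ** B = A"
proof -
  have symA: "transpose A = A" using A by (simp add: pos_semidef_def)
  obtain E m where E: "finite E" "\<And>e. e \<in> E \<Longrightarrow> norm e = 1" "\<And>e. e \<in> E \<Longrightarrow> A *v e = m e *\<^sub>R e"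
    and dec: "\<And>v. v = (\<Sum>e\<in>E. (e \<bullet> v) *\<^sub>R e)"
    using symmetric_eigenbasis[OF symA subspace_UNIV] by auto
  have m: "0 \<le> m e" if "e \<in> E" for e
  proof -
    have "0 \<le> e \<bullet> (A *v e)" using A by (simp add: pos_semidef_def)
    thus ?thesis using E that by (simp add: norm_eq_1)
  qed
  define b where "b v = (\<Sum>e\<in>E. (sqrt (m e) * (e \<bullet> v)) *\<^sub>R e)" for v
  have lin: "linear b"
    by (rule linearI) (auto simp: b_def inner_add_right scaleR_add_left distrib_left sum.distrib
        scaleR_sum_right algebra_simps)
  define B where "B = matrix b"
  have Bv: "B *v v = b v" for v by (simp add: B_def lin)
  have Be: "b e = sqrt (m e) *\<^sub>R e" if e: "e \<in> E" for e
  proof -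
    have *: "(m e' - m e) * (e' \<bullet> e) = 0" if "e' \<in> E" for e'
      using inner_symmetric_matrix[OF symA, of e' e] E(3)[OF that] E(3)[OF e]
      by (simp add: algebra_simps) auto
    have "b e = (\<Sum>e'\<in>E. (sqrt (m e) * (e' \<bullet> e)) *\<^sub>R e')"
      unfolding b_def by (intro sum.cong refl) (use * in auto)
    also have "\<dots> = sqrt (m e) *\<^sub>R (\<Sum>e'\<in>E. (e' \<bullet> e) *\<^sub>R e')" by (simp add: scaleR_sum_right)
    finally show ?thesis using dec[of e] by simp
  qed
  have "b (b v) = A *v v" for v
  proof -
    have "b (b v) = (\<Sum>e\<in>E. (sqrt (m e) * (e \<bullet> v)) *\<^sub>R b e)"
      by (subst (2) b_def) (simp add: linear_sum[OF lin] linear_scale[OF lin])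
    also have "\<dots> = (\<Sum>e\<in>E. (e \<bullet> v) *\<^sub>R (A *v e))"
      using m by (intro sum.cong refl) (simp add: Be E(3) mult_ac real_sqrt_mult_self)
    also have "\<dots> = A *v (\<Sum>e\<in>E. (e \<bullet> v) *\<^sub>R e)"
      by (simp add: linear_sum[OF matrix_vector_mul_linear] matrix_vector_mult_scaleR)
    finally show ?thesis using dec[of v] by simp
  qed
  hence "B ** B = A" by (simp add: matrix_eq matrix_vector_mul_assoc[symmetric] Bv)
  moreover have inner_b: "x \<bullet> b y = (\<Sum>e\<in>E. sqrt (m e) * (e \<bullet> x) * (e \<bullet> y))" for x y
    by (simp add: b_def inner_sum_right inner_commute mult_ac)
  have "transpose B = B"
  proof -
    have "(transpose B *v x) \<bullet> y = (B *v x) \<bullet> y" for x y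
      using inner_matrix_transpose[of x B y] inner_b[of x y] inner_b[of y x]
      by (simp add: Bv inner_commute[of "b x"] mult_ac)
    thus ?thesis by (metis matrix_eq vector_eq_rdot)
  qed
  moreover have "0 \<le> v \<bullet> (B *v v)" for v
    unfolding Bv inner_b using m by (intro sum_nonneg) (simp add: mult.assoc)
  ultimately show ?thesis by (auto simp: pos_semidef_def)
qed

lemma matrix_sqrt:
  fixes A :: "real^'n^'n"
  assumes "pos_semidef A"
  shows "pos_semidef (matrix_sqrt A)" "matrix_sqrt A ** matrix_sqrt A = A"
proof -
  have "\<exists>!B. pos_semidef B \<and> B ** B = A"
    using psd_square_root_exists[OF assms] psd_square_root_unique by metis
  from theI'[OF this] show "pos_semidef (matrix_sqrt A)" "matrix_sqrt A ** matrix_sqrt A = A"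
    by (auto simp: matrix_sqrt_def)
qed

lemma matrix_sqrt_quadratic:
  fixes A :: "real^'n^'n"
  assumes "pos_semidef A"
  shows "(norm (matrix_sqrt A *v v))\<^sup>2 = v \<bullet> (A *v v)"
proof -
  have "transpose (matrix_sqrt A) = matrix_sqrt A"
    using matrix_sqrt(1)[OF assms] by (simp add: pos_semidef_def)
  from inner_symmetric_matrix[OF this, of v "matrix_sqrt A *v v"]
  show ?thesis by (simp add: power2_norm_eq_inner matrix_vector_mul_assoc matrix_sqrt(2)[OF assms])
qed

lemma matrix_sqrt_inverse:
  fixes A :: "real^'n^'n"
  assumes "pos_def A"
  shows "matrix_sqrt A ** matrix_inv (matrix_sqrt A) = mat 1"
    "matrix_inv (matrix_sqrt A) ** matrix_sqrt A = mat 1"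
proof -
  have "x = 0" if "matrix_sqrt A *v x = 0" for x
    using matrix_sqrt_quadratic[OF pos_def_imp_semidef[OF assms], of x] that assms
    unfolding pos_def_def by (metis less_irrefl norm_zero power_zero_numeral)
  hence "invertible (matrix_sqrt A)"
    using matrix_left_invertible_ker invertible_left_inverse by blast
  thus "matrix_sqrt A ** matrix_inv (matrix_sqrt A) = mat 1"
    "matrix_inv (matrix_sqrt A) ** matrix_sqrt A = mat 1"
    unfolding matrix_inv_def invertible_def by (metis (mono_tags, lifting) someI_ex)+
qed

lemma norm_le_spectral_norm: "norm (A *v x) \<le> spectral_norm A * norm x" for A :: "real^'n^'n"
  unfolding spectral_norm_def by (rule onorm) simp

lemma spectral_norm_transpose_le: "spectral_norm (transpose A) \<le> spectral_norm A"
  for A :: "real^'n^'n"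
  unfolding spectral_norm_def
proof (rule onorm_le)
  fix x
  let ?y = "transpose A *v x"
  have "norm ?y * norm ?y = x \<bullet> (A *v ?y)"
    by (simp add: inner_matrix_transpose norm_eq_sqrt_inner)
  also have "\<dots> \<le> norm x * norm (A *v ?y)" by (rule norm_cauchy_schwarz)
  also have "\<dots> \<le> norm x * (onorm ((*v) A) * norm ?y)"
    by (intro mult_left_mono onorm) simp_all
  finally show "norm ?y \<le> onorm ((*v) A) * norm x"
    by (cases "norm ?y = 0") (auto simp: mult_ac onorm_pos_le)
qed

lemma spectral_norm_transpose: "spectral_norm (transpose A) = spectral_norm A" for A :: "real^'n^'n"
  by (metis antisym spectral_norm_transpose_le transpose_transpose)

section \<open>Blocks\<close>

lemma subvec_nth [simp]: "subvec blk i x $ j = (if blk j = i then x $ j else 0)"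
  by (simp add: subvec_def)

lemma subvec_add: "subvec blk i (x + y) = subvec blk i x + subvec blk i y"
  by (simp add: vec_eq_iff)

lemma subvec_diff: "subvec blk i (x - y) = subvec blk i x - subvec blk i y"
  by (simp add: vec_eq_iff)

lemma subvec_scaleR: "subvec blk i (c *\<^sub>R x) = c *\<^sub>R subvec blk i x"
  by (simp add: vec_eq_iff)

lemma subvec_zero [simp]: "subvec blk i 0 = 0"
  by (simp add: vec_eq_iff)

lemma linear_subvec: "linear (subvec blk i)"
  by (rule linearI) (simp_all add: subvec_add subvec_scaleR)

lemma subvec_in_block_space [simp]: "subvec blk i x \<in> block_space blk i"
  by (simp add: block_space_def)

lemma subvec_idem [simp]: "subvec blk i (subvec blk i x) = subvec blk i x"
  by (simp add: vec_eq_iff)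

lemma subvec_block_space: "e \<in> block_space blk i \<Longrightarrow> subvec blk i e = e"
  by (auto simp: vec_eq_iff block_space_def)

lemma subvec_block_space_other: "e \<in> block_space blk i \<Longrightarrow> j \<noteq> i \<Longrightarrow> subvec blk j e = 0"
  by (auto simp: vec_eq_iff block_space_def)

lemma subspace_block_space: "subspace (block_space blk i)"
  by (auto simp: subspace_def block_space_def)

lemma sum_subvec: "(\<Sum>i\<in>UNIV. subvec blk i x) = x" for blk :: "'n::finite \<Rightarrow> 'b::finite"
  by (simp add: vec_eq_iff)

lemma inner_subvec_swap: "x \<bullet> subvec blk i y = subvec blk i x \<bullet> y"
  by (auto simp: inner_vec_def intro!: sum.cong)

lemma inner_block_space: "e \<in> block_space blk i \<Longrightarrow> subvec blk i x \<bullet> e = x \<bullet> e"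
  using inner_subvec_swap[of x blk i e] subvec_block_space[of e blk i] by simp

lemma inner_sum_subvec: "x \<bullet> y = (\<Sum>i\<in>UNIV. subvec blk i x \<bullet> subvec blk i y)"
  for blk :: "'n::finite \<Rightarrow> 'b::finite"
proof -
  have "x \<bullet> y = (\<Sum>i\<in>UNIV. x \<bullet> subvec blk i y)"
    by (subst (1) sum_subvec[of blk y, symmetric]) (simp only: inner_sum_right)
  thus ?thesis by (simp add: inner_subvec_swap)
qed

lemma sum_norm_subvec: "(\<Sum>i\<in>UNIV. (norm (subvec blk i x))\<^sup>2) = (norm x)\<^sup>2"
  for blk :: "'n::finite \<Rightarrow> 'b::finite"
  by (simp add: power2_norm_eq_inner inner_sum_subvec[of x x blk])

lemma subvec_sum_block_space:
  fixes blk :: "'n::finite \<Rightarrow> 'b::finite"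
  assumes "\<And>i. e i \<in> block_space blk i"
  shows "subvec blk i (\<Sum>j\<in>UNIV. e j) = e i"
proof -
  have "subvec blk i (\<Sum>j\<in>UNIV. e j) = (\<Sum>j\<in>UNIV. subvec blk i (e j))"
    by (simp add: linear_sum[OF linear_subvec])
  also have "\<dots> = (\<Sum>j\<in>UNIV. if j = i then e i else 0)"
    using subvec_block_space[OF assms] subvec_block_space_other[OF assms]
    by (intro sum.cong refl) (metis (full_types))
  finally show ?thesis by simp
qed

lemma submat_mult_vec: "submat blk i A *v x = subvec blk i (A *v subvec blk i x)"
  by (auto simp: vec_eq_iff submat_def matrix_vector_mult_def intro!: sum.cong)

lemma quadratic_submat:
  "e \<in> block_space blk i \<Longrightarrow> y \<bullet> (submat blk i A *v e) = subvec blk i y \<bullet> (A *v e)"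
  by (simp add: submat_mult_vec subvec_block_space inner_subvec_swap)

lemma block_diag_mult_vec: "block_diag blk A *v x = (\<Sum>i\<in>UNIV. subvec blk i (A *v subvec blk i x))"
proof -
  have "(\<Sum>i\<in>I. submat blk i A) *v x = (\<Sum>i\<in>I. submat blk i A *v x)" if "finite I" for I
    using that by induction (auto simp: matrix_vector_mult_add_rdistrib)
  thus ?thesis by (simp add: block_diag_def submat_mult_vec)
qed

lemma quadratic_block_diag:
  "x \<bullet> (block_diag blk A *v x) = (\<Sum>i\<in>UNIV. subvec blk i x \<bullet> (A *v subvec blk i x))"
  unfolding block_diag_mult_vec inner_sum_right
  by (simp only: inner_subvec_swap)

lemma transpose_block_diag:
  assumes "transpose A = A"
  shows "transpose (block_diag blk A) = block_diag blk A"
proof -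
  have "A $ j $ k = A $ k $ j" for j k
    using assms by (metis transpose_def vec_lambda_beta)
  thus ?thesis by (auto simp: vec_eq_iff transpose_def block_diag_def submat_def intro!: sum.cong)
qed

lemma quadratic_block_diag_bounds:
  fixes A :: "real^'n^'n"
  shows "(\<And>v. s * (v \<bullet> v) \<le> v \<bullet> (A *v v)) \<Longrightarrow> s * (x \<bullet> x) \<le> x \<bullet> (block_diag blk A *v x)"
    and "(\<And>v. v \<bullet> (A *v v) \<le> l * (v \<bullet> v)) \<Longrightarrow> x \<bullet> (block_diag blk A *v x) \<le> l * (x \<bullet> x)"
  unfolding quadratic_block_diag inner_sum_subvec[of x x blk] sum_distrib_left
  by (auto intro: sum_mono)

lemma pos_def_block_diag:
  fixes A :: "real^'n^'n"
  assumes "pos_def A"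
  shows "pos_def (block_diag blk A)"
  unfolding pos_def_def
proof safe
  show "transpose (block_diag blk A) = block_diag blk A"
    using assms by (auto simp: pos_def_def intro: transpose_block_diag)
  fix v :: "real^'n" assume "v \<noteq> 0"
  with sum_subvec[of blk v] obtain i where i: "subvec blk i v \<noteq> 0"
    by (metis (no_types, lifting) sum.neutral)
  have "0 \<le> w \<bullet> (A *v w)" for w
    using pos_def_imp_semidef[OF assms] by (simp add: pos_semidef_def)
  moreover have "0 < subvec blk i v \<bullet> (A *v subvec blk i v)"
    using assms i by (simp add: pos_def_def)
  ultimately show "0 < v \<bullet> (block_diag blk A *v v)"
    unfolding quadratic_block_diag by (intro sum_pos2[of _ i]) auto
qed

text \<open>The block diagonal of \<open>A\<close> is positive definite and commutes with the projections \<open>subvec blk i\<close>, hence so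
  does its inverse, whose diagonal blocks are the inverses of the diagonal blocks.\<close>

lemma submat_inv:
  fixes A :: "real^'n^'n" and blk :: "'n \<Rightarrow> 'b::finite"
  assumes "pos_def A"
  shows "submat blk i A ** submat_inv blk i A = submat blk i (mat 1)"
proof -
  let ?D = "block_diag blk A" and ?P = "\<lambda>x. subvec blk i x"
  obtain E where E: "?D ** E = mat 1" "E ** ?D = mat 1"
    using pos_def_invertible[OF pos_def_block_diag[OF assms]] unfolding invertible_def by blast
  have DE: "?D *v (E *v x) = x" and ED: "E *v (?D *v x) = x" for x
    by (simp_all add: matrix_vector_mul_assoc E)
  have 1: "?D *v ?P x = submat blk i A *v x" for x
  proof -
    have "?D *v ?P x = (\<Sum>j\<in>UNIV. if j = i then subvec blk i (A *v ?P x) else 0)"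
      unfolding block_diag_mult_vec
      by (intro sum.cong refl) (auto simp: subvec_block_space_other[OF subvec_in_block_space])
    thus ?thesis by (simp add: submat_mult_vec)
  qed
  have 2: "?P (?D *v x) = submat blk i A *v x" for x
    unfolding block_diag_mult_vec submat_mult_vec
    by (rule subvec_sum_block_space) simp
  have PE: "E *v ?P x = ?P (E *v x)" for x
    by (metis 1 2 DE ED)
  have PD: "?P (?D *v x) = ?D *v ?P x" for x by (simp only: 1 2)
  let ?B = "submat blk i E"
  have "submat blk i ?B = ?B" by (simp add: submat_def vec_eq_iff)
  moreover have "submat blk i A ** ?B = submat blk i (mat 1)"
    unfolding matrix_eq
    by (simp add: matrix_vector_mul_assoc[symmetric] submat_mult_vec[of _ _ E]
        submat_mult_vec[of _ _ "mat 1"] PE[symmetric] 1[symmetric] DE)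
  moreover have "?B ** submat blk i A = submat blk i (mat 1)"
    unfolding matrix_eq
    by (simp add: matrix_vector_mul_assoc[symmetric] submat_mult_vec[of _ _ E]
        submat_mult_vec[of _ _ "mat 1"] 1[symmetric] PE[symmetric] PD ED)
  ultimately show ?thesis
    unfolding submat_inv_def
    using someI[of "\<lambda>B. submat blk i B = B \<and> submat blk i A ** B = submat blk i (mat 1) \<and>
      B ** submat blk i A = submat blk i (mat 1)" ?B] by blast
qed

lemma quadratic_form_cauchy_schwarz:
  fixes A :: "real^'n^'n"
  assumes "pos_semidef A"
  shows "\<bar>x \<bullet> (A *v y)\<bar> \<le> sqrt (x \<bullet> (A *v x)) * sqrt (y \<bullet> (A *v y))"
proof -
  let ?R = "matrix_sqrt A"
  have "transpose ?R = ?R" using matrix_sqrt(1)[OF assms] by (simp add: pos_semidef_def)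
  from inner_symmetric_matrix[OF this, of x "?R *v y"]
  have "x \<bullet> (A *v y) = (?R *v x) \<bullet> (?R *v y)"
    by (simp add: matrix_vector_mul_assoc matrix_sqrt(2)[OF assms])
  moreover have "sqrt (z \<bullet> (A *v z)) = norm (?R *v z)" for z
    by (simp add: matrix_sqrt_quadratic[OF assms, symmetric])
  ultimately show ?thesis by (simp add: Cauchy_Schwarz_ineq2)
qed

text \<open>Duality of the two norms on a block: \<open>v\<close> is the image of \<open>w = submat_inv v\<close> under the block of the
  Hessian, and the claim is the Cauchy-Schwarz inequality for the form of the Hessian at \<open>w\<close> and \<open>y\<close>.\<close>

lemma local_dual_norm_bound:
  fixes blk :: "'n::finite \<Rightarrow> 'b::finite"
  assumes A: "pos_def (hessian f x)"
    and v: "v \<in> block_space blk i" and y: "y \<in> block_space blk i"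
  shows "\<bar>v \<bullet> y\<bar> \<le> local_dual_norm blk f i x v * local_norm blk f i x y"
proof -
  define w where "w = subvec blk i (submat_inv blk i (hessian f x) *v v)"
  have "v = submat blk i (mat 1) *v v"
    using v by (simp add: submat_mult_vec subvec_block_space)
  also have "\<dots> = submat blk i (hessian f x) *v (submat_inv blk i (hessian f x) *v v)"
    by (simp only: matrix_vector_mul_assoc submat_inv[OF A])
  also have "\<dots> = subvec blk i (hessian f x *v w)" by (simp add: submat_mult_vec w_def)
  finally have vw: "v = subvec blk i (hessian f x *v w)" .
  have wv: "w \<in> block_space blk i" by (simp add: w_def)
  have "v \<bullet> (submat_inv blk i (hessian f x) *v v) = v \<bullet> w"
    using inner_block_space[OF v] by (simp add: w_def inner_commute)
  also have "\<dots> = w \<bullet> (hessian f x *v w)"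
    by (subst vw) (simp add: inner_block_space[OF wv] inner_commute[of w])
  finally have 1: "local_dual_norm blk f i x v = sqrt (w \<bullet> (hessian f x *v w))"
    by (simp add: local_dual_norm_def)
  have 2: "local_norm blk f i x y = sqrt (y \<bullet> (hessian f x *v y))"
    using y by (simp add: local_norm_def quadratic_submat subvec_block_space)
  have "v \<bullet> y = y \<bullet> (hessian f x *v w)"
    by (subst vw) (simp add: inner_block_space[OF y] inner_commute[of y])
  thus ?thesis unfolding 1 2
    using quadratic_form_cauchy_schwarz[OF pos_def_imp_semidef[OF A], of y w] by (simp add: mult.commute)
qed

section \<open>The constant c1\<close>

text \<open>For \<open>T\<close> the inverse of \<open>D\<^sup>1\<^sup>/\<^sup>2\<close>, the square of the norm of \<open>A\<^sup>1\<^sup>/\<^sup>2 T\<close> is the largest ratio of the quadratic forms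
  of \<open>A\<close> and \<open>D\<close>; this lemma and the next bound it from above and below.\<close>

lemma spectral_norm_sqrt_ratio_le:
  fixes A D T :: "real^'n^'n"
  assumes "pos_def A" "pos_def D" and T: "matrix_sqrt D ** T = mat 1"
    and c: "0 \<le> c" "\<And>w. w \<bullet> (A *v w) \<le> c\<^sup>2 * (w \<bullet> (D *v w))"
  shows "spectral_norm (matrix_sqrt A ** T) \<le> c"
  unfolding spectral_norm_def
proof (rule onorm_le)
  fix v
  define w where "w = T *v v"
  have v: "matrix_sqrt D *v w = v" by (simp add: w_def matrix_vector_mul_assoc T)
  have "(norm (matrix_sqrt A *v w))\<^sup>2 \<le> c\<^sup>2 * (norm (matrix_sqrt D *v w))\<^sup>2"
    using c(2)[of w] by (simp add: matrix_sqrt_quadratic pos_def_imp_semidef assms)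
  hence "(norm (matrix_sqrt A *v w))\<^sup>2 \<le> (c * norm v)\<^sup>2" by (simp add: v power_mult_distrib)
  hence "norm (matrix_sqrt A *v w) \<le> c * norm v" by (rule power2_le_imp_le) (simp add: c)
  thus "norm ((matrix_sqrt A ** T) *v v) \<le> c * norm v"
    by (simp add: w_def matrix_vector_mul_assoc)
qed

lemma spectral_norm_sqrt_ratio_ge:
  fixes A D T :: "real^'n^'n"
  assumes "pos_def A" "pos_def D" and T: "T ** matrix_sqrt D = mat 1"
    and w: "w \<noteq> 0" "w \<bullet> (A *v w) = w \<bullet> (D *v w)"
  shows "1 \<le> spectral_norm (matrix_sqrt A ** T)"
proof -
  define v where "v = matrix_sqrt D *v w"
  have Tv: "T *v v = w" by (simp add: v_def matrix_vector_mul_assoc T)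
  hence v0: "v \<noteq> 0" using w by auto
  have "(norm (matrix_sqrt A *v w))\<^sup>2 = (norm v)\<^sup>2"
    using w by (simp add: v_def matrix_sqrt_quadratic pos_def_imp_semidef assms)
  hence "norm ((matrix_sqrt A ** T) *v v) = norm v"
    by (simp add: matrix_vector_mul_assoc[symmetric] Tv)
  with norm_le_spectral_norm[of "matrix_sqrt A ** T" v] v0 show ?thesis by simp
qed

text \<open>Both norms in the definition of \<open>c1\<close> are largest ratios between the quadratic forms of the Hessian and
  its block diagonal. These forms agree on coordinate vectors, so the norms are at least 1 and the
  denominator of \<open>c1\<close> is at least \<open>\<surd>n (2 + \<eta>)\<close>. The bounds \<open>s\<close> and \<open>l\<close> on the Hessian make the supremum
  over \<open>S\<close> finite.\<close>

lemma c1_const_bounds: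
  fixes blk :: "'n::finite \<Rightarrow> 'b::finite" and f :: "real^'n \<Rightarrow> ereal"
  assumes S: "S \<noteq> {}" "\<And>x. x \<in> S \<Longrightarrow> pos_def (hessian f x)"
    and s: "0 < s" "\<And>x v. x \<in> S \<Longrightarrow> s * (v \<bullet> v) \<le> v \<bullet> (hessian f x *v v)"
    and l: "\<And>x v. x \<in> S \<Longrightarrow> v \<bullet> (hessian f x *v v) \<le> l * (v \<bullet> v)"
    and \<eta>: "0 \<le> \<eta>" "\<eta> < 1"
  shows "0 < c1_const blk f \<eta> S" "c1_const blk f \<eta> S * sqrt (real CARD('b)) \<le> (1 - \<eta>) / (2 + \<eta>)"
proof -
  define t where "t x = (let R = matrix_sqrt (hessian f x); Q = matrix_sqrt (block_diag blk (hessian f x))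
          in (1 + \<eta>) * spectral_norm (Q ** matrix_inv R) + spectral_norm (matrix_inv Q ** R))" for x
  define c where "c = sqrt (\<bar>l\<bar> / s)"
  have c: "0 \<le> c" "c\<^sup>2 * s = \<bar>l\<bar>" using s by (auto simp: c_def)
  have t: "2 + \<eta> \<le> t x \<and> t x \<le> (1 + \<eta>) * c + c" if x: "x \<in> S" for x
  proof -
    define A where "A = hessian f x"
    define D where "D = block_diag blk A"
    have A: "pos_def A" and D: "pos_def D" using S x by (auto simp: A_def D_def pos_def_block_diag)
    define T where "T = transpose (matrix_inv (matrix_sqrt D))"
    have symD: "transpose (matrix_sqrt D) = matrix_sqrt D"
      using matrix_sqrt(1)[OF pos_def_imp_semidef[OF D]] by (simp add: pos_semidef_def)
    have symA: "transpose (matrix_sqrt A) = matrix_sqrt A"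
      using matrix_sqrt(1)[OF pos_def_imp_semidef[OF A]] by (simp add: pos_semidef_def)
    have T: "matrix_sqrt D ** T = mat 1" "T ** matrix_sqrt D = mat 1"
      using arg_cong[OF matrix_sqrt_inverse(2)[OF D], of transpose]
        arg_cong[OF matrix_sqrt_inverse(1)[OF D], of transpose]
      by (simp_all add: matrix_transpose_mul transpose_mat symD T_def)
    have TT: "spectral_norm (matrix_inv (matrix_sqrt D) ** matrix_sqrt A) = spectral_norm (matrix_sqrt A ** T)"
      using spectral_norm_transpose[of "matrix_inv (matrix_sqrt D) ** matrix_sqrt A"]
      by (simp add: matrix_transpose_mul symA T_def)
    have As: "s * (w \<bullet> w) \<le> w \<bullet> (A *v w)" and Al: "w \<bullet> (A *v w) \<le> \<bar>l\<bar> * (w \<bullet> w)" for w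
      using s(2)[OF x, of w] l[OF x, of w] mult_right_mono[OF abs_ge_self[of l], of "w \<bullet> w"]
      by (auto simp: A_def)
    have Ds: "s * (w \<bullet> w) \<le> w \<bullet> (D *v w)" and Dl: "w \<bullet> (D *v w) \<le> \<bar>l\<bar> * (w \<bullet> w)" for w
      unfolding D_def using As Al by (auto intro: quadratic_block_diag_bounds)
    have AD: "w \<bullet> (A *v w) \<le> c\<^sup>2 * (w \<bullet> (D *v w))" for w
      using Al[of w] mult_left_mono[OF Ds[of w], of "c\<^sup>2"] c by (simp add: mult.assoc[symmetric])
    have DA: "w \<bullet> (D *v w) \<le> c\<^sup>2 * (w \<bullet> (A *v w))" for w
      using Dl[of w] mult_left_mono[OF As[of w], of "c\<^sup>2"] c by (simp add: mult.assoc[symmetric])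
    define w :: "real^'n" where "w = axis undefined 1"
    have w0: "w \<noteq> 0" by (simp add: w_def)
    \<comment> \<open>A coordinate vector lies in a single block, where \<open>A\<close> and its block diagonal agree.\<close>
    have "w \<bullet> (D *v w) = w \<bullet> (A *v w)"
    proof -
      have wb: "w \<in> block_space blk (blk undefined)" by (auto simp: w_def block_space_def axis_def)
      have "w \<bullet> (D *v w) = (\<Sum>i\<in>UNIV. if i = blk undefined then w \<bullet> (A *v w) else 0)"
        unfolding D_def quadratic_block_diag
        by (intro sum.cong refl) (auto simp: subvec_block_space[OF wb] subvec_block_space_other[OF wb])
      thus ?thesis by simp
    qed
    note w = w0 this
    note R = matrix_sqrt_inverse[OF A]
    have "1 \<le> spectral_norm (matrix_sqrt D ** matrix_inv (matrix_sqrt A))"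
      using spectral_norm_sqrt_ratio_ge[OF D A R(2) w] .
    moreover have "1 \<le> spectral_norm (matrix_sqrt A ** T)"
      using spectral_norm_sqrt_ratio_ge[OF A D T(2) w(1) w(2)[symmetric]] .
    moreover have "spectral_norm (matrix_sqrt D ** matrix_inv (matrix_sqrt A)) \<le> c"
      using spectral_norm_sqrt_ratio_le[OF D A R(1) c(1) DA] .
    moreover have "spectral_norm (matrix_sqrt A ** T) \<le> c"
      using spectral_norm_sqrt_ratio_le[OF A D T(1) c(1) AD] .
    moreover have tx: "t x = (1 + \<eta>) * spectral_norm (matrix_sqrt D ** matrix_inv (matrix_sqrt A))
        + spectral_norm (matrix_sqrt A ** T)"
      by (simp add: t_def Let_def A_def[symmetric] D_def[symmetric] TT)
    moreover have "(1 + \<eta>) * 1 \<le> (1 + \<eta>) * spectral_norm (matrix_sqrt D ** matrix_inv (matrix_sqrt A))"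
      "(1 + \<eta>) * spectral_norm (matrix_sqrt D ** matrix_inv (matrix_sqrt A)) \<le> (1 + \<eta>) * c"
      using \<eta> calculation by (intro mult_left_mono; simp)+
    ultimately show ?thesis by simp
  qed
  obtain x where x: "x \<in> S" using S by blast
  have "bdd_above (t ` S)" using t by (auto intro!: bdd_aboveI2)
  hence "2 + \<eta> \<le> (SUP x\<in>S. t x)" using t[OF x] cSUP_upper[OF x, of t] by auto
  moreover have c1: "c1_const blk f \<eta> S = (1 - \<eta>) / (sqrt (real CARD('b)) * (SUP x\<in>S. t x))"
    unfolding c1_const_def t_def ..
  ultimately show "0 < c1_const blk f \<eta> S"
    using \<eta> by (auto intro!: divide_pos_pos mult_pos_pos)
  have "c1_const blk f \<eta> S * sqrt (real CARD('b)) = (1 - \<eta>) / (SUP x\<in>S. t x)"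
    using \<eta> by (simp add: c1)
  also have "\<dots> \<le> (1 - \<eta>) / (2 + \<eta>)"
    using \<open>2 + \<eta> \<le> (SUP x\<in>S. t x)\<close> \<eta> by (intro divide_left_mono) auto
  finally show "c1_const blk f \<eta> S * sqrt (real CARD('b)) \<le> (1 - \<eta>) / (2 + \<eta>)" .
qed

section \<open>Derivatives along lines\<close>

lemma grad_nth: "grad f x $ j = frechet_derivative (re f) (at x) (axis j 1)"
  by (simp add: grad_def)

lemma self_concordant_smooth:
  assumes sc: "self_concordant f" and y: "y \<in> edom f"
  shows "re f differentiable (at y)"
    and "(\<lambda>x. grad f x $ j) differentiable (at y)"
    and "(\<lambda>x. frechet_derivative (\<lambda>x. grad f x $ j) (at x) (axis k 1)) differentiable (at y)"
proof -
  have C: "Ck_on 3 (edom f) (re f)" using sc by (simp add: self_concordant_def)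
  have ax: "axis j 1 \<in> (Basis :: (real^'a) set)" for j by (simp add: axis_in_Basis_iff)
  show "re f differentiable (at y)" using C y by (simp add: numeral_3_eq_3)
  have C2: "Ck_on 2 (edom f) (\<lambda>x. grad f x $ j)" for j
    using C ax[of j] by (simp add: numeral_3_eq_3 numeral_2_eq_2 grad_nth)
  show "(\<lambda>x. grad f x $ j) differentiable (at y)" using C2 y by (simp add: numeral_2_eq_2)
  show "(\<lambda>x. frechet_derivative (\<lambda>x. grad f x $ j) (at x) (axis k 1)) differentiable (at y)"
    using C2[of j] ax[of k] y by (simp add: numeral_2_eq_2)
qed

lemma has_derivative_grad:
  fixes f :: "real^'n \<Rightarrow> ereal"
  assumes sc: "self_concordant f" and y: "y \<in> edom f"
  shows "(re f has_derivative (\<lambda>h. grad f y \<bullet> h)) (at y)"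
proof -
  let ?D = "frechet_derivative (re f) (at y)"
  have D: "(re f has_derivative ?D) (at y)"
    using self_concordant_smooth(1)[OF assms] frechet_derivative_works by blast
  hence lin: "linear ?D" by (rule has_derivative_linear)
  have "?D h = grad f y \<bullet> h" for h
  proof -
    have "?D h = ?D (\<Sum>j\<in>UNIV. h $ j *\<^sub>R axis j 1)" by (simp add: basis_expansion scalar_mult_eq_scaleR[symmetric])
    also have "\<dots> = (\<Sum>j\<in>UNIV. h $ j *\<^sub>R ?D (axis j 1))"
      by (simp add: linear_sum[OF lin] linear_scale[OF lin])
    finally show ?thesis by (simp add: inner_vec_def grad_nth mult.commute)
  qed
  hence "?D = (\<lambda>h. grad f y \<bullet> h)" by (rule ext)
  thus ?thesis using D by simp
qed

lemma has_derivative_hessian: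
  fixes f :: "real^'n \<Rightarrow> ereal"
  assumes sc: "self_concordant f" and y: "y \<in> edom f"
  shows "(grad f has_derivative (\<lambda>h. hessian f y *v h)) (at y)"
proof -
  let ?D = "\<lambda>j. frechet_derivative (\<lambda>x. grad f x $ j) (at y)"
  have D: "((\<lambda>x. grad f x $ j) has_derivative ?D j) (at y)" for j
    using self_concordant_smooth(2)[OF assms] frechet_derivative_works by blast
  have "(grad f has_derivative (\<lambda>h. \<chi> j. ?D j h)) (at y)"
    unfolding has_derivative_componentwise_within[of "grad f"]
    using D by (auto simp: Basis_vec_def inner_axis)
  hence "grad f differentiable (at y)" by (auto simp: differentiable_def)
  thus ?thesis using jacobian_works unfolding hessian_def by blast
qed

lemma hessian_nth:
  fixes f :: "real^'n \<Rightarrow> ereal"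
  assumes sc: "self_concordant f" and y: "y \<in> edom f"
  shows "hessian f y $ j $ k = frechet_derivative (\<lambda>x. grad f x $ j) (at y) (axis k 1)"
proof -
  have "((\<lambda>x. grad f x $ j) has_derivative (\<lambda>h. (hessian f y *v h) $ j)) (at y)"
    using has_derivative_hessian[OF assms] by (rule bounded_linear.has_derivative[OF bounded_linear_vec_nth])
  hence "frechet_derivative (\<lambda>x. grad f x $ j) (at y) = (\<lambda>h. (hessian f y *v h) $ j)"
    by (rule frechet_derivative_at[symmetric])
  thus ?thesis by (simp add: matrix_vector_mult_basis column_def)
qed

text \<open>The third derivative of \<open>f\<close> at \<open>y\<close> in direction \<open>u\<close>, obtained from the differentiability of the second
  derivatives as functions of the base point.\<close>

definition third_derivative :: "(real^'n \<Rightarrow> ereal) \<Rightarrow> real^'n \<Rightarrow> real^'n \<Rightarrow> real" where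
  "third_derivative f u y = frechet_derivative (\<lambda>z. u \<bullet> (hessian f z *v u)) (at y) u"

lemma quadratic_hessian_differentiable:
  fixes f :: "real^'n \<Rightarrow> ereal"
  assumes sc: "self_concordant f" and y: "y \<in> edom f"
  shows "(\<lambda>z. u \<bullet> (hessian f z *v u)) differentiable (at y)"
proof -
  have op: "open (edom f)" using sc by (simp add: self_concordant_def)
  have "(\<lambda>z. hessian f z $ j $ k) differentiable (at y)" for j k
  proof -
    from self_concordant_smooth(3)[OF assms, of j k] obtain D where
      "((\<lambda>x. frechet_derivative (\<lambda>x. grad f x $ j) (at x) (axis k 1)) has_derivative D) (at y)"
      by (auto simp: differentiable_def)
    hence "((\<lambda>z. hessian f z $ j $ k) has_derivative D) (at y)"
      by (rule has_derivative_transform_within_open[OF _ op y]) (simp add: hessian_nth[OF sc])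
    thus ?thesis by (auto simp: differentiable_def)
  qed
  hence "(\<lambda>z. \<Sum>j\<in>UNIV. \<Sum>k\<in>UNIV. u $ j * (hessian f z $ j $ k * u $ k)) differentiable (at y)"
    by (intro differentiable_sum differentiable_mult differentiable_const) auto
  thus ?thesis by (simp add: inner_vec_def matrix_vector_mult_def sum_distrib_left)
qed

lemma line_derivatives:
  fixes f :: "real^'n \<Rightarrow> ereal" and x u :: "real^'n"
  assumes sc: "self_concordant f" and y: "x + t *\<^sub>R u \<in> edom f"
  shows "((\<lambda>t. re f (x + t *\<^sub>R u)) has_real_derivative grad f (x + t *\<^sub>R u) \<bullet> u) (at t)"
    and "((\<lambda>t. grad f (x + t *\<^sub>R u) \<bullet> e) has_real_derivative e \<bullet> (hessian f (x + t *\<^sub>R u) *v u)) (at t)"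
    and "((\<lambda>t. u \<bullet> (hessian f (x + t *\<^sub>R u) *v u)) has_real_derivative
      third_derivative f u (x + t *\<^sub>R u)) (at t)"
proof -
  have line: "((\<lambda>t. x + t *\<^sub>R u) has_derivative (\<lambda>s. s *\<^sub>R u)) (at t)"
    by (auto intro!: derivative_eq_intros)
  have *: "((\<lambda>t. q (x + t *\<^sub>R u)) has_real_derivative D u) (at t)"
    if D: "(q has_derivative D) (at (x + t *\<^sub>R u))" for q :: "real^'n \<Rightarrow> real" and D
  proof -
    have "linear D" using D by (rule has_derivative_linear)
    hence "(\<lambda>s. D (s *\<^sub>R u)) = (*) (D u)" by (simp add: linear_scale mult.commute fun_eq_iff)
    thus ?thesis
      using diff_chain_at[OF line D] by (simp add: o_def has_field_derivative_def)
  qed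
  show "((\<lambda>t. re f (x + t *\<^sub>R u)) has_real_derivative grad f (x + t *\<^sub>R u) \<bullet> u) (at t)"
    by (rule *[OF has_derivative_grad[OF sc y]])
  have "((\<lambda>z. grad f z \<bullet> e) has_derivative (\<lambda>h. (hessian f (x + t *\<^sub>R u) *v h) \<bullet> e)) (at (x + t *\<^sub>R u))"
    using has_derivative_hessian[OF sc y] by (rule has_derivative_inner_left)
  from *[OF this] show "((\<lambda>t. grad f (x + t *\<^sub>R u) \<bullet> e) has_real_derivative
      e \<bullet> (hessian f (x + t *\<^sub>R u) *v u)) (at t)" by (simp add: inner_commute)
  show "((\<lambda>t. u \<bullet> (hessian f (x + t *\<^sub>R u) *v u)) has_real_derivative
      third_derivative f u (x + t *\<^sub>R u)) (at t)"
    unfolding third_derivative_def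
    using quadratic_hessian_differentiable[OF sc y] frechet_derivative_works by (intro *) blast
qed

text \<open>Self-concordance is stated for iterated derivatives of the restriction of \<open>f\<close> to a line; near 0 these
  agree with the gradient, the Hessian and its derivative.\<close>

lemma third_derivative_bound:
  fixes f :: "real^'n \<Rightarrow> ereal" and y u :: "real^'n"
  assumes sc: "self_concordant f" and y: "y \<in> edom f"
  shows "\<bar>third_derivative f u y\<bar> \<le> 2 * (u \<bullet> (hessian f y *v u)) powr (3/2)"
proof -
  define \<psi> where "\<psi> = (\<lambda>t. re f (y + t *\<^sub>R u))"
  define I where "I = (\<lambda>t. y + t *\<^sub>R u) -` edom f"
  have "open I" unfolding I_def
    using sc by (intro open_vimage continuous_intros) (auto simp: self_concordant_def)
  have I0: "0 \<in> I" using y by (simp add: I_def)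
  have 1: "deriv \<psi> t = grad f (y + t *\<^sub>R u) \<bullet> u" if "t \<in> I" for t
    using line_derivatives(1)[OF sc, of y t u] that unfolding I_def \<psi>_def by (auto intro: DERIV_imp_deriv)
  have cong: "deriv h t = deriv k t" if "\<And>s. s \<in> I \<Longrightarrow> h s = k s" "t \<in> I" for h k :: "real \<Rightarrow> real" and t
    using that \<open>open I\<close> by (intro deriv_cong_ev refl) (auto simp: eventually_nhds)
  have 2: "(deriv ^^ 2) \<psi> t = u \<bullet> (hessian f (y + t *\<^sub>R u) *v u)" if "t \<in> I" for t
  proof -
    have "(deriv ^^ 2) \<psi> t = deriv (\<lambda>t. grad f (y + t *\<^sub>R u) \<bullet> u) t"
      using cong[OF 1 that] by (simp add: numeral_2_eq_2)
    thus ?thesis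
      using line_derivatives(2)[OF sc, of y t u] that unfolding I_def by (auto intro: DERIV_imp_deriv)
  qed
  have "(deriv ^^ 3) \<psi> 0 = deriv (\<lambda>t. u \<bullet> (hessian f (y + t *\<^sub>R u) *v u)) 0"
    using cong[OF 2 I0] by (simp add: numeral_3_eq_3 numeral_2_eq_2)
  hence 3: "(deriv ^^ 3) \<psi> 0 = third_derivative f u y"
    using line_derivatives(3)[OF sc, of y 0 u] y by (auto dest: DERIV_imp_deriv)
  have "\<bar>(deriv ^^ 3) \<psi> 0\<bar> \<le> 2 * ((deriv ^^ 2) \<psi> 0) powr (3/2)"
    using sc y unfolding self_concordant_def Let_def \<psi>_def by blast
  thus ?thesis using 2[OF I0] 3 by simp
qed

section \<open>The self-concordant upper bound\<close>

text \<open>Self-concordance says that \<open>\<psi>2 powr (-1/2)\<close> has derivative at least \<open>-1\<close>. Hence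
  \<open>\<psi>2 t \<le> (r / (1 - r t))\<^sup>2\<close>, and integrating twice gives the claim.\<close>

lemma self_concordant_line_bound:
  fixes \<psi> \<psi>1 \<psi>2 \<psi>3 :: "real \<Rightarrow> real"
  assumes \<tau>: "0 \<le> \<tau>" and r: "0 < r" "r * \<tau> < 1" "\<psi>2 0 = r\<^sup>2"
    and d1: "\<And>t. 0 \<le> t \<Longrightarrow> t \<le> \<tau> \<Longrightarrow> (\<psi> has_real_derivative \<psi>1 t) (at t)"
    and d2: "\<And>t. 0 \<le> t \<Longrightarrow> t \<le> \<tau> \<Longrightarrow> (\<psi>1 has_real_derivative \<psi>2 t) (at t)"
    and d3: "\<And>t. 0 \<le> t \<Longrightarrow> t \<le> \<tau> \<Longrightarrow> (\<psi>2 has_real_derivative \<psi>3 t) (at t)"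
    and pos: "\<And>t. 0 \<le> t \<Longrightarrow> t \<le> \<tau> \<Longrightarrow> 0 < \<psi>2 t"
    and sc: "\<And>t. 0 \<le> t \<Longrightarrow> t \<le> \<tau> \<Longrightarrow> \<bar>\<psi>3 t\<bar> \<le> 2 * \<psi>2 t powr (3/2)"
  shows "\<psi> \<tau> \<le> \<psi> 0 + \<psi>1 0 * \<tau> - r * \<tau> - ln (1 - r * \<tau>)"
proof -
  have rt: "r * t < 1" if "t \<le> \<tau>" for t
    using mult_left_mono[OF that, of r] r by linarith
  have bound: "\<psi>2 t \<le> (r / (1 - r * t))\<^sup>2" if t: "0 \<le> t" "t \<le> \<tau>" for t
  proof -
    let ?u = "\<lambda>t. \<psi>2 t powr (-1/2) + t"
    have "?u 0 \<le> ?u t"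
    proof (rule DERIV_nonneg_imp_nondecreasing[OF t(1)])
      fix s assume s: "0 \<le> s" "s \<le> t"
      hence s': "0 \<le> s" "s \<le> \<tau>" using t by auto
      have "(?u has_real_derivative (-1/2) * \<psi>2 s powr (-1/2 - 1) * \<psi>3 s + 1) (at s)"
        using pos[OF s'] d3[OF s'] by (auto intro!: derivative_eq_intros)
      moreover have "\<psi>2 s powr (-1/2 - 1) * \<psi>3 s \<le> \<psi>2 s powr (-1/2 - 1) * (2 * \<psi>2 s powr (3/2))"
        using sc[OF s'] by (intro mult_left_mono) auto
      moreover have "\<psi>2 s powr (-1/2 - 1) * \<psi>2 s powr (3/2) = 1"
        using pos[OF s'] by (simp add: powr_add[symmetric])
      ultimately show "\<exists>y. (?u has_real_derivative y) (at s) \<and> 0 \<le> y"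
        by (intro exI[of _ "(-1/2) * \<psi>2 s powr (-1/2 - 1) * \<psi>3 s + 1"]) (auto simp: algebra_simps)
    qed
    moreover have root: "\<psi>2 s powr (-1/2) = 1 / sqrt (\<psi>2 s)" if "0 < \<psi>2 s" for s
      using that by (simp add: powr_half_sqrt powr_minus_divide)
    ultimately have "1 / r - t \<le> 1 / sqrt (\<psi>2 t)"
      using root[of 0] root[OF pos[OF t]] r by simp
    hence "(1 - r * t) / r \<le> 1 / sqrt (\<psi>2 t)" using r by (simp add: diff_divide_distrib)
    hence "sqrt (\<psi>2 t) \<le> r / (1 - r * t)"
      using rt[OF t(2)] r pos[OF t] by (simp add: field_simps)
    hence "(sqrt (\<psi>2 t))\<^sup>2 \<le> (r / (1 - r * t))\<^sup>2"
      using pos[OF t] by (intro power_mono) auto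
    thus ?thesis using pos[OF t] by simp
  qed
  have first: "\<psi>1 t \<le> \<psi>1 0 - r + r / (1 - r * t)" if t: "0 \<le> t" "t \<le> \<tau>" for t
  proof -
    let ?h = "\<lambda>t. r / (1 - r * t) - \<psi>1 t"
    have "?h 0 \<le> ?h t"
    proof (rule DERIV_nonneg_imp_nondecreasing[OF t(1)])
      fix s assume s: "0 \<le> s" "s \<le> t"
      hence s': "0 \<le> s" "s \<le> \<tau>" using t by auto
      have "(?h has_real_derivative (r / (1 - r * s))\<^sup>2 - \<psi>2 s) (at s)"
        using rt[OF s'(2)] d2[OF s']
        by (auto intro!: derivative_eq_intros simp: power2_eq_square)
      thus "\<exists>y. (?h has_real_derivative y) (at s) \<and> 0 \<le> y" using bound[OF s'] by force
    qed
    thus ?thesis by simp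
  qed
  let ?h = "\<lambda>t. (\<psi>1 0 - r) * t - ln (1 - r * t) - \<psi> t"
  have "?h 0 \<le> ?h \<tau>"
  proof (rule DERIV_nonneg_imp_nondecreasing[OF \<tau>])
    fix s assume s: "0 \<le> s" "s \<le> \<tau>"
    have "(?h has_real_derivative \<psi>1 0 - r + r / (1 - r * s) - \<psi>1 s) (at s)"
      using rt[OF s(2)] d1[OF s] by (auto intro!: derivative_eq_intros)
    thus "\<exists>y. (?h has_real_derivative y) (at s) \<and> 0 \<le> y" using first[OF s] by force
  qed
  thus ?thesis by (simp add: algebra_simps)
qed

lemma closed_sublevel_closed_convex:
  assumes "closed_convex_on UNIV f"
  shows "closed {y. f y \<le> ereal c}"
proof -
  have "{y. f y \<le> ereal c} = (\<lambda>y. (y, c)) -` epi_on UNIV f" by (auto simp: epi_on_def)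
  moreover have "closed ((\<lambda>y. (y, c)) -` epi_on UNIV f)"
    using assms by (intro continuous_closed_vimage) (auto simp: closed_convex_on_def intro!: continuous_intros)
  ultimately show ?thesis by simp
qed

lemma closed_convex_on_convexD:
  assumes h: "closed_convex_on V h" and x: "x \<in> V" "h x \<le> ereal a" and y: "y \<in> V" "h y \<le> ereal b"
    and t: "0 \<le> t" "t \<le> 1"
  shows "h (x + t *\<^sub>R (y - x)) \<le> ereal (a + t * (b - a))" "x + t *\<^sub>R (y - x) \<in> V"
proof -
  have "(1 - t) *\<^sub>R (x, a) + t *\<^sub>R (y, b) \<in> epi_on V h"
    using assms by (intro convexD) (auto simp: closed_convex_on_def epi_on_def)
  moreover have "(1 - t) *\<^sub>R (x, a) + t *\<^sub>R (y, b) = (x + t *\<^sub>R (y - x), a + t * (b - a))"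
    by (simp add: algebra_simps)
  ultimately show "h (x + t *\<^sub>R (y - x)) \<le> ereal (a + t * (b - a))" "x + t *\<^sub>R (y - x) \<in> V"
    by (simp_all add: epi_on_def)
qed

lemma ereal_re:
  assumes "h x \<noteq> -\<infinity>" "x \<in> edom h"
  shows "h x = ereal (re h x)"
  using assms by (cases "h x") (auto simp: edom_def)

text \<open>That \<open>x + \<tau> u\<close> lies in the domain is part of the claim. The set \<open>J\<close> of parameters for which \<open>x + t u\<close> is
  in the domain is open in \<open>[0, \<tau>]\<close>. On \<open>J\<close> the line bound holds, so \<open>f\<close> is bounded by a constant \<open>C\<close> there;
  thus \<open>J\<close> is given by the closed condition \<open>f (x + t u) \<le> C\<close> and is all of \<open>[0, \<tau>]\<close> by connectedness.\<close>

lemma self_concordant_step: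
  fixes f :: "real^'n \<Rightarrow> ereal" and x u :: "real^'n"
  assumes sc: "self_concordant f" and x: "x \<in> edom f" and \<tau>: "0 \<le> \<tau>"
    and pos: "\<And>t. 0 \<le> t \<Longrightarrow> t \<le> \<tau> \<Longrightarrow> x + t *\<^sub>R u \<in> edom f \<Longrightarrow> 0 < u \<bullet> (hessian f (x + t *\<^sub>R u) *v u)"
    and r: "r = sqrt (u \<bullet> (hessian f x *v u))" "r * \<tau> < 1"
  shows "x + \<tau> *\<^sub>R u \<in> edom f"
    and "re f (x + \<tau> *\<^sub>R u) \<le> re f x + (grad f x \<bullet> u) * \<tau> - r * \<tau> - ln (1 - r * \<tau>)"
proof -
  have f: "closed_convex_on UNIV f" "open (edom f)" "\<And>y. f y \<noteq> -\<infinity>"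
    using sc by (auto simp: self_concordant_def)
  have fre: "f y = ereal (re f y)" if "y \<in> edom f" for y using ereal_re[OF f(3) that] .
  have "0 < u \<bullet> (hessian f x *v u)" using pos[of 0] x \<tau> by simp
  hence r0: "0 < r" "r\<^sup>2 = u \<bullet> (hessian f x *v u)" unfolding r(1) by simp_all
  define J where "J = {t \<in> {0..\<tau>}. x + t *\<^sub>R u \<in> edom f}"
  have J_down: "s \<in> J" if "t \<in> J" "0 \<le> s" "s \<le> t" for s t
  proof (cases "t = 0")
    case False
    have "f (x + (s / t) *\<^sub>R (x + t *\<^sub>R u - x)) \<le> ereal (re f x + (s / t) * (re f (x + t *\<^sub>R u) - re f x))"
      using closed_convex_on_convexD(1)[OF f(1), of x "re f x" "x + t *\<^sub>R u" "re f (x + t *\<^sub>R u)" "s / t"]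
        fre[OF x] fre[of "x + t *\<^sub>R u"] that False by (auto simp: J_def)
    hence "x + s *\<^sub>R u \<in> edom f" using False by (auto simp: edom_def)
    thus ?thesis using that by (auto simp: J_def)
  qed (use that in auto)
  have bound: "re f (x + t *\<^sub>R u) \<le> re f x + (grad f x \<bullet> u) * t - r * t - ln (1 - r * t)" if "t \<in> J" for t
  proof -
    have in_dom: "x + s *\<^sub>R u \<in> edom f" if "0 \<le> s" "s \<le> t" for s
      using J_down[OF \<open>t \<in> J\<close> that] by (simp add: J_def)
    have t: "0 \<le> t" "t \<le> \<tau>" using that by (auto simp: J_def)
    have "r * t < 1" using mult_left_mono[OF t(2), of r] r0 r by linarith
    from self_concordant_line_bound[where \<psi> = "\<lambda>t. re f (x + t *\<^sub>R u)" and
      ?\<psi>1.0 = "\<lambda>t. grad f (x + t *\<^sub>R u) \<bullet> u" and ?\<psi>2.0 = "\<lambda>t. u \<bullet> (hessian f (x + t *\<^sub>R u) *v u)" and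
      ?\<psi>3.0 = "\<lambda>t. third_derivative f u (x + t *\<^sub>R u)", OF t(1) r0(1) this]
    show ?thesis
      using in_dom t r0 pos by (simp add: line_derivatives[OF sc] third_derivative_bound[OF sc])
  qed
  define C where "C = re f x + \<bar>grad f x \<bullet> u\<bar> * \<tau> - ln (1 - r * \<tau>)"
  have "J = {t \<in> {0..\<tau>}. f (x + t *\<^sub>R u) \<le> ereal C}"
  proof (intro equalityI subsetI)
    fix t assume t: "t \<in> J"
    hence t': "0 \<le> t" "t \<le> \<tau>" by (auto simp: J_def)
    have "r * t \<le> r * \<tau>" using t' r0 by (intro mult_left_mono) auto
    hence "ln (1 - r * \<tau>) \<le> ln (1 - r * t)" using r by (intro ln_mono) auto
    moreover have "(grad f x \<bullet> u) * t \<le> \<bar>grad f x \<bullet> u\<bar> * \<tau>"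
      using t' by (intro mult_mono) auto
    moreover have "0 \<le> r * t" using t' r0 by simp
    ultimately have "re f (x + t *\<^sub>R u) \<le> C" using bound[OF t] unfolding C_def by linarith
    moreover have "f (x + t *\<^sub>R u) = ereal (re f (x + t *\<^sub>R u))" using t by (intro fre) (simp add: J_def)
    ultimately have "f (x + t *\<^sub>R u) \<le> ereal C" by (metis ereal_less_eq(3))
    thus "t \<in> {t \<in> {0..\<tau>}. f (x + t *\<^sub>R u) \<le> ereal C}" using t by (simp add: J_def)
  qed (auto simp: J_def edom_def)
  also have "\<dots> = {0..\<tau>} \<inter> (\<lambda>t. x + t *\<^sub>R u) -` {y. f y \<le> ereal C}" by auto
  finally have "closedin (top_of_set {0..\<tau>}) J"
    using closed_sublevel_closed_convex[OF f(1)]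
    by (auto simp: closedin_closed intro!: exI[of _ "(\<lambda>t. x + t *\<^sub>R u) -` {y. f y \<le> ereal C}"]
        continuous_closed_vimage continuous_intros)
  moreover have "openin (top_of_set {0..\<tau>}) J"
  proof -
    have "J = {0..\<tau>} \<inter> (\<lambda>t. x + t *\<^sub>R u) -` edom f" by (auto simp: J_def)
    moreover have "open ((\<lambda>t. x + t *\<^sub>R u) -` edom f)"
      using f(2) by (intro open_vimage continuous_intros)
    ultimately show ?thesis by (auto simp: openin_open)
  qed
  ultimately have "J = {} \<or> J = {0..\<tau>}"
    using connected_clopen[of "{0..\<tau>}"] by (auto simp: connected_Icc)
  moreover have "0 \<in> J" using x \<tau> by (simp add: J_def)
  ultimately have "\<tau> \<in> J" using \<tau> by auto
  thus "x + \<tau> *\<^sub>R u \<in> edom f" by (simp add: J_def)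
  show "re f (x + \<tau> *\<^sub>R u) \<le> re f x + (grad f x \<bullet> u) * \<tau> - r * \<tau> - ln (1 - r * \<tau>)"
    by (rule bound[OF \<open>\<tau> \<in> J\<close>])
qed

section \<open>Sublevel sets\<close>

text \<open>Sublevel sets of a sum of closed functions are closed: a strict lower bound for a sum can be split
  into strict lower bounds for the summands, which hold on open sets.\<close>

lemma less_ereal_add_iff:
  assumes "a \<noteq> -\<infinity>" "b \<noteq> -\<infinity>"
  shows "ereal c < a + b \<longleftrightarrow> (\<exists>q. ereal q < a \<and> ereal (c - q) < b)"
proof (cases a)
  case (real r)
  show ?thesis
  proof (cases b)
    case (real s)
    have "(c < r + s) = (\<exists>q. q < r \<and> c - q < s)"
    proof
      assume "c < r + s"
      thus "\<exists>q. q < r \<and> c - q < s"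
        by (intro exI[of _ "r - (r + s - c) / 2"]) (simp add: field_simps)
    qed auto
    thus ?thesis using real \<open>a = ereal r\<close> by simp
  next
    case PInf
    thus ?thesis using real by (auto intro: exI[of _ "r - 1"])
  qed (use assms in simp)
next
  case PInf
  show ?thesis
  proof (cases b)
    case (real s)
    thus ?thesis using PInf by (auto intro!: exI[of _ "c - s + 1"])
  qed (use assms PInf in auto)
qed (use assms in simp)

lemma closed_sublevel_add:
  fixes h k :: "'a::topological_space \<Rightarrow> ereal"
  assumes h: "\<And>c. closed {x. h x \<le> ereal c}" "\<And>x. h x \<noteq> -\<infinity>"
    and k: "\<And>c. closed {x. k x \<le> ereal c}" "\<And>x. k x \<noteq> -\<infinity>"
  shows "closed {x. h x + k x \<le> ereal c}"
proof -
  have op: "open {x. ereal q < h x}" "open {x. ereal q < k x}" for q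
    using h(1)[of q] k(1)[of q] by (auto simp: closed_def Collect_neg_eq[symmetric] not_le)
  have "- {x. h x + k x \<le> ereal c} = (\<Union>q. {x. ereal q < h x} \<inter> {x. ereal (c - q) < k x})"
  proof -
    have "ereal c < h x + k x \<longleftrightarrow> (\<exists>q. ereal q < h x \<and> ereal (c - q) < k x)" for x
      by (rule less_ereal_add_iff[OF h(2) k(2)])
    thus ?thesis by (auto simp: set_eq_iff not_le)
  qed
  moreover have "open \<dots>" using op by auto
  ultimately show ?thesis by (simp add: closed_def)
qed

lemma sum_not_MInfty:
  fixes h :: "'i \<Rightarrow> ereal"
  assumes "\<And>i. h i \<noteq> -\<infinity>"
  shows "(\<Sum>i\<in>I. h i) \<noteq> -\<infinity>"
proof (induction I rule: infinite_finite_induct)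
  case (insert i I)
  thus ?case using assms[of i] by (cases "h i"; cases "\<Sum>i\<in>I. h i") auto
qed auto

lemma closed_sublevel_sum:
  fixes h :: "'i \<Rightarrow> 'a::topological_space \<Rightarrow> ereal"
  assumes "finite I" and h: "\<And>i c. closed {x. h i x \<le> ereal c}" "\<And>i x. h i x \<noteq> -\<infinity>"
  shows "closed {x. (\<Sum>i\<in>I. h i x) \<le> ereal c}"
  using assms(1)
proof (induction I arbitrary: c)
  case (insert i I)
  have "(\<Sum>i\<in>I. h i x) \<noteq> -\<infinity>" for x by (rule sum_not_MInfty) (rule h)
  with insert h show ?case by (auto intro: closed_sublevel_add)
qed simp

text \<open>A closed convex function with a unique minimiser exceeds its minimum by a positive amount on
  the unit sphere around it, hence grows at least linearly.\<close>

lemma compact_sublevel_unique_minimizer: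
  fixes F :: "'a::euclidean_space \<Rightarrow> ereal"
  assumes closed: "\<And>c. closed {x. F x \<le> ereal c}"
    and conv: "\<And>x y a b t. F x \<le> ereal a \<Longrightarrow> F y \<le> ereal b \<Longrightarrow> 0 \<le> t \<Longrightarrow> t \<le> 1 \<Longrightarrow>
      F (x + t *\<^sub>R (y - x)) \<le> ereal (a + t * (b - a))"
    and min: "F z = ereal m" and uniq: "\<And>x. F x \<le> ereal m \<Longrightarrow> x = z"
  shows "compact {x. F x \<le> ereal c}"
proof -
  define K where "K n = sphere z 1 \<inter> {x. F x \<le> ereal (m + 1 / real (Suc n))}" for n
  have "\<exists>n. K n = {}"
  proof (rule ccontr)
    assume "\<nexists>n. K n = {}"
    hence "K n \<noteq> {}" for n by blast
    moreover have "compact (K n)" for n by (simp add: K_def closed compact_Int_closed)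
    moreover have "K n \<subseteq> K m" if "m \<le> n" for m n
    proof -
      have "1 / real (Suc n) \<le> 1 / real (Suc m)" using that by (intro divide_left_mono) auto
      thus ?thesis by (auto simp: K_def intro: order_trans)
    qed
    ultimately have "(\<Inter>n. K n) \<noteq> {}" by (intro compact_nest)
    then obtain x where x: "\<And>n. x \<in> K n" by blast
    have "F x \<le> ereal m"
    proof (rule ereal_le_epsilon2)
      fix e :: real assume "0 < e"
      then obtain n where "1 / real (Suc n) < e" using nat_approx_posE by blast
      moreover have "F x \<le> ereal (m + 1 / real (Suc n))" using x by (simp add: K_def)
      ultimately show "F x \<le> ereal m + ereal e"
        by (metis add_left_mono ereal_less_eq(3) less_imp_le order_trans plus_ereal.simps(1))
    qed
    with uniq x[of 0] show False by (auto simp: K_def)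
  qed
  then obtain n where n: "K n = {}" by blast
  have "dist z x \<le> max 1 (\<bar>c - m\<bar> * real (Suc n))" if x: "F x \<le> ereal c" for x
  proof (rule ccontr)
    define R where "R = dist z x"
    assume "\<not> dist z x \<le> max 1 (\<bar>c - m\<bar> * real (Suc n))"
    hence R: "1 < R" "\<bar>c - m\<bar> * real (Suc n) < R" by (auto simp: R_def)
    \<comment> \<open>the point of the segment from the minimiser to \<open>x\<close> at distance 1 from the minimiser\<close>
    let ?y = "z + (1 / R) *\<^sub>R (x - z)"
    have "F ?y \<le> ereal (m + 1 / R * (c - m))" using R min x by (intro conv) auto
    moreover have "1 / R * (c - m) \<le> 1 / real (Suc n)"
    proof -
      have "(c - m) * real (Suc n) \<le> \<bar>c - m\<bar> * real (Suc n)" by (intro mult_right_mono) auto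
      thus ?thesis using R by (simp add: field_simps)
    qed
    ultimately have "F ?y \<le> ereal (m + 1 / real (Suc n))"
      by (meson add_left_mono ereal_less_eq(3) order_trans)
    moreover have "?y \<in> sphere z 1"
      using R by (auto simp: R_def dist_norm norm_minus_commute)
    ultimately show False using n by (auto simp: K_def)
  qed
  hence "bounded {x. F x \<le> ereal c}" unfolding bounded_def by blast
  thus ?thesis using closed compact_eq_bounded_closed by blast
qed

section \<open>Expectation along an independent sequence of choices\<close>

text \<open>The iteration with an arbitrary update map \<open>T\<close>, driven by the sequence \<open>c\<close> of choices.\<close>

primrec random_path :: "('b \<Rightarrow> 'a \<Rightarrow> 'a) \<Rightarrow> 'a \<Rightarrow> (nat \<Rightarrow> 'b) \<Rightarrow> nat \<Rightarrow> 'a" where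
  "random_path T x0 c 0 = x0"
| "random_path T x0 c (Suc k) = T (c k) (random_path T x0 c k)"

lemma random_path_cong:
  "(\<And>j. j < k \<Longrightarrow> c j = c' j) \<Longrightarrow> random_path T x0 c k = random_path T x0 c' k"
  by (induction k) auto

context prob_space
begin

text \<open>A function of the first \<open>k\<close> choices takes finitely many values, on the events fixing these choices;
  independence gives the probabilities of these events as products.\<close>

lemma nn_integral_independent_choices:
  fixes \<iota> :: "nat \<Rightarrow> 'a \<Rightarrow> 'b::finite" and h :: "(nat \<Rightarrow> 'b) \<Rightarrow> ennreal"
  assumes ind: "indep_vars (\<lambda>_. count_space UNIV) \<iota> UNIV"
    and dist: "\<And>k i. prob {w \<in> space M. \<iota> k w = i} = p i"
  shows "(\<integral>\<^sup>+ w. h (\<lambda>j\<in>{..<k}. \<iota> j w) \<partial>M)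
    = (\<Sum>c\<in>PiE {..<k} (\<lambda>_. UNIV). ennreal (\<Prod>j<k. p (c j)) * h c)"
proof -
  define A where "A c = {w \<in> space M. \<forall>j<k. \<iota> j w = c j}" for c
  have meas: "\<iota> j \<in> measurable M (count_space UNIV)" for j
    using ind by (simp add: indep_vars_def)
  have A: "A c \<in> sets M" for c
  proof -
    have "{w \<in> space M. \<iota> j w = i} \<in> sets M" for j i
      using measurable_sets[OF meas[of j], of "{i}"] by (simp add: vimage_def Int_def conj_commute)
    thus ?thesis unfolding A_def by (intro sets.sets_Collect_countable_All' sets.sets_Collect) auto
  qed
  have prob_A: "emeasure M (A c) = ennreal (\<Prod>j<k. p (c j))" for c
  proof (cases "k = 0")
    case True
    thus ?thesis by (simp add: A_def emeasure_space_1)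
  next
    case False
    have "A c = (\<Inter>j\<in>{..<k}. \<iota> j -` {c j} \<inter> space M)" using False by (auto simp: A_def)
    also have "prob \<dots> = (\<Prod>j<k. prob (\<iota> j -` {c j} \<inter> space M))"
      using False by (intro indep_varsD[OF ind]) auto
    also have "\<dots> = (\<Prod>j<k. p (c j))"
      using dist by (intro prod.cong refl) (simp add: vimage_def Int_def conj_commute)
    finally show ?thesis by (simp add: emeasure_eq_measure)
  qed
  have fin: "finite (PiE {..<k} (\<lambda>_. UNIV :: 'b set))" by (intro finite_PiE) auto
  have "(\<integral>\<^sup>+ w. h (\<lambda>j\<in>{..<k}. \<iota> j w) \<partial>M)
    = (\<integral>\<^sup>+ w. (\<Sum>c\<in>PiE {..<k} (\<lambda>_. UNIV). h c * indicator (A c) w) \<partial>M)"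
  proof (rule nn_integral_cong)
    fix w assume w: "w \<in> space M"
    let ?r = "\<lambda>j\<in>{..<k}. \<iota> j w"
    have "w \<in> A c \<longleftrightarrow> c = ?r" if "c \<in> PiE {..<k} (\<lambda>_. UNIV)" for c
      using that w by (auto simp: A_def PiE_def extensional_def fun_eq_iff)
    hence "(\<Sum>c\<in>PiE {..<k} (\<lambda>_. UNIV). h c * indicator (A c) w)
      = (\<Sum>c\<in>PiE {..<k} (\<lambda>_. UNIV). if c = ?r then h c else 0)"
      by (intro sum.cong refl) auto
    also have "\<dots> = h ?r" using fin by (simp add: sum.delta PiE_def)
    finally show "h ?r = (\<Sum>c\<in>PiE {..<k} (\<lambda>_. UNIV). h c * indicator (A c) w)" by simp
  qed
  also have "\<dots> = (\<Sum>c\<in>PiE {..<k} (\<lambda>_. UNIV). h c * emeasure M (A c))"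
    using A by (simp add: nn_integral_sum nn_integral_cmult_indicator)
  finally show ?thesis by (simp add: prob_A mult.commute)
qed

text \<open>Summing over the last choice first, which is independent of the path so far, contracts by \<open>\<rho>\<close>.\<close>

lemma expected_contraction:
  fixes \<iota> :: "nat \<Rightarrow> 'a \<Rightarrow> 'b::finite" and \<Phi> :: "'c \<Rightarrow> ennreal"
  assumes ind: "indep_vars (\<lambda>_. count_space UNIV) \<iota> UNIV"
    and dist: "\<And>k i. prob {w \<in> space M. \<iota> k w = i} = p i"
    and S: "x0 \<in> S" "\<And>i x. x \<in> S \<Longrightarrow> T i x \<in> S"
    and contr: "\<And>x. x \<in> S \<Longrightarrow> (\<Sum>i\<in>UNIV. ennreal (p i) * \<Phi> (T i x)) \<le> \<rho> * \<Phi> x"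
  shows "(\<integral>\<^sup>+ w. \<Phi> (random_path T x0 (\<lambda>j. \<iota> j w) k) \<partial>M) \<le> \<rho> ^ k * \<Phi> x0"
proof -
  have p: "0 \<le> p i" for i using dist[of 0 i] by (metis measure_nonneg)
  have path_S: "random_path T x0 c k \<in> S" for c k by (induction k) (use S in auto)
  define E where "E k = (\<Sum>c\<in>PiE {..<k} (\<lambda>_. UNIV). ennreal (\<Prod>j<k. p (c j)) * \<Phi> (random_path T x0 c k))" for k
  have step: "E (Suc k) \<le> \<rho> * E k" for k
  proof -
    let ?P = "PiE {..<k} (\<lambda>_. UNIV :: 'b set)"
    let ?u = "\<lambda>(i, c). c(k := i)"
    have inj: "inj_on ?u (UNIV \<times> ?P)" by (rule inj_combinator) simp
    have "E (Suc k) = (\<Sum>(i, c)\<in>UNIV \<times> ?P. ennreal (\<Prod>j<Suc k. p ((c(k := i)) j))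
        * \<Phi> (random_path T x0 (c(k := i)) (Suc k)))"
      unfolding E_def lessThan_Suc PiE_insert_eq sum.reindex[OF inj]
      by (simp add: case_prod_beta o_def)
    also have "\<dots> = (\<Sum>(i, c)\<in>UNIV \<times> ?P. ennreal (\<Prod>j<k. p (c j)) * (ennreal (p i)
        * \<Phi> (T i (random_path T x0 c k))))"
    proof (intro sum.cong refl, clarify)
      fix i c
      have "random_path T x0 (c(k := i)) k = random_path T x0 c k" by (rule random_path_cong) auto
      moreover have "(\<Prod>j<k. p ((c(k := i)) j)) = (\<Prod>j<k. p (c j))" by (intro prod.cong) auto
      ultimately show "ennreal (\<Prod>j<Suc k. p ((c(k := i)) j)) * \<Phi> (random_path T x0 (c(k := i)) (Suc k))
        = ennreal (\<Prod>j<k. p (c j)) * (ennreal (p i) * \<Phi> (T i (random_path T x0 c k)))"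
        using p by (simp add: ennreal_mult prod_nonneg mult.assoc)
    qed
    also have "\<dots> = (\<Sum>c\<in>?P. ennreal (\<Prod>j<k. p (c j)) * (\<Sum>i\<in>UNIV. ennreal (p i)
        * \<Phi> (T i (random_path T x0 c k))))"
      by (simp add: sum.cartesian_product[symmetric] sum_distrib_left) (rule sum.swap)
    also have "\<dots> \<le> (\<Sum>c\<in>?P. ennreal (\<Prod>j<k. p (c j)) * (\<rho> * \<Phi> (random_path T x0 c k)))"
      by (intro sum_mono mult_left_mono contr path_S) simp
    also have "\<dots> = \<rho> * E k" by (simp add: E_def sum_distrib_left mult_ac)
    finally show ?thesis .
  qed
  have "E k \<le> \<rho> ^ k * \<Phi> x0"
  proof (induction k)
    case (Suc k)
    have "E (Suc k) \<le> \<rho> * E k" by (rule step)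
    also have "\<dots> \<le> \<rho> * (\<rho> ^ k * \<Phi> x0)" by (intro mult_left_mono Suc.IH) simp
    finally show ?case by (simp add: mult.assoc)
  qed (simp add: E_def)
  moreover have "(\<integral>\<^sup>+ w. \<Phi> (random_path T x0 (\<lambda>j. \<iota> j w) k) \<partial>M) = E k"
  proof -
    have "random_path T x0 (\<lambda>j. \<iota> j w) k = random_path T x0 (\<lambda>j\<in>{..<k}. \<iota> j w) k" for w
      by (rule random_path_cong) simp
    thus ?thesis
      using nn_integral_independent_choices[OF ind dist, of "\<lambda>c. \<Phi> (random_path T x0 c k)" k]
      by (simp add: E_def)
  qed
  ultimately show ?thesis by simp
qed

end

section \<open>The composite objective\<close>

text \<open>The standing assumptions of the method. On its domain the objective \<open>F\<close> is the extended real
  \<open>ereal (rF x)\<close>, and \<open>rF\<close> is what the estimates work with; \<open>xs\<close> is the minimiser.\<close>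

locale rbpdn_setting =
  fixes blk :: "'n::finite \<Rightarrow> 'b::finite"
    and f :: "real^'n \<Rightarrow> ereal"
    and g :: "'b \<Rightarrow> real^'n \<Rightarrow> ereal"
    and d :: "'b \<Rightarrow> real^'n \<Rightarrow> real^'n"
    and p :: "'b \<Rightarrow> real"
    and \<eta> :: real
    and x0 :: "real^'n"
  assumes sc: "self_concordant f"
    and g_proper: "\<And>i. proper_on (block_space blk i) (g i)"
    and g_closed: "\<And>i. closed_convex_on (block_space blk i) (g i)"
    and hessian_continuous: "continuous_on (edom (objective blk f g)) (hessian f)"
    and hessian_pos_def: "\<And>x. x \<in> edom (objective blk f g) \<Longrightarrow> pos_def (hessian f x)"
    and unique_min: "\<exists>!x. is_arg_min (objective blk f g) (\<lambda>_. True) x"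
    and x0_dom: "x0 \<in> edom (objective blk f g)"
    and \<eta>: "0 \<le> \<eta>" "\<eta> \<le> 1/4"
    and p_pos: "\<And>i. 0 < p i"
    and p_sum: "(\<Sum>i\<in>UNIV. p i) = 1"
    and direction: "\<And>x i. x \<in> edom (objective blk f g) \<Longrightarrow> approx_direction blk f g \<eta> i x (d i x)"
begin

abbreviation F :: "real^'n \<Rightarrow> ereal" where "F \<equiv> objective blk f g"
abbreviation S :: "(real^'n) set" where "S \<equiv> sublevel F x0"
abbreviation gb :: "'b \<Rightarrow> real^'n \<Rightarrow> ereal" where "gb i x \<equiv> g i (subvec blk i x)"
abbreviation rg :: "'b \<Rightarrow> real^'n \<Rightarrow> real" where "rg i x \<equiv> real_of_ereal (gb i x)"

definition rF :: "real^'n \<Rightarrow> real" where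
  "rF x = re f x + (\<Sum>i\<in>UNIV. rg i x)"

lemma f_not_MInf: "f x \<noteq> -\<infinity>"
  using sc by (simp add: self_concordant_def)

lemma gb_not_MInf: "gb i x \<noteq> -\<infinity>"
  using g_proper[of i] by (simp add: proper_on_def)

lemma gb_real: "gb i x < \<infinity> \<Longrightarrow> gb i x = ereal (rg i x)"
  using gb_not_MInf[of i x] by (cases "gb i x") auto

lemma f_real: "x \<in> edom f \<Longrightarrow> f x = ereal (re f x)"
  using ereal_re[of f x] f_not_MInf[of x] by blast

lemma f_closed_convex: "closed_convex_on UNIV f" and open_edom_f: "open (edom f)"
  using sc by (auto simp: self_concordant_def)

lemma edom_F: "x \<in> edom F \<longleftrightarrow> x \<in> edom f \<and> (\<forall>i. gb i x < \<infinity>)"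
proof -
  have "(\<Sum>i\<in>UNIV. gb i x) \<noteq> -\<infinity>" by (rule sum_not_MInfty) (rule gb_not_MInf)
  moreover have "(\<Sum>i\<in>UNIV. gb i x) = \<infinity> \<longleftrightarrow> (\<exists>i. gb i x = \<infinity>)" by (simp add: sum_Pinfty)
  ultimately show ?thesis
    using f_not_MInf[of x]
    by (cases "f x"; cases "\<Sum>i\<in>UNIV. gb i x") (auto simp: edom_def objective_def less_top[symmetric] top_ereal_def)
qed

lemma edom_F_f: "x \<in> edom F \<Longrightarrow> x \<in> edom f" and edom_F_gb: "x \<in> edom F \<Longrightarrow> gb i x < \<infinity>"
  by (auto simp: edom_F)

lemma F_real:
  assumes "x \<in> edom F"
  shows "F x = ereal (rF x)"
proof -
  have "(\<Sum>i\<in>UNIV. gb i x) = (\<Sum>i\<in>UNIV. ereal (rg i x))"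
    by (intro sum.cong refl gb_real edom_F_gb assms)
  moreover have "f x = ereal (re f x)" by (intro f_real edom_F_f assms)
  ultimately show ?thesis unfolding objective_def rF_def
    by (metis plus_ereal.simps(1) sum_ereal)
qed

lemma F_le_sum:
  assumes "f z \<le> ereal a" "\<And>i. gb i z \<le> ereal (b i)"
  shows "F z \<le> ereal (a + (\<Sum>i\<in>UNIV. b i))"
proof -
  have "F z \<le> ereal a + (\<Sum>i\<in>UNIV. ereal (b i))"
    unfolding objective_def using assms by (intro add_mono sum_mono) auto
  thus ?thesis by simp
qed

lemma F_le_dom: "F z \<le> ereal a \<Longrightarrow> z \<in> edom F"
  by (auto simp: edom_def)

lemma F_le_rF: "F z \<le> ereal a \<Longrightarrow> rF z \<le> a"
  using F_real[OF F_le_dom] by fastforce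

lemma gb_convex:
  assumes "gb i x < \<infinity>" "gb i y < \<infinity>" "0 \<le> t" "t \<le> 1"
  shows "gb i (x + t *\<^sub>R (y - x)) \<le> ereal (rg i x + t * (rg i y - rg i x))"
proof -
  have "gb i x \<le> ereal (rg i x)" "gb i y \<le> ereal (rg i y)"
    using gb_real[of i x] gb_real[of i y] assms by (metis order_refl)+
  from closed_convex_on_convexD(1)[OF g_closed _ this(1) _ this(2) assms(3,4)]
  show ?thesis by (simp add: subvec_add subvec_diff subvec_scaleR)
qed

lemma F_convex:
  assumes x: "F x \<le> ereal a" and y: "F y \<le> ereal b" and t: "0 \<le> t" "t \<le> 1"
  shows "F (x + t *\<^sub>R (y - x)) \<le> ereal (a + t * (b - a))"
proof -
  note dom = F_le_dom[OF x] F_le_dom[OF y]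
  have "f x \<le> ereal (re f x)" "f y \<le> ereal (re f y)"
    using f_real[OF edom_F_f] dom by (metis order_refl)+
  hence fz: "f (x + t *\<^sub>R (y - x)) \<le> ereal (re f x + t * (re f y - re f x))"
    by (intro closed_convex_on_convexD(1)[OF f_closed_convex] t) simp_all
  have "F (x + t *\<^sub>R (y - x)) \<le> ereal (re f x + t * (re f y - re f x)
      + (\<Sum>i\<in>UNIV. rg i x + t * (rg i y - rg i x)))"
    by (intro F_le_sum gb_convex edom_F_gb fz t dom)
  also have "re f x + t * (re f y - re f x) + (\<Sum>i\<in>UNIV. rg i x + t * (rg i y - rg i x))
      = rF x + t * (rF y - rF x)"
    by (simp add: rF_def sum.distrib sum_distrib_left[symmetric] sum_subtractf algebra_simps)
  also have "rF x + t * (rF y - rF x) \<le> a + t * (b - a)"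
  proof -
    have "(1 - t) * rF x \<le> (1 - t) * a" "t * rF y \<le> t * b"
      using t F_le_rF[OF x] F_le_rF[OF y] by (auto intro!: mult_left_mono)
    thus ?thesis by (simp add: algebra_simps)
  qed
  finally show ?thesis by simp
qed

lemma closed_F_sublevel: "closed {x. F x \<le> ereal c}"
proof -
  have "closed {x. gb i x \<le> ereal c}" for i c
  proof -
    have "{x. gb i x \<le> ereal c} = (\<lambda>x. (subvec blk i x, c)) -` epi_on (block_space blk i) (g i)"
      by (auto simp: epi_on_def)
    moreover have "closed ((\<lambda>x. (subvec blk i x, c)) -` epi_on (block_space blk i) (g i))"
      using g_closed[of i] linear_subvec[of blk i, unfolded linear_conv_bounded_linear]
      by (intro continuous_closed_vimage continuous_Pair linear_continuous_at continuous_const)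
        (simp_all add: closed_convex_on_def)
    ultimately show ?thesis by simp
  qed
  hence "closed {x. (\<Sum>i\<in>UNIV. gb i x) \<le> ereal c}" for c
    using gb_not_MInf by (intro closed_sublevel_sum) auto
  thus ?thesis unfolding objective_def
    by (intro closed_sublevel_add closed_sublevel_closed_convex[OF f_closed_convex]
        f_not_MInf sum_not_MInfty gb_not_MInf)
qed

definition xs :: "real^'n" where
  "xs = (THE x. is_arg_min F (\<lambda>_. True) x)"

lemma xs_min: "F xs \<le> F x"
proof -
  have "is_arg_min F (\<lambda>_. True) xs" unfolding xs_def by (rule theI'[OF unique_min])
  thus ?thesis by (auto simp: is_arg_min_def not_less)
qed

lemma xs_unique: "F x \<le> F xs \<Longrightarrow> x = xs"
proof -
  assume x: "F x \<le> F xs"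
  have "is_arg_min F (\<lambda>_. True) y" if "F y \<le> F xs" for y
    using that xs_min by (auto simp: is_arg_min_def not_less intro: order_trans)
  thus "x = xs" using unique_min x by blast
qed

lemma xs_dom: "xs \<in> edom F"
  using xs_min[of x0] x0_dom by (auto simp: edom_def)

lemma INF_F: "(INF x. F x) = ereal (rF xs)"
  unfolding F_real[OF xs_dom, symmetric]
  by (intro antisym INF_lower INF_greatest xs_min UNIV_I)

lemma rF_ge: "x \<in> edom F \<Longrightarrow> rF xs \<le> rF x"
  using xs_min[of x] F_real xs_dom by (metis ereal_less_eq(3))

lemma S_eq: "S = {x. F x \<le> ereal (rF x0)}"
  using F_real[OF x0_dom] by (simp add: sublevel_def)

lemma S_dom: "x \<in> S \<Longrightarrow> x \<in> edom F"
  unfolding S_eq using F_le_dom by blast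

lemma S_rF: "x \<in> S \<longleftrightarrow> x \<in> edom F \<and> rF x \<le> rF x0"
  unfolding S_eq using F_le_dom F_real by (metis ereal_less_eq(3) mem_Collect_eq)

lemma x0_S: "x0 \<in> S" and xs_S: "xs \<in> S"
  using xs_min[of x0] by (auto simp: sublevel_def)

lemma compact_S: "compact S"
  unfolding S_eq
proof (rule compact_sublevel_unique_minimizer[OF closed_F_sublevel F_convex F_real[OF xs_dom]])
  fix x assume "F x \<le> ereal (rF xs)"
  thus "x = xs" using xs_unique F_real[OF xs_dom] by metis
qed

lemma segment_S:
  assumes "x \<in> S" "y \<in> S" "0 \<le> t" "t \<le> 1"
  shows "x + t *\<^sub>R (y - x) \<in> S"
  using F_convex[of x "rF x0" y "rF x0" t] assms unfolding S_eq by simp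

lemma convex_S: "convex S"
  unfolding convex_alt using segment_S by (simp add: algebra_simps)

section \<open>Bounds on the Hessian and the gradient over the sublevel set\<close>

abbreviation H :: "real^'n \<Rightarrow> real^'n^'n" where "H \<equiv> hessian f"
abbreviation \<sigma> :: real where "\<sigma> \<equiv> sigma_f f S"
abbreviation L :: real where "L \<equiv> L_f f S"

lemma H_sym: "x \<in> edom F \<Longrightarrow> transpose (H x) = H x"
  using hessian_pos_def by (simp add: pos_def_def)

lemma continuous_on_H: "continuous_on S H"
  using continuous_on_subset[OF hessian_continuous] S_dom by blast

text \<open>The quadratic form \<open>v \<bullet> H(x) v\<close> attains a positive minimum over \<open>x \<in> S\<close> and unit vectors \<open>v\<close>; it bounds all
  eigenvalues, hence their infimum.\<close>

lemma sigma_pos: "0 < \<sigma>"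
  and sigma_le: "x \<in> S \<Longrightarrow> \<sigma> * (v \<bullet> v) \<le> v \<bullet> (H x *v v)"
proof -
  let ?K = "S \<times> sphere (0 :: real^'n) 1"
  let ?q = "\<lambda>z. snd z \<bullet> (H (fst z) *v snd z)"
  have "compact ?K" by (intro compact_Times compact_S) simp
  moreover have "(x0, axis undefined 1) \<in> ?K" using x0_S by (simp add: norm_axis_1)
  moreover have "continuous_on ?K ?q"
  proof -
    have "continuous_on ?K (\<lambda>z. H (fst z))"
      by (rule continuous_on_compose2[OF continuous_on_H continuous_on_fst]) (auto intro: continuous_intros)
    thus ?thesis
      unfolding inner_vec_def matrix_vector_mult_def by (auto intro!: continuous_intros)
  qed
  ultimately obtain z where z: "z \<in> ?K" "\<And>y. y \<in> ?K \<Longrightarrow> ?q z \<le> ?q y"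
    using continuous_attains_inf[of ?K ?q] by blast
  have "snd z \<noteq> 0" using z(1) by auto
  hence pos: "0 < ?q z"
    using z(1) hessian_pos_def[OF S_dom, of "fst z"] by (auto simp: pos_def_def)
  have low: "?q z \<le> lambda_min (H x)" if x: "x \<in> S" for x
  proof -
    obtain e where "norm e = 1" "e \<bullet> (H x *v e) = lambda_min (H x)"
      using lambda_min_bounds(2)[OF H_sym[OF S_dom[OF x]]] by blast
    thus ?thesis using z(2)[of "(x, e)"] x by simp
  qed
  hence "?q z \<le> \<sigma>" unfolding sigma_f_def using x0_S by (intro cINF_greatest) auto
  with pos show "0 < \<sigma>" by simp
  assume x: "x \<in> S"
  have "bdd_below ((\<lambda>x. lambda_min (H x)) ` S)" by (rule bdd_belowI2) (rule low)
  hence "\<sigma> \<le> lambda_min (H x)" unfolding sigma_f_def using x by (intro cINF_lower)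
  hence "\<sigma> * (v \<bullet> v) \<le> lambda_min (H x) * (v \<bullet> v)" by (intro mult_right_mono) auto
  also have "\<dots> \<le> v \<bullet> (H x *v v)" by (rule lambda_min_bounds(1)[OF H_sym[OF S_dom[OF x]]])
  finally show "\<sigma> * (v \<bullet> v) \<le> v \<bullet> (H x *v v)" .
qed

lemma L_onorm: "x \<in> S \<Longrightarrow> onorm ((*v) (H x)) \<le> L"
proof -
  assume x: "x \<in> S"
  have "bounded (H ` S)"
    using compact_continuous_image[OF continuous_on_H compact_S] compact_imp_bounded by blast
  then obtain B where B: "\<And>x. x \<in> S \<Longrightarrow> norm (H x) \<le> B" by (auto simp: bounded_iff)
  have le: "spectral_norm (H x) \<le> real CARD('n) * real CARD('n) * B" if "x \<in> S" for x
    unfolding spectral_norm_def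
    using B[OF that] by (intro onorm_le_matrix_component)
      (meson component_le_norm_cart order_trans Finite_Cartesian_Product.norm_nth_le real_norm_def)
  have "bdd_above ((\<lambda>x. spectral_norm (H x)) ` S)" by (rule bdd_aboveI2) (rule le)
  from cSUP_upper[OF x this] show ?thesis by (simp add: L_f_def spectral_norm_def)
qed

lemma L_norm: "x \<in> S \<Longrightarrow> norm (H x *v v) \<le> L * norm v"
  using onorm[of "(*v) (H x)" v] mult_right_mono[OF L_onorm, of x "norm v"] by (simp add: order_trans)

lemma L_ge: "x \<in> S \<Longrightarrow> v \<bullet> (H x *v v) \<le> L * (v \<bullet> v)"
proof -
  assume x: "x \<in> S"
  have "v \<bullet> (H x *v v) \<le> norm v * norm (H x *v v)" by (rule norm_cauchy_schwarz)
  also have "\<dots> \<le> norm v * (L * norm v)" by (intro mult_left_mono L_norm x) simp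
  finally show ?thesis by (simp add: power2_norm_eq_inner[symmetric] power2_eq_square mult_ac)
qed

lemma sigma_le_L: "\<sigma> \<le> L"
  using sigma_le[OF x0_S, of "axis undefined 1"] L_ge[OF x0_S, of "axis undefined 1"]
  by (simp add: inner_axis_axis)

lemma L_pos: "0 < L"
  using sigma_pos sigma_le_L by simp

lemma grad_strongly_monotone:
  assumes x: "x \<in> S" and y: "y \<in> S"
  shows "\<sigma> * ((x - y) \<bullet> (x - y)) \<le> (grad f x - grad f y) \<bullet> (x - y)"
proof -
  have dom: "y + t *\<^sub>R (x - y) \<in> S" if "0 \<le> t" "t \<le> 1" for t
    using segment_S[OF y x] that by blast
  from MVT2[of 0 1 "\<lambda>t. grad f (y + t *\<^sub>R (x - y)) \<bullet> (x - y)"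
      "\<lambda>t. (x - y) \<bullet> (H (y + t *\<^sub>R (x - y)) *v (x - y))"]
  obtain t where t: "0 < t" "t < 1"
    "grad f x \<bullet> (x - y) - grad f y \<bullet> (x - y) = (x - y) \<bullet> (H (y + t *\<^sub>R (x - y)) *v (x - y))"
    using line_derivatives(2)[OF sc] dom S_dom edom_F_f by auto
  with sigma_le[OF dom, of t "x - y"] show ?thesis by (simp add: inner_diff_left)
qed

lemma grad_lipschitz:
  assumes x: "x \<in> S" and y: "y \<in> S"
  shows "norm (grad f x - grad f y) \<le> L * norm (x - y)"
proof (rule differentiable_bound[OF convex_S _ _ x y])
  fix z assume z: "z \<in> S"
  show "(grad f has_derivative (*v) (H z)) (at z within S)"
    using has_derivative_hessian[OF sc edom_F_f[OF S_dom[OF z]]] by (rule has_derivative_at_withinI)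
  show "onorm ((*v) (H z)) \<le> L" by (rule L_onorm[OF z])
qed

text \<open>By the mean value theorem and monotonicity of the gradient along the segment.\<close>

lemma f_above_tangent:
  assumes x: "x \<in> S" and y: "y \<in> S"
  shows "re f x + grad f x \<bullet> (y - x) \<le> re f y"
proof -
  have dom: "x + t *\<^sub>R (y - x) \<in> S" if "0 \<le> t" "t \<le> 1" for t
    using segment_S[OF x y] that by blast
  from MVT2[of 0 1 "\<lambda>t. re f (x + t *\<^sub>R (y - x))" "\<lambda>t. grad f (x + t *\<^sub>R (y - x)) \<bullet> (y - x)"]
  obtain t where t: "0 < t" "t < 1" "re f y - re f x = grad f (x + t *\<^sub>R (y - x)) \<bullet> (y - x)"
    using line_derivatives(1)[OF sc] dom S_dom edom_F_f by auto
  have "0 \<le> \<sigma> * ((t *\<^sub>R (y - x)) \<bullet> (t *\<^sub>R (y - x)))"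
    using sigma_pos by (intro mult_nonneg_nonneg inner_ge_zero) simp
  also have "\<dots> \<le> (grad f (x + t *\<^sub>R (y - x)) - grad f x) \<bullet> (t *\<^sub>R (y - x))"
    using grad_strongly_monotone[OF dom x, of t] t by simp
  finally have "0 \<le> (grad f (x + t *\<^sub>R (y - x)) - grad f x) \<bullet> (y - x)"
    using t by (simp add: zero_le_mult_iff)
  with t show ?thesis by (simp add: inner_diff_left)
qed

text \<open>The minimiser satisfies \<open>-\<nabla>f(xs) \<in> \<partial>g(xs)\<close>: otherwise, moving from \<open>xs\<close> towards \<open>z\<close>, the sum of \<open>f\<close> and
  the chord of \<open>g\<close> would decrease at first, and this sum is an upper bound for \<open>F\<close>. It is applied at
  the full step \<open>z\<close>, which may leave the domain of \<open>f\<close>.\<close>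

lemma first_order_optimality:
  assumes z: "\<And>i. gb i z < \<infinity>"
  shows "(\<Sum>i\<in>UNIV. rg i xs) \<le> (\<Sum>i\<in>UNIV. rg i z) + grad f xs \<bullet> (z - xs)"
proof (rule ccontr)
  define \<Delta> where "\<Delta> = (\<Sum>i\<in>UNIV. rg i z) - (\<Sum>i\<in>UNIV. rg i xs)"
  define \<phi> where "\<phi> t = re f (xs + t *\<^sub>R (z - xs)) + t * \<Delta>" for t
  assume "\<not> ?thesis"
  hence neg: "grad f xs \<bullet> (z - xs) + \<Delta> < 0" by (simp add: \<Delta>_def)
  have "(\<phi> has_real_derivative grad f xs \<bullet> (z - xs) + \<Delta>) (at 0)"
    unfolding \<phi>_def using line_derivatives(1)[OF sc, of xs 0 "z - xs"] edom_F_f[OF xs_dom]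
    by (auto intro!: derivative_eq_intros)
  from DERIV_neg_dec_right[OF this neg] obtain \<delta> where \<delta>: "0 < \<delta>" "\<And>t. 0 < t \<Longrightarrow> t < \<delta> \<Longrightarrow> \<phi> t < \<phi> 0"
    by auto
  have "open ((\<lambda>t. xs + t *\<^sub>R (z - xs)) -` edom f)"
    by (intro open_vimage open_edom_f continuous_intros)
  moreover have "0 \<in> (\<lambda>t. xs + t *\<^sub>R (z - xs)) -` edom f" using edom_F_f[OF xs_dom] by simp
  ultimately obtain \<epsilon> where \<epsilon>: "0 < \<epsilon>" "ball 0 \<epsilon> \<subseteq> (\<lambda>t. xs + t *\<^sub>R (z - xs)) -` edom f"
    by (rule openE)
  define t where "t = min (min \<delta> \<epsilon>) 1 / 2"
  have t: "0 < t" "t < \<delta>" "t < \<epsilon>" "t \<le> 1" using \<delta> \<epsilon> by (auto simp: t_def)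
  let ?y = "xs + t *\<^sub>R (z - xs)"
  have "?y \<in> edom f" using subsetD[OF \<epsilon>(2), of t] t by simp
  hence "f ?y \<le> ereal (re f ?y)" using f_real by (metis order_refl)
  hence "F ?y \<le> ereal (re f ?y + (\<Sum>i\<in>UNIV. rg i xs + t * (rg i z - rg i xs)))"
    using t z edom_F_gb[OF xs_dom] by (intro F_le_sum gb_convex) auto
  also have "re f ?y + (\<Sum>i\<in>UNIV. rg i xs + t * (rg i z - rg i xs)) = \<phi> t + (\<Sum>i\<in>UNIV. rg i xs)"
    by (simp add: \<phi>_def \<Delta>_def sum.distrib sum_distrib_left[symmetric] sum_subtractf)
  also have "\<dots> < \<phi> 0 + (\<Sum>i\<in>UNIV. rg i xs)" using \<delta>(2) t by simp
  also have "\<phi> 0 + (\<Sum>i\<in>UNIV. rg i xs) = rF xs" by (simp add: \<phi>_def rF_def)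
  finally have "F ?y < F xs" using F_real[OF xs_dom] by simp
  with xs_min[of ?y] show False by simp
qed

section \<open>One step of the method\<close>

abbreviation lam :: "'b \<Rightarrow> real^'n \<Rightarrow> real" where "lam \<equiv> decrement blk f d"

definition next_iterate :: "'b \<Rightarrow> real^'n \<Rightarrow> real^'n" where
  "next_iterate i x = x + (1 / (1 + lam i x)) *\<^sub>R d i x"

text \<open>The point with all blocks updated at once without damping. The
  subgradients in the definition of the directions are subgradients of \<open>g\<close> at this point.\<close>

definition full_step :: "real^'n \<Rightarrow> real^'n" where
  "full_step x = x + (\<Sum>i\<in>UNIV. d i x)"

lemma d_block: "x \<in> edom F \<Longrightarrow> d i x \<in> block_space blk i"
  using direction by (simp add: approx_direction_def)

lemma subvec_full_step: "x \<in> edom F \<Longrightarrow> subvec blk i (full_step x) = subvec blk i x + d i x"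
  unfolding full_step_def subvec_add by (subst subvec_sum_block_space) (simp_all add: d_block)

lemma local_norm_block:
  assumes "y \<in> block_space blk i"
  shows "local_norm blk f i x y = sqrt (y \<bullet> (H x *v y))"
  using assms by (simp add: local_norm_def quadratic_submat subvec_block_space)

lemma H_nonneg: "x \<in> edom F \<Longrightarrow> 0 \<le> y \<bullet> (H x *v y)"
  using pos_def_imp_semidef[OF hessian_pos_def] by (simp add: pos_semidef_def)

lemma lam_nonneg: "x \<in> edom F \<Longrightarrow> 0 \<le> lam i x"
  unfolding decrement_def by (simp add: local_norm_block[OF d_block] H_nonneg)

lemma lam_square: "x \<in> edom F \<Longrightarrow> (lam i x)\<^sup>2 = d i x \<bullet> (H x *v d i x)"
  unfolding decrement_def by (simp add: local_norm_block[OF d_block] H_nonneg)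

text \<open>The vectors \<open>v i\<close> are residuals certifying the directions \<open>d i x\<close>: their dual norms are at most \<open>\<eta>\<close> times the
  decrements, here written as a bound on linear forms. The last conjunct is the subgradient inequality
  of \<open>g i\<close> at the full step, after the subgradient has been expressed by \<open>v i\<close>, the gradient and the
  Hessian.\<close>

definition residual :: "real^'n \<Rightarrow> ('b \<Rightarrow> real^'n) \<Rightarrow> bool" where
  "residual x v \<longleftrightarrow> (\<forall>i.
     (\<forall>y\<in>block_space blk i. \<bar>v i \<bullet> y\<bar> \<le> \<eta> * lam i x * local_norm blk f i x y) \<and>
     gb i (full_step x) < \<infinity> \<and>
     (\<forall>y. gb i y < \<infinity> \<longrightarrow> rg i (full_step x) \<le>
        rg i y + (v i + grad f x + H x *v d i x) \<bullet> (subvec blk i (y - x) - d i x)))"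

lemma residual_exists:
  assumes x: "x \<in> edom F"
  shows "\<exists>v. residual x v"
proof -
  have "\<exists>v. (\<forall>y\<in>block_space blk i. \<bar>v \<bullet> y\<bar> \<le> \<eta> * lam i x * local_norm blk f i x y) \<and>
     gb i (full_step x) < \<infinity> \<and>
     (\<forall>y. gb i y < \<infinity> \<longrightarrow> rg i (full_step x) \<le>
        rg i y + (v + grad f x + H x *v d i x) \<bullet> (subvec blk i (y - x) - d i x))" for i
  proof -
    from direction[OF x, of i] obtain v s where v: "v \<in> block_space blk i"
      and s: "s \<in> subdiff_on (block_space blk i) (g i) (subvec blk i x + d i x)"
      and eq: "- v = subvec blk i (grad f x) + submat blk i (H x) *v d i x + s"
      and dual: "local_dual_norm blk f i x v \<le> \<eta> * local_norm blk f i x (d i x)"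
      unfolding approx_direction_def by blast
    have sub: "gb i (full_step x) + ereal (s \<bullet> (subvec blk i y - (subvec blk i x + d i x))) \<le> gb i y" for y
      using s by (auto simp: subdiff_on_def subvec_full_step[OF x])
    have fin: "gb i (full_step x) < \<infinity>"
      using sub[of x] edom_F_gb[OF x, of i] by (cases "gb i (full_step x)") auto
    have 1: "\<bar>v \<bullet> y\<bar> \<le> \<eta> * lam i x * local_norm blk f i x y" if y: "y \<in> block_space blk i" for y
    proof -
      have "\<bar>v \<bullet> y\<bar> \<le> local_dual_norm blk f i x v * local_norm blk f i x y"
        by (rule local_dual_norm_bound[OF hessian_pos_def[OF x] v y])
      also have "\<dots> \<le> \<eta> * local_norm blk f i x (d i x) * local_norm blk f i x y"
        using dual by (intro mult_right_mono) (simp_all add: local_norm_block[OF y] H_nonneg[OF x])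
      finally show ?thesis by (simp add: decrement_def)
    qed
    have 2: "rg i (full_step x) \<le>
        rg i y + (v + grad f x + H x *v d i x) \<bullet> (subvec blk i (y - x) - d i x)" if y: "gb i y < \<infinity>" for y
    proof -
      define w where "w = subvec blk i (y - x) - d i x"
      have w: "w \<in> block_space blk i"
        unfolding w_def by (intro subspace_diff[OF subspace_block_space] d_block[OF x]) simp
      have "s = - (v + subvec blk i (grad f x) + submat blk i (H x) *v d i x)"
        using eq by (simp add: algebra_simps)
      hence "- (s \<bullet> w) = v \<bullet> w + grad f x \<bullet> w + (H x *v d i x) \<bullet> w"
        by (simp add: inner_add_left inner_diff_left submat_mult_vec subvec_block_space[OF d_block[OF x]]
            inner_block_space[OF w])
      moreover have "rg i (full_step x) + s \<bullet> w \<le> rg i y"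
      proof -
        obtain a b where ab: "gb i y = ereal a" "gb i (full_step x) = ereal b"
          using gb_real[OF y] gb_real[OF fin] by blast
        have "w = subvec blk i y - (subvec blk i x + d i x)" by (simp add: w_def subvec_diff)
        with sub[of y] show ?thesis by (simp add: ab)
      qed
      ultimately show ?thesis by (simp add: w_def inner_add_left)
    qed
    from 1 2 fin show ?thesis by blast
  qed
  hence "\<exists>v. \<forall>i. (\<forall>y\<in>block_space blk i. \<bar>v i \<bullet> y\<bar> \<le> \<eta> * lam i x * local_norm blk f i x y) \<and>
     gb i (full_step x) < \<infinity> \<and>
     (\<forall>y. gb i y < \<infinity> \<longrightarrow> rg i (full_step x) \<le>
        rg i y + (v i + grad f x + H x *v d i x) \<bullet> (subvec blk i (y - x) - d i x))"
    by (intro choice allI)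
  thus ?thesis by (simp add: residual_def)
qed

lemma residualD:
  assumes "residual x v"
  shows "y \<in> block_space blk i \<Longrightarrow> \<bar>v i \<bullet> y\<bar> \<le> \<eta> * lam i x * local_norm blk f i x y"
    and "gb i (full_step x) < \<infinity>"
    and "gb i y < \<infinity> \<Longrightarrow> rg i (full_step x) \<le>
        rg i y + (v i + grad f x + H x *v d i x) \<bullet> (subvec blk i (y - x) - d i x)"
  using assms unfolding residual_def by blast+

text \<open>The self-concordant upper bound with \<open>u = d i x\<close> and \<open>\<tau> = 1/(1 + \<lambda>)\<close> for the smooth part, and convexity of
  \<open>g i\<close> between \<open>x\<close> and the full step for the other part.\<close>

lemma next_iterate_bound:
  assumes x: "x \<in> edom F"
  shows "next_iterate i x \<in> edom F"
    and "rF (next_iterate i x) \<le> rF x +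
      (1 / (1 + lam i x)) * (grad f x \<bullet> d i x + (rg i (full_step x) - rg i x)) +
      (ln (1 + lam i x) - lam i x / (1 + lam i x))"
proof -
  let ?e = "d i x" and ?l = "lam i x"
  define \<tau> where "\<tau> = 1 / (1 + ?l)"
  have \<tau>: "0 \<le> \<tau>" "\<tau> \<le> 1" using lam_nonneg[OF x, of i] by (auto simp: \<tau>_def)
  obtain v where v: "residual x v" using residual_exists[OF x] by blast
  have e: "?e \<in> block_space blk i" by (rule d_block[OF x])
  have gj: "gb j (x + t *\<^sub>R ?e) = gb j x" if "j \<noteq> i" for j t
    using subvec_block_space_other[OF e that] by (simp add: subvec_add subvec_scaleR)
  have gi: "gb i (x + t *\<^sub>R ?e) \<le> ereal (rg i x + t * (rg i (full_step x) - rg i x))" if "0 \<le> t" "t \<le> 1" for t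
  proof -
    have "subvec blk i (x + t *\<^sub>R ?e) = subvec blk i (x + t *\<^sub>R (full_step x - x))"
      by (simp add: subvec_add subvec_scaleR subvec_diff subvec_full_step[OF x] subvec_block_space[OF e])
    thus ?thesis using gb_convex[OF edom_F_gb[OF x] residualD(2)[OF v] that] by simp
  qed
  have dom: "x + t *\<^sub>R ?e \<in> edom F" if t: "0 \<le> t" "t \<le> 1" and "x + t *\<^sub>R ?e \<in> edom f" for t
  proof -
    have "gb j (x + t *\<^sub>R ?e) < \<infinity>" for j
      using gi[OF t] gj[of j t] edom_F_gb[OF x, of j] by (cases "j = i") (auto intro: le_less_trans)
    with that show ?thesis by (simp add: edom_F)
  qed
  have f_step: "x + \<tau> *\<^sub>R ?e \<in> edom f \<and>
    re f (x + \<tau> *\<^sub>R ?e) \<le> re f x + (grad f x \<bullet> ?e) * \<tau> + (ln (1 + ?l) - ?l / (1 + ?l))"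
  proof (cases "?e = 0")
    case True
    hence "?l = 0" using lam_square[OF x, of i] by simp
    thus ?thesis using True edom_F_f[OF x] by simp
  next
    case False
    have pos: "0 < ?e \<bullet> (H (x + t *\<^sub>R ?e) *v ?e)"
      if "0 \<le> t" "t \<le> \<tau>" "x + t *\<^sub>R ?e \<in> edom f" for t
      using hessian_pos_def[OF dom, of t] that \<tau> False by (simp add: pos_def_def)
    have r: "?l = sqrt (?e \<bullet> (H x *v ?e))" by (simp add: decrement_def local_norm_block[OF e])
    have t1: "?l * \<tau> < 1" "1 - ?l * \<tau> = 1 / (1 + ?l)"
      using lam_nonneg[OF x, of i] by (auto simp: \<tau>_def field_simps)
    have "ln (1 - ?l * \<tau>) = - ln (1 + ?l)"
      unfolding t1(2) using lam_nonneg[OF x, of i] by (simp add: ln_div)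
    moreover have "?l * \<tau> = ?l / (1 + ?l)" by (simp add: \<tau>_def)
    ultimately show ?thesis
      using self_concordant_step[OF sc edom_F_f[OF x] \<tau>(1) pos r t1(1)] by simp
  qed
  have T: "next_iterate i x = x + \<tau> *\<^sub>R ?e" by (simp add: next_iterate_def \<tau>_def)
  show T_dom: "next_iterate i x \<in> edom F" unfolding T using dom[OF \<tau>] f_step by blast
  have "(\<Sum>j\<in>UNIV. rg j (x + \<tau> *\<^sub>R ?e)) \<le>
      (\<Sum>j\<in>UNIV. rg j x + (if j = i then \<tau> * (rg i (full_step x) - rg i x) else 0))"
  proof (rule sum_mono)
    fix j
    have "rg i (x + \<tau> *\<^sub>R ?e) \<le> rg i x + \<tau> * (rg i (full_step x) - rg i x)"
    proof -
      obtain a where "gb i (x + \<tau> *\<^sub>R ?e) = ereal a"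
        using gb_real[OF edom_F_gb[OF T_dom], of i] unfolding T by blast
      with gi[OF \<tau>] show ?thesis by simp
    qed
    thus "rg j (x + \<tau> *\<^sub>R ?e) \<le> rg j x + (if j = i then \<tau> * (rg i (full_step x) - rg i x) else 0)"
      using gj[of j \<tau>] by auto
  qed
  also have "\<dots> = (\<Sum>j\<in>UNIV. rg j x) + \<tau> * (rg i (full_step x) - rg i x)"
    by (simp add: sum.distrib)
  finally have "rF (x + \<tau> *\<^sub>R ?e) \<le> rF x + \<tau> * (grad f x \<bullet> ?e + (rg i (full_step x) - rg i x))
      + (ln (1 + ?l) - ?l / (1 + ?l))"
    using f_step by (simp add: rF_def algebra_simps)
  thus "rF (next_iterate i x) \<le> rF x +
      (1 / (1 + lam i x)) * (grad f x \<bullet> d i x + (rg i (full_step x) - rg i x)) +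
      (ln (1 + lam i x) - lam i x / (1 + lam i x))"
    unfolding T by (simp add: \<tau>_def)
qed

text \<open>Change of the linearised objective in block \<open>i\<close> under the undamped step, corrected by the residual. The
  correction makes it at most \<open>-\<lambda>\<^sub>i\<^sup>2\<close> and thereby nonpositive, so that the factor \<open>p i / (1 + \<lambda>\<^sub>i)\<close> in front
  of it can be replaced by \<open>\<theta>\<close>.\<close>

definition model_change :: "real^'n \<Rightarrow> ('b \<Rightarrow> real^'n) \<Rightarrow> 'b \<Rightarrow> real" where
  "model_change x v i = (grad f x + v i) \<bullet> d i x + (rg i (full_step x) - rg i x)"

lemma model_change_le:
  assumes x: "x \<in> edom F" and v: "residual x v"
  shows "model_change x v i \<le> - (lam i x)\<^sup>2"
  using residualD(3)[OF v edom_F_gb[OF x], of i]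
  by (simp add: model_change_def inner_add_left lam_square[OF x] inner_commute[of "H x *v d i x"])

lemma residual_direction:
  assumes x: "x \<in> edom F" and v: "residual x v"
  shows "\<bar>v i \<bullet> d i x\<bar> \<le> \<eta> * (lam i x)\<^sup>2"
  using residualD(1)[OF v d_block[OF x]] by (simp add: decrement_def power2_eq_square mult.assoc)

text \<open>The residual changes the decrease of an exact step by at most \<open>\<eta> \<lambda>\<^sup>2/(1 + \<lambda>)\<close>.\<close>

lemma next_iterate_decrease:
  assumes x: "x \<in> edom F"
  shows "rF (next_iterate i x) \<le> rF x - decrease \<eta> (lam i x)"
proof -
  let ?l = "lam i x"
  obtain v where v: "residual x v" using residual_exists[OF x] by blast
  have "grad f x \<bullet> d i x + (rg i (full_step x) - rg i x) \<le> - ?l\<^sup>2 + \<eta> * ?l\<^sup>2"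
    using model_change_le[OF x v, of i] residual_direction[OF x v, of i]
    by (simp add: model_change_def inner_add_left)
  hence "(1 / (1 + ?l)) * (grad f x \<bullet> d i x + (rg i (full_step x) - rg i x))
      \<le> (1 / (1 + ?l)) * (- ?l\<^sup>2 + \<eta> * ?l\<^sup>2)"
    using lam_nonneg[OF x, of i] by (intro mult_left_mono) auto
  also have "\<dots> + (ln (1 + ?l) - ?l / (1 + ?l)) = - decrease \<eta> ?l"
    using lam_nonneg[OF x, of i]
    by (simp add: decrease_def omega_def divide_simps power2_eq_square) (simp add: algebra_simps)
  finally show ?thesis using next_iterate_bound(2)[OF x, of i] by simp
qed

lemma next_iterate_S:
  assumes x: "x \<in> S"
  shows "next_iterate i x \<in> S"
proof -
  note dom = S_dom[OF x]
  have "0 \<le> (1/2 - \<eta>) * (lam i x)\<^sup>2 / (1 + lam i x)"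
    using \<eta> lam_nonneg[OF dom, of i] by (intro divide_nonneg_nonneg mult_nonneg_nonneg) auto
  hence "rF (next_iterate i x) \<le> rF x"
    using next_iterate_decrease[OF dom, of i] decrease_lower[OF lam_nonneg[OF dom, of i], of \<eta>] by linarith
  thus ?thesis using x next_iterate_bound(1)[OF dom] by (simp add: S_rF)
qed

section \<open>Error bound and linear rate\<close>

abbreviation c1 :: real where "c1 \<equiv> c1_const blk f \<eta> S"
abbreviation \<theta> :: real where "\<theta> \<equiv> theta_const blk f d p S"
abbreviation pmin :: real where "pmin \<equiv> p_min p"
abbreviation pmax :: real where "pmax \<equiv> p_max p"

lemma pmin_pos: "0 < pmin" and pmin_le: "pmin \<le> p i" and p_le_pmax: "p i \<le> pmax" and p_le_1: "p i \<le> 1"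
proof -
  show "0 < pmin" using p_pos by (simp add: p_min_def)
  show "pmin \<le> p i" by (simp add: p_min_def)
  show "p i \<le> pmax" by (simp add: p_max_def)
  show "p i \<le> 1"
    using member_le_sum[of i UNIV p] p_pos p_sum by (simp add: less_imp_le)
qed

lemma c1_bounds: "0 < c1" "c1 * sqrt (real CARD('b)) \<le> (1 - \<eta>) / (2 + \<eta>)"
proof -
  have ne: "S \<noteq> {}" using x0_S by blast
  have "0 \<le> \<eta>" "\<eta> < 1" using \<eta> by auto
  from c1_const_bounds[OF ne hessian_pos_def[OF S_dom] sigma_pos sigma_le L_ge this, of blk]
  show "0 < c1" "c1 * sqrt (real CARD('b)) \<le> (1 - \<eta>) / (2 + \<eta>)" by auto
qed

lemma powr_three_halves:
  fixes a :: real
  assumes "0 \<le> a"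
  shows "a powr (3/2) = a * sqrt a"
  using powr_add[of a 1 "1/2"] assms by (simp add: powr_half_sqrt)

definition total_decrement :: "real^'n \<Rightarrow> real" where
  "total_decrement x = (\<Sum>i\<in>UNIV. (lam i x)\<^sup>2)"

lemma total_decrement_nonneg: "0 \<le> total_decrement x"
  by (simp add: total_decrement_def sum_nonneg)

text \<open>The part of the subgradient inequalities at \<open>xs\<close> that pairs the blockwise Newton steps with the unknown
  vector \<open>xs - x\<close>.\<close>

definition cross_term :: "real^'n \<Rightarrow> ('b \<Rightarrow> real^'n) \<Rightarrow> real" where
  "cross_term x v = (\<Sum>i\<in>UNIV. (v i + H x *v d i x) \<bullet> subvec blk i (xs - x))"

lemma cross_term_le:
  assumes x: "x \<in> S" and v: "residual x v"
  shows "cross_term x v \<le> (1 + \<eta>) * sqrt L * sqrt (total_decrement x) * norm (x - xs)"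
proof -
  note dom = S_dom[OF x]
  let ?y = "\<lambda>i. subvec blk i (xs - x)"
  have "cross_term x v \<le> (\<Sum>i\<in>UNIV. (1 + \<eta>) * sqrt L * (lam i x * norm (?y i)))"
    unfolding cross_term_def
  proof (rule sum_mono)
    fix i
    have ln: "local_norm blk f i x (?y i) \<le> sqrt L * norm (?y i)"
    proof -
      have "?y i \<bullet> (H x *v ?y i) \<le> L * (norm (?y i))\<^sup>2"
        using L_ge[OF x] by (simp add: power2_norm_eq_inner)
      hence "sqrt (?y i \<bullet> (H x *v ?y i)) \<le> sqrt (L * (norm (?y i))\<^sup>2)" by simp
      thus ?thesis by (simp add: local_norm_block real_sqrt_mult)
    qed
    have "(H x *v d i x) \<bullet> ?y i \<le> lam i x * local_norm blk f i x (?y i)"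
      using quadratic_form_cauchy_schwarz[OF pos_def_imp_semidef[OF hessian_pos_def[OF dom]], of "?y i" "d i x"]
      by (simp add: decrement_def local_norm_block d_block[OF dom] inner_commute mult.commute)
    moreover have "v i \<bullet> ?y i \<le> \<eta> * lam i x * local_norm blk f i x (?y i)"
      using residualD(1)[OF v, of "?y i" i] by simp
    ultimately have "(v i + H x *v d i x) \<bullet> ?y i \<le> (1 + \<eta>) * lam i x * local_norm blk f i x (?y i)"
      by (simp add: inner_add_left algebra_simps)
    also have "\<dots> \<le> (1 + \<eta>) * lam i x * (sqrt L * norm (?y i))"
      using lam_nonneg[OF dom] \<eta> by (intro mult_left_mono ln) auto
    finally show "(v i + H x *v d i x) \<bullet> ?y i \<le> (1 + \<eta>) * sqrt L * (lam i x * norm (?y i))"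
      by (simp add: mult_ac)
  qed
  also have "\<dots> = (1 + \<eta>) * sqrt L * (\<Sum>i\<in>UNIV. lam i x * norm (?y i))"
    by (simp add: sum_distrib_left)
  also have "\<dots> \<le> (1 + \<eta>) * sqrt L * (sqrt (total_decrement x) * norm (x - xs))"
  proof (intro mult_left_mono)
    have "(\<Sum>i\<in>UNIV. lam i x * norm (?y i)) = (\<Sum>i\<in>UNIV. \<bar>lam i x\<bar> * \<bar>norm (?y i)\<bar>)"
      using lam_nonneg[OF dom] by simp
    also have "\<dots> \<le> L2_set (\<lambda>i. lam i x) UNIV * L2_set (\<lambda>i. norm (?y i)) UNIV"
      by (rule L2_set_mult_ineq)
    also have "\<dots> = sqrt (total_decrement x) * norm (x - xs)"
      by (simp add: L2_set_def total_decrement_def sum_norm_subvec norm_minus_commute)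
    finally show "(\<Sum>i\<in>UNIV. lam i x * norm (?y i)) \<le> sqrt (total_decrement x) * norm (x - xs)" .
  qed (use \<eta> L_pos in auto)
  finally show ?thesis by (simp add: mult.assoc)
qed

lemma norm_full_step_le:
  assumes x: "x \<in> S"
  shows "norm (full_step x - x) \<le> sqrt (total_decrement x) / sqrt \<sigma>"
proof -
  note dom = S_dom[OF x]
  have "\<sigma> * (norm (full_step x - x))\<^sup>2 = (\<Sum>i\<in>UNIV. \<sigma> * (norm (subvec blk i (full_step x - x)))\<^sup>2)"
    by (simp add: sum_norm_subvec[symmetric] sum_distrib_left[symmetric])
  also have "\<dots> = (\<Sum>i\<in>UNIV. \<sigma> * (norm (d i x))\<^sup>2)"
    by (simp add: subvec_diff subvec_full_step[OF dom])
  also have "\<dots> \<le> total_decrement x"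
    unfolding total_decrement_def using sigma_le[OF x]
    by (intro sum_mono) (simp add: lam_square[OF dom] power2_norm_eq_inner)
  finally have "(norm (full_step x - x))\<^sup>2 \<le> total_decrement x / \<sigma>"
    using sigma_pos by (simp add: field_simps)
  hence "norm (full_step x - x) \<le> sqrt (total_decrement x / \<sigma>)" by (rule real_le_rsqrt)
  thus ?thesis by (simp add: real_sqrt_divide)
qed

text \<open>Adding the subgradient inequalities at the full step \<open>z\<close> (evaluated at \<open>xs\<close>) to the optimality condition
  at \<open>xs\<close> (evaluated at \<open>z\<close>) expresses monotonicity of \<open>\<partial>g\<close>. It bounds
  \<open>(\<nabla>f(x) - \<nabla>f(xs)) \<bullet> (x - xs)\<close> by the cross term plus \<open>\<bar>(\<nabla>f(x) - \<nabla>f(xs)) \<bullet> (z - x)\<bar>\<close>. Both are at most a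
  constant times \<open>\<Lambda> \<parallel>x - xs\<parallel>\<close>, while the left-hand side is at least \<open>\<sigma> \<parallel>x - xs\<parallel>\<^sup>2\<close>.\<close>

lemma error_bound:
  assumes x: "x \<in> S"
  shows "norm (x - xs) \<le> ((1 + \<eta>) * sqrt L / \<sigma> + L / (\<sigma> * sqrt \<sigma>)) * sqrt (total_decrement x)"
proof (cases "x = xs")
  case True
  thus ?thesis using \<eta> L_pos sigma_pos total_decrement_nonneg[of x] by simp
next
  case False
  note dom = S_dom[OF x]
  obtain v where v: "residual x v" using residual_exists[OF dom] by blast
  let ?D = "full_step x - x"
  let ?\<Lambda> = "sqrt (total_decrement x)"
  have "(\<Sum>i\<in>UNIV. rg i (full_step x)) \<le>
    (\<Sum>i\<in>UNIV. rg i xs + (v i + grad f x + H x *v d i x) \<bullet> (subvec blk i (xs - x) - d i x))"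
    by (intro sum_mono residualD(3)[OF v edom_F_gb[OF xs_dom]])
  also have "\<dots> = (\<Sum>i\<in>UNIV. rg i xs) + cross_term x v + grad f x \<bullet> (xs - x - ?D)
      - (\<Sum>i\<in>UNIV. v i \<bullet> d i x + (lam i x)\<^sup>2)"
  proof -
    have "(\<Sum>i\<in>UNIV. grad f x \<bullet> (subvec blk i (xs - x) - d i x)) = grad f x \<bullet> (xs - x - ?D)"
      by (simp add: inner_sum_right[symmetric] sum_subtractf sum_subvec full_step_def)
    moreover have "(v i + grad f x + H x *v d i x) \<bullet> (subvec blk i (xs - x) - d i x)
      = (v i + H x *v d i x) \<bullet> subvec blk i (xs - x) + grad f x \<bullet> (subvec blk i (xs - x) - d i x)
        - (v i \<bullet> d i x + (lam i x)\<^sup>2)" for i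
      by (simp add: inner_add_left inner_diff_right lam_square[OF dom] inner_commute[of "H x *v d i x"])
    ultimately show ?thesis by (simp add: cross_term_def sum.distrib sum_subtractf)
  qed
  finally have "0 \<le> cross_term x v + grad f x \<bullet> (xs - x - ?D) + grad f xs \<bullet> (full_step x - xs)
      - (\<Sum>i\<in>UNIV. v i \<bullet> d i x + (lam i x)\<^sup>2)"
    using first_order_optimality[of "full_step x"] residualD(2)[OF v] by simp
  moreover have "grad f x \<bullet> (xs - x - ?D) + grad f xs \<bullet> (full_step x - xs)
      = - ((grad f x - grad f xs) \<bullet> (x - xs)) - (grad f x - grad f xs) \<bullet> ?D"
    by (simp add: inner_diff_left inner_diff_right)
  moreover have "0 \<le> (\<Sum>i\<in>UNIV. v i \<bullet> d i x + (lam i x)\<^sup>2)"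
  proof (intro sum_nonneg)
    fix i
    have "\<eta> * (lam i x)\<^sup>2 \<le> 1 * (lam i x)\<^sup>2" using \<eta> by (intro mult_right_mono) auto
    thus "0 \<le> v i \<bullet> d i x + (lam i x)\<^sup>2" using residual_direction[OF dom v, of i] by linarith
  qed
  moreover have "- ((grad f x - grad f xs) \<bullet> ?D) \<le> L * norm (x - xs) * (?\<Lambda> / sqrt \<sigma>)"
  proof -
    have "- ((grad f x - grad f xs) \<bullet> ?D) \<le> norm (grad f x - grad f xs) * norm ?D"
      using Cauchy_Schwarz_ineq2[of "grad f x - grad f xs" ?D] by linarith
    also have "\<dots> \<le> (L * norm (x - xs)) * (?\<Lambda> / sqrt \<sigma>)"
      using L_pos by (intro mult_mono grad_lipschitz norm_full_step_le x xs_S) auto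
    finally show ?thesis .
  qed
  moreover have "\<sigma> * (norm (x - xs) * norm (x - xs)) \<le> (grad f x - grad f xs) \<bullet> (x - xs)"
    using grad_strongly_monotone[OF x xs_S] by (simp add: power2_norm_eq_inner[symmetric] power2_eq_square)
  ultimately have "\<sigma> * (norm (x - xs) * norm (x - xs)) \<le>
      (1 + \<eta>) * sqrt L * ?\<Lambda> * norm (x - xs) + L * norm (x - xs) * (?\<Lambda> / sqrt \<sigma>)"
    using cross_term_le[OF x v] by linarith
  hence "(\<sigma> * norm (x - xs)) * norm (x - xs) \<le>
      (((1 + \<eta>) * sqrt L + L / sqrt \<sigma>) * ?\<Lambda>) * norm (x - xs)"
    by (simp add: algebra_simps)
  hence "\<sigma> * norm (x - xs) \<le> ((1 + \<eta>) * sqrt L + L / sqrt \<sigma>) * ?\<Lambda>"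
    using False by (simp add: mult_le_cancel_right)
  hence "norm (x - xs) \<le> ((1 + \<eta>) * sqrt L + L / sqrt \<sigma>) * ?\<Lambda> / \<sigma>"
    using sigma_pos by (simp add: pos_le_divide_eq mult.commute)
  also have "\<dots> = ((1 + \<eta>) * sqrt L / \<sigma> + L / (\<sigma> * sqrt \<sigma>)) * ?\<Lambda>"
  proof -
    have "(a + b / s) * z / t = (a / t + b / (t * s)) * z" if "s \<noteq> 0" "t \<noteq> 0" for a b s t z :: real
      using that by (simp add: field_simps)
    thus ?thesis using sigma_pos by simp
  qed
  finally show ?thesis .
qed

text \<open>The coefficient in \<open>c2\<close> that bounds the cross term relative to \<open>\<Lambda>\<^sup>2\<close>.\<close>

definition cross_const :: real where
  "cross_const = (L / \<sigma>) powr (3/2) * (2 * (1 - \<eta>\<^sup>2) / (c1 * sqrt (real CARD('b))))"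

text \<open>Inserting the error bound gives the factor \<open>(1 + \<eta>)(2 + \<eta>) (L/\<sigma>)\<^sup>3\<^sup>/\<^sup>2\<close>, and \<open>c1 \<surd>n \<le> (1 - \<eta>)/(2 + \<eta>)\<close> makes this
  at most half of \<open>cross_const\<close>.\<close>

lemma cross_term_le_decrement:
  assumes x: "x \<in> S" and v: "residual x v"
  shows "cross_term x v \<le> cross_const * total_decrement x"
proof -
  let ?\<kappa> = "L / \<sigma>" and ?\<Lambda> = "sqrt (total_decrement x)"
  have \<kappa>: "1 \<le> ?\<kappa>" using sigma_pos sigma_le_L by simp
  have \<kappa>32: "?\<kappa> powr (3/2) = ?\<kappa> * sqrt ?\<kappa>" using \<kappa> by (intro powr_three_halves) simp
  have "cross_term x v \<le> (1 + \<eta>) * sqrt L * ?\<Lambda> * norm (x - xs)" by (rule cross_term_le[OF x v])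
  also have "\<dots> \<le> (1 + \<eta>) * sqrt L * ?\<Lambda> *
      (((1 + \<eta>) * sqrt L / \<sigma> + L / (\<sigma> * sqrt \<sigma>)) * ?\<Lambda>)"
    using \<eta> L_pos total_decrement_nonneg[of x]
    by (intro mult_left_mono error_bound[OF x] mult_nonneg_nonneg) auto
  also have "\<dots> = (1 + \<eta>) * ((1 + \<eta>) * (sqrt L * sqrt L) / \<sigma> + L / \<sigma> * (sqrt L / sqrt \<sigma>)) * (?\<Lambda> * ?\<Lambda>)"
  proof -
    have "a * s * z * ((a * s / t + l / (t * r)) * z) = a * (a * (s * s) / t + l / t * (s / r)) * (z * z)"
      for a s z t l r :: real by (simp add: algebra_simps)
    thus ?thesis .
  qed
  also have "\<dots> = (1 + \<eta>) * ((1 + \<eta>) * ?\<kappa> + ?\<kappa> * sqrt ?\<kappa>) * total_decrement x"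
    using L_pos total_decrement_nonneg[of x] by (simp add: real_sqrt_divide)
  also have "\<dots> \<le> (1 + \<eta>) * ((1 + \<eta>) * (?\<kappa> * sqrt ?\<kappa>) + ?\<kappa> * sqrt ?\<kappa>) * total_decrement x"
  proof -
    have "?\<kappa> * 1 \<le> ?\<kappa> * sqrt ?\<kappa>" using \<kappa> by (intro mult_left_mono) auto
    thus ?thesis using \<eta> total_decrement_nonneg[of x]
      by (intro mult_right_mono mult_left_mono add_right_mono) auto
  qed
  also have "\<dots> = (?\<kappa> powr (3/2) * ((1 + \<eta>) * (2 + \<eta>))) * total_decrement x"
  proof -
    have "(1 + \<eta>) * ((1 + \<eta>) * c + c) * z = (c * ((1 + \<eta>) * (2 + \<eta>))) * z" for c z :: real
      by (simp add: algebra_simps)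
    thus ?thesis unfolding \<kappa>32 .
  qed
  also have "\<dots> \<le> cross_const * total_decrement x"
    unfolding cross_const_def
  proof (intro mult_right_mono mult_left_mono total_decrement_nonneg)
    let ?c = "c1 * sqrt (real CARD('b))"
    have c: "0 < ?c" using c1_bounds(1) by simp
    have "(1 + \<eta>) * (2 + \<eta>) * ?c \<le> (1 + \<eta>) * (2 + \<eta>) * ((1 - \<eta>) / (2 + \<eta>))"
      using \<eta> by (intro mult_left_mono c1_bounds(2)) auto
    also have "\<dots> = 1 - \<eta>\<^sup>2" using \<eta> by (simp add: field_simps power2_eq_square)
    also have "\<dots> \<le> 2 * (1 - \<eta>\<^sup>2)"
      using \<eta> power_le_one[of \<eta> 2] by simp
    finally show "(1 + \<eta>) * (2 + \<eta>) \<le> 2 * (1 - \<eta>\<^sup>2) / ?c"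
      using c by (simp add: pos_le_divide_eq)
  qed simp
  finally show ?thesis .
qed

text \<open>The subgradient inequalities at the full step, evaluated at \<open>xs\<close>, bound the changes of the \<open>g i\<close>, and convexity
  of \<open>f\<close> bounds the linear term.\<close>

lemma model_change_sum_le:
  assumes x: "x \<in> S" and v: "residual x v"
  shows "(\<Sum>i\<in>UNIV. model_change x v i) \<le> rF xs - rF x + (cross_const - 1) * total_decrement x"
proof -
  note dom = S_dom[OF x]
  have "(\<Sum>i\<in>UNIV. model_change x v i) \<le> (\<Sum>i\<in>UNIV. (rg i xs - rg i x) + grad f x \<bullet> subvec blk i (xs - x)
      + (v i + H x *v d i x) \<bullet> subvec blk i (xs - x) - (lam i x)\<^sup>2)"
  proof (rule sum_mono)
    fix i
    show "model_change x v i \<le> (rg i xs - rg i x) + grad f x \<bullet> subvec blk i (xs - x)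
      + (v i + H x *v d i x) \<bullet> subvec blk i (xs - x) - (lam i x)\<^sup>2"
      using residualD(3)[OF v edom_F_gb[OF xs_dom], of i]
      by (simp add: model_change_def inner_add_left inner_diff_right lam_square[OF dom]
          inner_commute[of "H x *v d i x" "d i x"])
  qed
  also have "\<dots> = (\<Sum>i\<in>UNIV. rg i xs) - (\<Sum>i\<in>UNIV. rg i x) + grad f x \<bullet> (xs - x)
      + cross_term x v - total_decrement x"
    by (simp add: sum.distrib sum_subtractf inner_sum_right[symmetric] sum_subvec cross_term_def
        total_decrement_def)
  also have "\<dots> \<le> rF xs - rF x + cross_const * total_decrement x - total_decrement x"
    using f_above_tangent[OF x xs_S] cross_term_le_decrement[OF x v] by (simp add: rF_def)
  finally show ?thesis by (simp add: algebra_simps)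
qed

text \<open>The blocks enter the mean with the weights \<open>p i / (1 + \<lambda>\<^sub>i) \<ge> t\<close>; the model changes are nonpositive, so
  these weights may be lowered to the common value \<open>t\<close>, after which the blockwise changes add up to the
  change of the full model. The residual and the second-order excess account for \<open>(1/2 + \<eta>) pmax \<Lambda>\<^sup>2\<close>.\<close>

lemma expected_value_le_model:
  assumes x: "x \<in> S" and t: "0 \<le> t" "\<And>i. t \<le> p i / (1 + lam i x)"
  shows "(\<Sum>i\<in>UNIV. p i * rF (next_iterate i x)) \<le> rF x - t * (rF x - rF xs)
    + (t * (cross_const - 1) + (1/2 + \<eta>) * pmax) * total_decrement x"
proof -
  note dom = S_dom[OF x]
  obtain v where v: "residual x v" using residual_exists[OF dom] by blast
  have "(\<Sum>i\<in>UNIV. p i * rF (next_iterate i x)) \<le>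
    (\<Sum>i\<in>UNIV. p i * rF x + t * model_change x v i + (1/2 + \<eta>) * pmax * (lam i x)\<^sup>2)"
  proof (rule sum_mono)
    fix i
    let ?l = "lam i x"
    have l: "0 \<le> ?l" by (rule lam_nonneg[OF dom])
    have "p i * rF (next_iterate i x) \<le> p i * (rF x +
      (1 / (1 + ?l)) * (model_change x v i - v i \<bullet> d i x) + (ln (1 + ?l) - ?l / (1 + ?l)))"
      using next_iterate_bound(2)[OF dom, of i] p_pos[of i]
      by (intro mult_left_mono) (simp_all add: model_change_def inner_add_left)
    also have "\<dots> = p i * rF x + p i / (1 + ?l) * model_change x v i
        + p i * ((1 / (1 + ?l)) * (- (v i \<bullet> d i x)) + (ln (1 + ?l) - ?l / (1 + ?l)))"
      unfolding divide_inverse by (simp add: algebra_simps)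
    also have "p i / (1 + ?l) * model_change x v i \<le> t * model_change x v i"
      using model_change_le[OF dom v, of i] by (intro mult_right_mono_neg t) (simp add: order_trans)
    also have "p i * ((1 / (1 + ?l)) * (- (v i \<bullet> d i x)) + (ln (1 + ?l) - ?l / (1 + ?l)))
        \<le> p i * ((1/2 + \<eta>) * ?l\<^sup>2)"
    proof (rule mult_left_mono)
      have "(1 / (1 + ?l)) * (- (v i \<bullet> d i x)) \<le> (1 / (1 + ?l)) * (\<eta> * ?l\<^sup>2)"
        using residual_direction[OF dom v, of i] l by (intro mult_left_mono) auto
      also have "\<dots> \<le> 1 * (\<eta> * ?l\<^sup>2)" using l \<eta> by (intro mult_right_mono) auto
      finally show "(1 / (1 + ?l)) * (- (v i \<bullet> d i x)) + (ln (1 + ?l) - ?l / (1 + ?l)) \<le> (1/2 + \<eta>) * ?l\<^sup>2"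
        using omega_conj_le[OF l] by (simp add: algebra_simps)
    qed (use p_pos[of i] in simp)
    also have "p i * ((1/2 + \<eta>) * ?l\<^sup>2) \<le> pmax * ((1/2 + \<eta>) * ?l\<^sup>2)"
      using \<eta> by (intro mult_right_mono p_le_pmax) simp
    finally show "p i * rF (next_iterate i x) \<le>
      p i * rF x + t * model_change x v i + (1/2 + \<eta>) * pmax * ?l\<^sup>2" by (simp add: mult_ac)
  qed
  also have "\<dots> = rF x + t * (\<Sum>i\<in>UNIV. model_change x v i) + (1/2 + \<eta>) * pmax * total_decrement x"
    by (simp add: sum.distrib sum_distrib_left sum_distrib_right[symmetric] p_sum total_decrement_def)
  also have "\<dots> \<le> rF x + t * (rF xs - rF x + (cross_const - 1) * total_decrement x)
      + (1/2 + \<eta>) * pmax * total_decrement x"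
    by (intro add_left_mono add_right_mono mult_left_mono model_change_sum_le[OF x v] t)
  finally show ?thesis by (simp add: algebra_simps)
qed

text \<open>A longer direction would decrease \<open>F\<close> by more than the whole gap \<open>F(x0) - Fstar\<close>.\<close>

lemma lam_le:
  assumes gap: "rF x0 \<le> rF xs + omega (c1 / pmin)" and x: "x \<in> S"
  shows "lam i x \<le> 1 / (2 * pmin)"
proof (rule ccontr)
  note dom = S_dom[OF x]
  let ?t = "1 / (2 * pmin)"
  assume "\<not> lam i x \<le> ?t"
  hence "decrease \<eta> ?t < decrease \<eta> (lam i x)"
    using pmin_pos \<eta> by (intro decrease_strict_mono) auto
  also have "\<dots> \<le> rF x - rF (next_iterate i x)" using next_iterate_decrease[OF dom, of i] by simp
  also have "\<dots> \<le> rF x0 - rF xs"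
    using x rF_ge[OF next_iterate_bound(1)[OF dom], of i] by (simp add: S_rF)
  also have "\<dots> \<le> omega (c1 / pmin)" using gap by simp
  also have "\<dots> \<le> omega (2 * ((1 - \<eta>) / (2 + \<eta>)) * ?t)"
  proof (rule omega_mono)
    have "1 \<le> real CARD('b)" by (simp add: Suc_le_eq)
    hence "c1 * 1 \<le> c1 * sqrt (real CARD('b))"
      using c1_bounds(1) by (intro mult_left_mono) auto
    hence "c1 \<le> (1 - \<eta>) / (2 + \<eta>)" using c1_bounds(2) by simp
    hence "c1 / pmin \<le> (1 - \<eta>) / (2 + \<eta>) / pmin" using pmin_pos by (intro divide_right_mono) auto
    moreover have "2 * a * (1 / (2 * b)) = a / b" for a b :: real by simp
    ultimately show "c1 / pmin \<le> 2 * ((1 - \<eta>) / (2 + \<eta>)) * ?t" by metis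
  qed (use c1_bounds(1) pmin_pos in auto)
  also have "\<dots> \<le> decrease \<eta> ?t"
    using \<eta> pmin_pos order_trans[OF pmin_le p_le_1] by (intro omega_le_decrease) auto
  finally show False by simp
qed

text \<open>The decrease for block \<open>i\<close> is at least \<open>\<lambda>\<^sub>i\<^sup>2 / (4 (1 + \<lambda>\<^sub>i))\<close>, and \<open>1 + \<lambda>\<^sub>i \<le> 3 / (2 pmin)\<close>.\<close>

lemma expected_value_decrease:
  assumes gap: "rF x0 \<le> rF xs + omega (c1 / pmin)" and x: "x \<in> S"
  shows "(\<Sum>i\<in>UNIV. p i * rF (next_iterate i x)) \<le> rF x - pmin\<^sup>2 / 6 * total_decrement x"
proof -
  note dom = S_dom[OF x]
  have "(\<Sum>i\<in>UNIV. p i * rF (next_iterate i x)) \<le> (\<Sum>i\<in>UNIV. p i * rF x - pmin\<^sup>2 / 6 * (lam i x)\<^sup>2)"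
  proof (rule sum_mono)
    fix i
    let ?l = "lam i x"
    have l: "0 \<le> ?l" by (rule lam_nonneg[OF dom])
    have "pmin\<^sup>2 / 6 * ?l\<^sup>2 = pmin * ((1/4) * ?l\<^sup>2 / (3 / (2 * pmin)))"
      by (simp add: power2_eq_square)
    also have "\<dots> \<le> p i * ((1/2 - \<eta>) * ?l\<^sup>2 / (1 + ?l))"
    proof (intro mult_mono frac_le mult_right_mono)
      have "1 \<le> 1 / pmin" using order_trans[OF pmin_le p_le_1] pmin_pos by simp
      thus "1 + ?l \<le> 3 / (2 * pmin)" using lam_le[OF gap x, of i] by (simp add: field_simps)
    qed (use \<eta> l pmin_pos pmin_le[of i] p_pos[of i] in auto)
    also have "\<dots> \<le> p i * decrease \<eta> ?l"
      using p_pos[of i] by (intro mult_left_mono decrease_lower[OF l]) auto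
    also have "\<dots> \<le> p i * (rF x - rF (next_iterate i x))"
      using next_iterate_decrease[OF dom, of i] p_pos[of i] by (intro mult_left_mono) auto
    finally show "p i * rF (next_iterate i x) \<le> p i * rF x - pmin\<^sup>2 / 6 * ?l\<^sup>2"
      by (simp add: algebra_simps)
  qed
  also have "\<dots> = rF x - pmin\<^sup>2 / 6 * total_decrement x"
    by (simp only: sum_subtractf sum_distrib_left[symmetric] sum_distrib_right[symmetric] p_sum
        total_decrement_def mult_1_left)
  finally show ?thesis .
qed

lemma theta_le:
  assumes x: "x \<in> S"
  shows "\<theta> \<le> p i / (1 + lam i x)"
proof -
  have "0 \<le> p i / (1 + lam i y)" if "y \<in> S" for y
    using lam_nonneg[OF S_dom[OF that], of i] p_pos[of i] by (intro divide_nonneg_nonneg) auto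
  hence "bdd_below ((\<lambda>y. p i / (1 + lam i y)) ` S)" by (rule bdd_belowI2)
  hence "(INF y\<in>S. p i / (1 + lam i y)) \<le> p i / (1 + lam i x)" by (rule cINF_lower) (rule x)
  moreover have "\<theta> \<le> (INF y\<in>S. p i / (1 + lam i y))"
    unfolding theta_const_def by (intro Min_le) auto
  ultimately show ?thesis by simp
qed

lemma theta_pos:
  assumes gap: "rF x0 \<le> rF xs + omega (c1 / pmin)"
  shows "0 < \<theta>"
proof -
  have "pmin / (1 + 1 / (2 * pmin)) \<le> (INF y\<in>S. p i / (1 + lam i y))" for i
  proof (rule cINF_greatest)
    fix y assume y: "y \<in> S"
    show "pmin / (1 + 1 / (2 * pmin)) \<le> p i / (1 + lam i y)"
      using lam_le[OF gap y, of i] lam_nonneg[OF S_dom[OF y], of i] pmin_pos pmin_le[of i]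
      by (intro frac_le) auto
  qed (use x0_S in blast)
  hence "pmin / (1 + 1 / (2 * pmin)) \<le> \<theta>" unfolding theta_const_def by (intro Min.boundedI) auto
  moreover have "0 < pmin / (1 + 1 / (2 * pmin))" using pmin_pos by (intro divide_pos_pos add_pos_pos) auto
  ultimately show ?thesis by simp
qed

text \<open>With a single block all of the mass is on it, and \<open>\<theta> < 1\<close> needs \<open>\<lambda> > 0\<close> somewhere in \<open>S\<close>. By the error
  bound \<open>\<lambda>\<close> is positive at every point of \<open>S\<close> other than the minimiser.\<close>

lemma theta_less_1:
  assumes "CARD('b) > 1 \<or> rF x0 \<noteq> rF xs"
  shows "\<theta> < 1"
proof -
  have "\<exists>i. p i < 1 \<or> 0 < lam i x0"
  proof (rule ccontr)
    assume "\<not> ?thesis"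
    hence p: "1 \<le> p i" and l: "lam i x0 = 0" for i
      using lam_nonneg[OF x0_dom, of i] by (auto simp: not_less intro: antisym)
    have "real CARD('b) \<le> (\<Sum>i\<in>UNIV. p i)" using sum_mono[of UNIV "\<lambda>_. 1" p] p by simp
    hence "\<not> CARD('b) > 1" using p_sum by simp
    moreover have "x0 = xs" using error_bound[OF x0_S] l by (simp add: total_decrement_def)
    ultimately show False using assms by simp
  qed
  then obtain i where i: "p i < 1 \<or> 0 < lam i x0" by blast
  hence "p i < 1 + lam i x0" using p_le_1[of i] lam_nonneg[OF x0_dom, of i] by auto
  hence "p i / (1 + lam i x0) < 1" using lam_nonneg[OF x0_dom, of i] by simp
  with theta_le[OF x0_S, of i] show ?thesis by simp
qed

abbreviation c2 :: real where "c2 \<equiv> c2_const blk f d p \<eta> S"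
abbreviation \<rho> :: real where "\<rho> \<equiv> (6 * c2 + pmin\<^sup>2 * (1 - \<theta>)) / (6 * c2 + pmin\<^sup>2)"

lemma expected_gap_contraction:
  assumes gap: "rF x0 \<le> rF xs + omega (c1 / pmin)" and x: "x \<in> S"
  shows "(\<Sum>i\<in>UNIV. p i * (rF (next_iterate i x) - rF xs)) \<le> \<rho> * (rF x - rF xs)"
proof -
  let ?E = "(\<Sum>i\<in>UNIV. p i * (rF (next_iterate i x) - rF xs))"
  have E: "?E = (\<Sum>i\<in>UNIV. p i * rF (next_iterate i x)) - rF xs"
    by (simp add: right_diff_distrib sum_subtractf sum_distrib_right[symmetric] p_sum)
  have c2: "c2 = \<bar>\<theta> * (cross_const - 1) + (1/2 + \<eta>) * pmax\<bar>"
    by (simp add: c2_const_def cross_const_def)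
  have "(\<theta> * (cross_const - 1) + (1/2 + \<eta>) * pmax) * total_decrement x \<le> c2 * total_decrement x"
    unfolding c2 by (intro mult_right_mono total_decrement_nonneg) simp
  hence A: "?E \<le> (1 - \<theta>) * (rF x - rF xs) + c2 * total_decrement x"
    using expected_value_le_model[OF x less_imp_le[OF theta_pos[OF gap]] theta_le[OF x]] E
    by (simp add: algebra_simps)
  have B: "?E \<le> (rF x - rF xs) - pmin\<^sup>2 / 6 * total_decrement x"
    using expected_value_decrease[OF gap x] E by simp
  have c2_nonneg: "0 \<le> c2" by (simp add: c2)
  have "pmin\<^sup>2 * ?E + 6 * c2 * ?E \<le> pmin\<^sup>2 * ((1 - \<theta>) * (rF x - rF xs) + c2 * total_decrement x)
      + 6 * c2 * ((rF x - rF xs) - pmin\<^sup>2 / 6 * total_decrement x)"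
    using c2_nonneg by (intro add_mono mult_left_mono A B) auto
  hence "(6 * c2 + pmin\<^sup>2) * ?E \<le> (6 * c2 + pmin\<^sup>2 * (1 - \<theta>)) * (rF x - rF xs)"
    by (simp add: algebra_simps)
  moreover have "0 < 6 * c2 + pmin\<^sup>2" using c2_nonneg pmin_pos by (intro add_nonneg_pos) auto
  ultimately show ?thesis by (simp add: pos_le_divide_eq mult.commute)
qed

lemma rho_nonneg: "0 \<le> \<rho>"
proof -
  have "p i / (1 + lam i x0) \<le> 1" for i
    using p_le_1[of i] lam_nonneg[OF x0_dom, of i] by simp
  hence "\<theta> \<le> 1" using theta_le[OF x0_S] order_trans by blast
  moreover have "0 \<le> c2" by (simp add: c2_const_def)
  ultimately show ?thesis using pmin_pos by (intro divide_nonneg_nonneg add_nonneg_nonneg mult_nonneg_nonneg) auto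
qed

lemma rbpdn_eq_random_path: "rbpdn blk f d x0 c k = random_path next_iterate x0 c k"
  by (induction k) (simp_all add: next_iterate_def Let_def)

lemma expected_gap:
  fixes M :: "'w measure"
  assumes gap: "rF x0 \<le> rF xs + omega (c1 / pmin)"
    and M: "prob_space M" and ind: "prob_space.indep_vars M (\<lambda>_. count_space UNIV) \<iota> UNIV"
    and dist: "\<And>k i. measure M {w \<in> space M. \<iota> k w = i} = p i"
  shows "(\<integral>\<^sup>+ w. e2ennreal (F (rbpdn blk f d x0 (\<lambda>j. \<iota> j w) k) - F xs) \<partial>M)
    \<le> ennreal (\<rho> ^ k) * e2ennreal (F x0 - F xs)"
proof -
  interpret prob_space M by (rule M)
  define \<Phi> where "\<Phi> x = e2ennreal (F x - F xs)" for x
  have \<Phi>: "\<Phi> x = ennreal (rF x - rF xs)" if "x \<in> S" for x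
    by (simp add: \<Phi>_def F_real S_dom[OF that] xs_dom e2ennreal_ereal)
  have "(\<integral>\<^sup>+ w. \<Phi> (random_path next_iterate x0 (\<lambda>j. \<iota> j w) k) \<partial>M) \<le> ennreal \<rho> ^ k * \<Phi> x0"
  proof (rule expected_contraction[OF ind dist x0_S next_iterate_S])
    fix x assume x: "x \<in> S"
    have "(\<Sum>i\<in>UNIV. ennreal (p i) * \<Phi> (next_iterate i x))
      = (\<Sum>i\<in>UNIV. ennreal (p i * (rF (next_iterate i x) - rF xs)))"
      using p_pos rF_ge[OF S_dom[OF next_iterate_S[OF x]]]
      by (intro sum.cong refl) (simp add: \<Phi> next_iterate_S[OF x] ennreal_mult less_imp_le)
    also have "\<dots> = ennreal (\<Sum>i\<in>UNIV. p i * (rF (next_iterate i x) - rF xs))"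
      using p_pos rF_ge[OF S_dom[OF next_iterate_S[OF x]]]
      by (intro sum_ennreal mult_nonneg_nonneg) (auto simp: less_imp_le)
    also have "\<dots> \<le> ennreal (\<rho> * (rF x - rF xs))"
      by (intro ennreal_leI expected_gap_contraction[OF gap x])
    also have "\<dots> = ennreal \<rho> * \<Phi> x"
      unfolding \<Phi>[OF x] using rF_ge[OF S_dom[OF x]] by (intro ennreal_mult rho_nonneg) simp
    finally show "(\<Sum>i\<in>UNIV. ennreal (p i) * \<Phi> (next_iterate i x)) \<le> ennreal \<rho> * \<Phi> x" .
  qed
  thus ?thesis
    using rho_nonneg by (simp add: \<Phi>_def rbpdn_eq_random_path ennreal_power)
qed

end

theorem theorem4p2:
  fixes blk :: "'n::finite \<Rightarrow> 'b::finite"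
    and f :: "real^'n \<Rightarrow> ereal"
    and g :: "'b \<Rightarrow> real^'n \<Rightarrow> ereal"
    and d :: "'b \<Rightarrow> real^'n \<Rightarrow> real^'n"
    and p :: "'b \<Rightarrow> real"
    and \<eta> :: real
    and x0 :: "real^'n"
    and M :: "'w measure"
    and \<iota> :: "nat \<Rightarrow> 'w \<Rightarrow> 'b"
  defines "F \<equiv> objective blk f g"
  defines "Fstar \<equiv> (INF x. F x)"
  defines "S \<equiv> sublevel F x0"
  defines "c1 \<equiv> c1_const blk f \<eta> S"
  defines "c2 \<equiv> c2_const blk f d p \<eta> S"
  defines "\<theta> \<equiv> theta_const blk f d p S"
  defines "pmin \<equiv> p_min p"
  assumes "surj blk"
    and "self_concordant f"
    and "\<And>i. proper_on (block_space blk i) (g i)"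
    and "\<And>i. closed_convex_on (block_space blk i) (g i)"
    and "continuous_on (edom F) (hessian f)"
    and "\<And>x. x \<in> edom F \<Longrightarrow> pos_def (hessian f x)"
    and "\<exists>!x. is_arg_min F (\<lambda>_. True) x"
    and "x0 \<in> edom F"
    and "\<eta> \<in> {0..1/4}"
    and "\<And>i. 0 < p i"
    and "(\<Sum>i\<in>UNIV. p i) = 1"
    and "\<And>x i. x \<in> edom F \<Longrightarrow> approx_direction blk f g \<eta> i x (d i x)"
    and "prob_space M"
    and "prob_space.indep_vars M (\<lambda>_. count_space UNIV) \<iota> UNIV"
    and "\<And>k i. measure M {w \<in> space M. \<iota> k w = i} = p i"
    and "F x0 \<le> Fstar + ereal (omega (c1 / pmin))"
  shows "0 < \<theta> \<and> (CARD('b) > 1 \<or> F x0 \<noteq> Fstar \<longrightarrow> \<theta> < 1) \<and>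
    (\<forall>k. (\<integral>\<^sup>+ w. e2ennreal (F (rbpdn blk f d x0 (\<lambda>j. \<iota> j w) k) - Fstar) \<partial>M)
       \<le> ennreal (((6 * c2 + pmin\<^sup>2 * (1 - \<theta>)) / (6 * c2 + pmin\<^sup>2)) ^ k)
          * e2ennreal (F x0 - Fstar))"
proof -
  interpret rbpdn_setting blk f g d p \<eta> x0
    using assms(9-19) unfolding F_def by unfold_locales auto
  have Fstar: "Fstar = ereal (rF xs)" unfolding Fstar_def F_def by (rule INF_F)
  have F_x0: "F x0 = ereal (rF x0)" unfolding F_def by (rule F_real[OF x0_dom])
  have gap: "rF x0 \<le> rF xs + omega (c1_const blk f \<eta> (sublevel (objective blk f g) x0) / p_min p)"
    using assms(23) unfolding Fstar F_x0 unfolding c1_def S_def pmin_def F_def by simp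
  show ?thesis
    using theta_pos[OF gap] theta_less_1 expected_gap[OF gap assms(20-22)]
    unfolding \<theta>_def c2_def pmin_def S_def Fstar F_x0
    unfolding F_def F_real[OF xs_dom] F_real[OF x0_dom] by auto
qed

end
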